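(* For all cubical $\omega$-categories $\mathbf C$ and $\mathbf D$, the cubical $\omega$-category $\mathbf{PsLax}(\mathbf C,\mathbf D)$ of pseudo lax transfors from $\mathbf C$ to $\mathbf D$ and the cubical $\omega$-category $\mathbf{PsOpLax}(\mathbf C,\mathbf D)$ of pseudo oplax transfors from $\mathbf C$ to $\mathbf D$ are isomorphic.
   Context: Index notation: for positive integers $i,j$, $j^i=j$ if $j<i$ and $j^i=j+1$ if $j\ge i$; for $j\neq i$, $j_i=j$ if $j<i$ and $j_i=j-1$ if $j>i$. Cubical $\omega$-categories (always with connections): a cubical $\omega$-category $\mathbf C$ consists of sets $\mathbf C_n$ ($n\ge0$), maps $\partial_i^\alpha:\mathbf C_n\to\mathbf C_{n-1}$ and $\Gamma_i^\alpha:\mathbf C_n\to\mathbf C_{n+1}$ ($n\ge1$, $1\le i\le n$, $\alpha=\pm$), maps $\epsilon_i:\mathbf C_n\to\mathbf C_{n+1}$ ($n\ge0$, $1\le i\le n+1$), and partial operations $\star_i$ on $\mathbf C_n$ ($1\le i\le n$), with $A\star_iB$ defined exactly when $\partial_i^+A=\partial_i^-B$, subject to (for all indices and cells for which both sides make sense): - $\partial_{j-1}^\alpha\partial_i^\beta=\partial_i^\beta\partial_j^\alpha$ for $i<j$; - $\partial_i^\alpha\epsilon_j=\epsilon_{j_i}\partial_{i_j}^\alpha$ for $i\ne j$, and $\partial_i^\alpha\epsilon_i=\mathrm{id}$; - $\partial_i^\alpha\Gamma_j^\beta=\Gamma_{j_i}^\beta\partial_{i_j}^\alpha$ for $i\ne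 j,j+1$; for $i\in\{j,j+1\}$, $\partial_i^\alpha\Gamma_j^\alpha=\mathrm{id}$ and $\partial_i^\alpha\Gamma_j^{-\alpha}=\epsilon_j\partial_j^\alpha$; - $\epsilon_i\epsilon_j=\epsilon_{j+1}\epsilon_i$ for $i\le j$; $\Gamma_i^\alpha\Gamma_j^\beta=\Gamma_{j+1}^\beta\Gamma_i^\alpha$ for $i<j$; $\Gamma_{i+1}^\alpha\Gamma_i^\alpha=\Gamma_i^\alpha\Gamma_i^\alpha$; $\Gamma_i^\alpha\epsilon_j=\epsilon_{j^i}\Gamma_{i_j}^\alpha$ for $i\ne j$; $\Gamma_i^\alpha\epsilon_i=\epsilon_i\epsilon_i$; - $\partial_i^\alpha(A\star_jB)=\partial_i^\alpha A\star_{j_i}\partial_i^\alpha B$ for $i\neq j$; $\partial_i^-(A\star_iB)=\partial_i^-A$; $\partial_i^+(A\star_iB)=\partial_i^+B$; - $\star_i$ is associative; $A\star_i\epsilon_i\partial_i^+A=\epsilon_i\partial_i^-A\star_iA=A$; $(A\star_iB)\star_j(C\star_iD)=(A\star_jC)\star_i(B\star_jD)$ for $i\neq j$; - $\epsilon_i(A\star_jB)=\epsilon_iA\star_{j^i}\epsilon_iB$; $\Gamma_i^\alpha(A\star_jB)=\Gamma_i^\alpha A\star_{j^i}\Gamma_i^\alpha B$ for $i\ne j$; $\Gamma_i^-(A\star_iB)=(\Gamma_i^-A\star_i\epsilon_{i+1}B)\star_{i+1}(\epsilon_iB\star_i\Gamma_i^-B)$; $\Gamma_i^+(A\star_iB)=(\Gamma_i^+A\star_i\epsilon_iA)\star_{i+1}(\epsilon_{i+1}A\star_i\Gamma_i^+B)$;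 - $\Gamma_i^+A\star_i\Gamma_i^-A=\epsilon_{i+1}A$; $\Gamma_i^+A\star_{i+1}\Gamma_i^-A=\epsilon_iA$. $T_i$-inverses. For $1\le i<n$, $A\in\mathbf C_n$ is $T_i$-invertible with $T_i$-inverse $B\in\mathbf C_n$ (written $T_iA$; it is unique) if $\partial_i^\alpha A=\partial_{i+1}^\alpha B$ and $\partial_{i+1}^\alpha A=\partial_i^\alpha B$ for $\alpha=\pm$, and $(\Gamma_i^+\partial_{i+1}^-A\star_iB)\star_{i+1}(A\star_i\Gamma_i^-\partial_i^+A)=\Gamma_i^-\partial_i^-A\star_i\Gamma_i^+\partial_{i+1}^+A$, together with the same equation with $A$ and $B$ exchanged. $\sigma$-invertibility. $S_n$ acts on the right on $\{1,\dots,n\}$, $k\mapsto k\cdot\sigma$, so $k\cdot(\sigma\tau)=(k\cdot\sigma)\cdot\tau$; $\tau_i$ is the transposition of $i,i+1$. For a word $u=T_{i_1}\cdots T_{i_r}$ in letters $T_1,\dots,T_{n-1}$ representing $\tau_{i_1}\cdots\tau_{i_r}\in S_n$, define recursively: every $A\in\mathbf C_n$ is $1$-invertible with $1\cdot A=A$; $A$ is $(T_iu)$-invertible if $A$ is $u$-invertible and $u\cdot A$ is $T_i$-invertible, and then $(T_iu)\cdot A=T_i(u\cdot A)$. For $\sigma\in S_n$, $A\in\mathbf C_n$ is $\sigma$-invertible if it is $u$-invertible for some word $u$ of minimal length representing $\sigma$, and then $\sigma\cdot A:=u\cdot A$ (this is independent of the minimal word chosen). Transfors. A lax $p$-transfor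 $F$ from $\mathbf C$ to $\mathbf D$ is a family of maps $F_n:\mathbf C_n\to\mathbf D_{n+p}$ ($n\ge0$) such that $\partial_{p+i}^\alpha F_n(A)=F_{n-1}(\partial_i^\alpha A)$, $F_n(\epsilon_iA)=\epsilon_{p+i}F_{n-1}(A)$, $F_n(\Gamma_i^\alpha A)=\Gamma_{p+i}^\alpha F_{n-1}(A)$, $F_n(A\star_iB)=F_n(A)\star_{p+i}F_n(B)$. An oplax $p$-transfor is such a family satisfying instead the same equations with every index $p+i$ replaced by $i$. Lax $p$-transfors are the $p$-cells of a cubical $\omega$-category $\mathbf{Lax}(\mathbf C,\mathbf D)$ with $(\partial_i^\alpha F)_n(A)=\partial_i^\alpha(F_n(A))$, $(\epsilon_iF)_n(A)=\epsilon_i(F_n(A))$, $(\Gamma_i^\alpha F)_n(A)=\Gamma_i^\alpha(F_n(A))$, $(F\star_iG)_n(A)=F_n(A)\star_iG_n(A)$. Oplax $p$-transfors are the $p$-cells of a cubical $\omega$-category $\mathbf{OpLax}(\mathbf C,\mathbf D)$ with the same formulas, with index $i$ on the right-hand sides replaced by $n+i$. Pseudo transfors. Let $\rho_{n,m}\in S_{n+m}$ be given by $i\cdot\rho_{n,m}=i+m$ for $i\le n$ and $i\cdot\rho_{n,m}=i-n$ for $i>n$. A lax (resp. oplax) $p$-transfor $F$ is pseudo if for all $n$ and all $A\in\mathbf C_n$, $F_n(A)$ is $\rho_{n,p}$-invertible (resp. $\rho_{p,n}$-invertible). Pseudo lax (resp. pseudo oplax) transfors are closed under all operations and form the cubical $\omega$-category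 $\mathbf{PsLax}(\mathbf C,\mathbf D)\subseteq\mathbf{Lax}(\mathbf C,\mathbf D)$ (resp. $\mathbf{PsOpLax}(\mathbf C,\mathbf D)\subseteq\mathbf{OpLax}(\mathbf C,\mathbf D)$). *)

theory Defs
  imports "HOL-Library.FuncSet" "HOL-Combinatorics.Transposition"
begin

datatype polarity = Minus | Plus

text \<open>
  The number in front of the index is the dimension of the argument cell. It is a parameter
  because the sets of cells of different dimensions need not be disjoint. All operations are
  total functions; they are only meaningful on cells of the stated dimension and for indices in
  range, and compositions only on composable pairs.
\<close>

record 'a cubical =
  cells :: "nat \<Rightarrow> 'a set"
  face :: "nat \<Rightarrow> nat \<Rightarrow> polarity \<Rightarrow> 'a \<Rightarrow> 'a"
  degen :: "nat \<Rightarrow> nat \<Rightarrow> 'a \<Rightarrow> 'a"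
  conn :: "nat \<Rightarrow> nat \<Rightarrow> polarity \<Rightarrow> 'a \<Rightarrow> 'a"
  cube_comp :: "nat \<Rightarrow> nat \<Rightarrow> 'a \<Rightarrow> 'a \<Rightarrow> 'a"

text \<open>\<open>up j i\<close> is $j^i$ and \<open>down j i\<close> is $j_i$; the latter is only used for $j \neq i$.\<close>

definition up :: "nat \<Rightarrow> nat \<Rightarrow> nat" where
  "up j i = (if j < i then j else j + 1)"

definition down :: "nat \<Rightarrow> nat \<Rightarrow> nat" where
  "down j i = (if j < i then j else j - 1)"

definition composable :: "'a cubical \<Rightarrow> nat \<Rightarrow> nat \<Rightarrow> 'a \<Rightarrow> 'a \<Rightarrow> bool" where
  "composable C n i A B \<longleftrightarrow> 1 \<le> i \<and> i \<le> n \<and> A \<in> cells C n \<and> B \<in> cells C n \<and>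
     face C n i Plus A = face C n i Minus B"

locale cubical_omega_category =
  fixes C :: "'a cubical"
  assumes face_cell:
      "\<lbrakk>A \<in> cells C n; 1 \<le> i; i \<le> n\<rbrakk> \<Longrightarrow> face C n i \<alpha> A \<in> cells C (n - 1)"
    and degen_cell:
      "\<lbrakk>A \<in> cells C n; 1 \<le> i; i \<le> n + 1\<rbrakk> \<Longrightarrow> degen C n i A \<in> cells C (n + 1)"
    and conn_cell:
      "\<lbrakk>A \<in> cells C n; 1 \<le> i; i \<le> n\<rbrakk> \<Longrightarrow> conn C n i \<alpha> A \<in> cells C (n + 1)"
    and comp_cell:
      "composable C n i A B \<Longrightarrow> cube_comp C n i A B \<in> cells C n"
    and face_face:
      "\<lbrakk>A \<in> cells C n; 1 \<le> i; i < j; j \<le> n\<rbrakk> \<Longrightarrow>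
        face C (n - 1) (j - 1) \<alpha> (face C n i \<beta> A) = face C (n - 1) i \<beta> (face C n j \<alpha> A)"
    and face_degen:
      "\<lbrakk>A \<in> cells C n; 1 \<le> i; i \<le> n + 1; 1 \<le> j; j \<le> n + 1; i \<noteq> j\<rbrakk> \<Longrightarrow>
        face C (n + 1) i \<alpha> (degen C n j A) =
        degen C (n - 1) (down j i) (face C n (down i j) \<alpha> A)"
    and face_degen_same:
      "\<lbrakk>A \<in> cells C n; 1 \<le> i; i \<le> n + 1\<rbrakk> \<Longrightarrow> face C (n + 1) i \<alpha> (degen C n i A) = A"
    and face_conn:
      "\<lbrakk>A \<in> cells C n; 1 \<le> i; i \<le> n + 1; 1 \<le> j; j \<le> n; i \<noteq> j; i \<noteq> j + 1\<rbrakk> \<Longrightarrow>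
        face C (n + 1) i \<alpha> (conn C n j \<beta> A) =
        conn C (n - 1) (down j i) \<beta> (face C n (down i j) \<alpha> A)"
    and face_conn_same:
      "\<lbrakk>A \<in> cells C n; 1 \<le> j; j \<le> n; i = j \<or> i = j + 1\<rbrakk> \<Longrightarrow>
        face C (n + 1) i \<alpha> (conn C n j \<alpha> A) = A"
    and face_conn_opposite:
      "\<lbrakk>A \<in> cells C n; 1 \<le> j; j \<le> n; i = j \<or> i = j + 1; \<beta> \<noteq> \<alpha>\<rbrakk> \<Longrightarrow>
        face C (n + 1) i \<alpha> (conn C n j \<beta> A) = degen C (n - 1) j (face C n j \<alpha> A)"
    and degen_degen:
      "\<lbrakk>A \<in> cells C n; 1 \<le> i; i \<le> j; j \<le> n + 1\<rbrakk> \<Longrightarrow>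
        degen C (n + 1) i (degen C n j A) = degen C (n + 1) (j + 1) (degen C n i A)"
    and conn_conn:
      "\<lbrakk>A \<in> cells C n; 1 \<le> i; i < j; j \<le> n\<rbrakk> \<Longrightarrow>
        conn C (n + 1) i \<alpha> (conn C n j \<beta> A) = conn C (n + 1) (j + 1) \<beta> (conn C n i \<alpha> A)"
    and conn_conn_same:
      "\<lbrakk>A \<in> cells C n; 1 \<le> i; i \<le> n\<rbrakk> \<Longrightarrow>
        conn C (n + 1) (i + 1) \<alpha> (conn C n i \<alpha> A) = conn C (n + 1) i \<alpha> (conn C n i \<alpha> A)"
    and conn_degen:
      "\<lbrakk>A \<in> cells C n; 1 \<le> i; i \<le> n + 1; 1 \<le> j; j \<le> n + 1; i \<noteq> j\<rbrakk> \<Longrightarrow>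
        conn C (n + 1) i \<alpha> (degen C n j A) =
        degen C (n + 1) (up j i) (conn C n (down i j) \<alpha> A)"
    and conn_degen_same:
      "\<lbrakk>A \<in> cells C n; 1 \<le> i; i \<le> n + 1\<rbrakk> \<Longrightarrow>
        conn C (n + 1) i \<alpha> (degen C n i A) = degen C (n + 1) i (degen C n i A)"
    and face_comp:
      "\<lbrakk>composable C n j A B; 1 \<le> i; i \<le> n; i \<noteq> j\<rbrakk> \<Longrightarrow>
        face C n i \<alpha> (cube_comp C n j A B) =
        cube_comp C (n - 1) (down j i) (face C n i \<alpha> A) (face C n i \<alpha> B)"
    and face_comp_Minus:
      "composable C n i A B \<Longrightarrow> face C n i Minus (cube_comp C n i A B) = face C n i Minus A"
    and face_comp_Plus:
      "composable C n i A B \<Longrightarrow> face C n i Plus (cube_comp C n i A B) = face C n i Plus B"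
    and comp_assoc:
      "\<lbrakk>composable C n i A B; composable C n i B E\<rbrakk> \<Longrightarrow>
        cube_comp C n i (cube_comp C n i A B) E = cube_comp C n i A (cube_comp C n i B E)"
    and comp_degen_right:
      "\<lbrakk>A \<in> cells C n; 1 \<le> i; i \<le> n\<rbrakk> \<Longrightarrow>
        cube_comp C n i A (degen C (n - 1) i (face C n i Plus A)) = A"
    and comp_degen_left:
      "\<lbrakk>A \<in> cells C n; 1 \<le> i; i \<le> n\<rbrakk> \<Longrightarrow>
        cube_comp C n i (degen C (n - 1) i (face C n i Minus A)) A = A"
    and interchange:
      "\<lbrakk>composable C n i A B; composable C n i E F; composable C n j A E; composable C n j B F;
        i \<noteq> j\<rbrakk> \<Longrightarrow>
        cube_comp C n j (cube_comp C n i A B) (cube_comp C n i E F) =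
        cube_comp C n i (cube_comp C n j A E) (cube_comp C n j B F)"
    and degen_comp:
      "\<lbrakk>composable C n j A B; 1 \<le> i; i \<le> n + 1\<rbrakk> \<Longrightarrow>
        degen C n i (cube_comp C n j A B) =
        cube_comp C (n + 1) (up j i) (degen C n i A) (degen C n i B)"
    and conn_comp:
      "\<lbrakk>composable C n j A B; 1 \<le> i; i \<le> n; i \<noteq> j\<rbrakk> \<Longrightarrow>
        conn C n i \<alpha> (cube_comp C n j A B) =
        cube_comp C (n + 1) (up j i) (conn C n i \<alpha> A) (conn C n i \<alpha> B)"
    and conn_comp_Minus:
      "composable C n i A B \<Longrightarrow>
        conn C n i Minus (cube_comp C n i A B) =
        cube_comp C (n + 1) (i + 1)
          (cube_comp C (n + 1) i (conn C n i Minus A) (degen C n (i + 1) B))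
          (cube_comp C (n + 1) i (degen C n i B) (conn C n i Minus B))"
    and conn_comp_Plus:
      "composable C n i A B \<Longrightarrow>
        conn C n i Plus (cube_comp C n i A B) =
        cube_comp C (n + 1) (i + 1)
          (cube_comp C (n + 1) i (conn C n i Plus A) (degen C n i A))
          (cube_comp C (n + 1) i (degen C n (i + 1) A) (conn C n i Plus B))"
    and conn_transport:
      "\<lbrakk>A \<in> cells C n; 1 \<le> i; i \<le> n\<rbrakk> \<Longrightarrow>
        cube_comp C (n + 1) i (conn C n i Plus A) (conn C n i Minus A) = degen C n (i + 1) A"
    and conn_transport_Suc:
      "\<lbrakk>A \<in> cells C n; 1 \<le> i; i \<le> n\<rbrakk> \<Longrightarrow>
        cube_comp C (n + 1) (i + 1) (conn C n i Plus A) (conn C n i Minus A) = degen C n i A"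

definition cubical_functor :: "'a cubical \<Rightarrow> 'b cubical \<Rightarrow> (nat \<Rightarrow> 'a \<Rightarrow> 'b) \<Rightarrow> bool" where
  "cubical_functor C D f \<longleftrightarrow>
     (\<forall>n. \<forall>A \<in> cells C n. f n A \<in> cells D n) \<and>
     (\<forall>n i \<alpha>. \<forall>A \<in> cells C n. 1 \<le> i \<and> i \<le> n \<longrightarrow>
        f (n - 1) (face C n i \<alpha> A) = face D n i \<alpha> (f n A)) \<and>
     (\<forall>n i. \<forall>A \<in> cells C n. 1 \<le> i \<and> i \<le> n + 1 \<longrightarrow>
        f (n + 1) (degen C n i A) = degen D n i (f n A)) \<and>
     (\<forall>n i \<alpha>. \<forall>A \<in> cells C n. 1 \<le> i \<and> i \<le> n \<longrightarrow>
        f (n + 1) (conn C n i \<alpha> A) = conn D n i \<alpha> (f n A)) \<and>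
     (\<forall>n i A B. composable C n i A B \<longrightarrow>
        f n (cube_comp C n i A B) = cube_comp D n i (f n A) (f n B))"

definition cubical_isomorphic :: "'a cubical \<Rightarrow> 'b cubical \<Rightarrow> bool" where
  "cubical_isomorphic C D \<longleftrightarrow>
     (\<exists>f. cubical_functor C D f \<and> (\<forall>n. bij_betw (f n) (cells C n) (cells D n)))"

definition T_equation :: "'a cubical \<Rightarrow> nat \<Rightarrow> nat \<Rightarrow> 'a \<Rightarrow> 'a \<Rightarrow> bool" where
  "T_equation C n i A B \<longleftrightarrow>
     cube_comp C n (i + 1)
       (cube_comp C n i (conn C (n - 1) i Plus (face C n (i + 1) Minus A)) B)
       (cube_comp C n i A (conn C (n - 1) i Minus (face C n i Plus A))) =
     cube_comp C n i
       (conn C (n - 1) i Minus (face C n i Minus A))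
       (conn C (n - 1) i Plus (face C n (i + 1) Plus A))"

definition is_T_inverse :: "'a cubical \<Rightarrow> nat \<Rightarrow> nat \<Rightarrow> 'a \<Rightarrow> 'a \<Rightarrow> bool" where
  "is_T_inverse C n i A B \<longleftrightarrow>
     1 \<le> i \<and> i < n \<and> A \<in> cells C n \<and> B \<in> cells C n \<and>
     (\<forall>\<alpha>. face C n i \<alpha> A = face C n (i + 1) \<alpha> B \<and> face C n (i + 1) \<alpha> A = face C n i \<alpha> B) \<and>
     T_equation C n i A B \<and> T_equation C n i B A"

definition T_invertible :: "'a cubical \<Rightarrow> nat \<Rightarrow> nat \<Rightarrow> 'a \<Rightarrow> bool" where
  "T_invertible C n i A \<longleftrightarrow> (\<exists>B. is_T_inverse C n i A B)"

text \<open>In a cubical omega-category there is at most one $T_i$-inverse.\<close>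

definition T_inverse :: "'a cubical \<Rightarrow> nat \<Rightarrow> nat \<Rightarrow> 'a \<Rightarrow> 'a" where
  "T_inverse C n i A = (THE B. is_T_inverse C n i A B)"

text \<open>A word $T_{i_1} \cdots T_{i_r}$ is the list of its indices; its last letter acts first.\<close>

primrec word_act :: "'a cubical \<Rightarrow> nat \<Rightarrow> nat list \<Rightarrow> 'a \<Rightarrow> 'a" where
  "word_act C n [] A = A"
| "word_act C n (i # u) A = T_inverse C n i (word_act C n u A)"

primrec word_invertible :: "'a cubical \<Rightarrow> nat \<Rightarrow> nat list \<Rightarrow> 'a \<Rightarrow> bool" where
  "word_invertible C n [] A \<longleftrightarrow> A \<in> cells C n"
| "word_invertible C n (i # u) A \<longleftrightarrow>
     word_invertible C n u A \<and> T_invertible C n i (word_act C n u A)"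

text \<open>
  Elements of $S_n$ are functions on the naturals that fix everything outside $\{1,\dots,n\}$.
  Permutations act on the right, so a product is evaluated from left to right:
  $k \cdot (\tau_i \sigma) = (k \cdot \tau_i) \cdot \sigma$.
\<close>

primrec word_perm :: "nat list \<Rightarrow> nat \<Rightarrow> nat" where
  "word_perm [] = id"
| "word_perm (i # u) = word_perm u \<circ> transpose i (i + 1)"

definition represents :: "nat \<Rightarrow> nat list \<Rightarrow> (nat \<Rightarrow> nat) \<Rightarrow> bool" where
  "represents n u \<sigma> \<longleftrightarrow> set u \<subseteq> {1..<n} \<and> word_perm u = \<sigma>"

definition perm_invertible :: "'a cubical \<Rightarrow> nat \<Rightarrow> (nat \<Rightarrow> nat) \<Rightarrow> 'a \<Rightarrow> bool" where
  "perm_invertible C n \<sigma> A \<longleftrightarrow>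
     (\<exists>u. is_arg_min length (\<lambda>u. represents n u \<sigma>) u \<and> word_invertible C n u A)"

definition rho :: "nat \<Rightarrow> nat \<Rightarrow> nat \<Rightarrow> nat" where
  "rho n m i =
     (if 1 \<le> i \<and> i \<le> n then i + m else if n < i \<and> i \<le> n + m then i - n else i)"

text \<open>
  A transfor is a family of maps $F_n : C_n \to D_{n+p}$; membership in the extensional function
  space makes two transfors equal as soon as they agree on all cells. The operations on
  transfors restrict their results accordingly.
\<close>

definition lax_transfor :: "'a cubical \<Rightarrow> 'b cubical \<Rightarrow> nat \<Rightarrow> (nat \<Rightarrow> 'a \<Rightarrow> 'b) \<Rightarrow> bool" where
  "lax_transfor C D p F \<longleftrightarrow>
     (\<forall>n. F n \<in> cells C n \<rightarrow>\<^sub>E cells D (n + p)) \<and>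
     (\<forall>n i \<alpha>. \<forall>A \<in> cells C n. 1 \<le> i \<and> i \<le> n \<longrightarrow>
        face D (n + p) (p + i) \<alpha> (F n A) = F (n - 1) (face C n i \<alpha> A)) \<and>
     (\<forall>n i. \<forall>A \<in> cells C n. 1 \<le> i \<and> i \<le> n + 1 \<longrightarrow>
        F (n + 1) (degen C n i A) = degen D (n + p) (p + i) (F n A)) \<and>
     (\<forall>n i \<alpha>. \<forall>A \<in> cells C n. 1 \<le> i \<and> i \<le> n \<longrightarrow>
        F (n + 1) (conn C n i \<alpha> A) = conn D (n + p) (p + i) \<alpha> (F n A)) \<and>
     (\<forall>n i A B. composable C n i A B \<longrightarrow>
        F n (cube_comp C n i A B) = cube_comp D (n + p) (p + i) (F n A) (F n B))"

definition oplax_transfor :: "'a cubical \<Rightarrow> 'b cubical \<Rightarrow> nat \<Rightarrow> (nat \<Rightarrow> 'a \<Rightarrow> 'b) \<Rightarrow> bool" where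
  "oplax_transfor C D p F \<longleftrightarrow>
     (\<forall>n. F n \<in> cells C n \<rightarrow>\<^sub>E cells D (n + p)) \<and>
     (\<forall>n i \<alpha>. \<forall>A \<in> cells C n. 1 \<le> i \<and> i \<le> n \<longrightarrow>
        face D (n + p) i \<alpha> (F n A) = F (n - 1) (face C n i \<alpha> A)) \<and>
     (\<forall>n i. \<forall>A \<in> cells C n. 1 \<le> i \<and> i \<le> n + 1 \<longrightarrow>
        F (n + 1) (degen C n i A) = degen D (n + p) i (F n A)) \<and>
     (\<forall>n i \<alpha>. \<forall>A \<in> cells C n. 1 \<le> i \<and> i \<le> n \<longrightarrow>
        F (n + 1) (conn C n i \<alpha> A) = conn D (n + p) i \<alpha> (F n A)) \<and>
     (\<forall>n i A B. composable C n i A B \<longrightarrow>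
        F n (cube_comp C n i A B) = cube_comp D (n + p) i (F n A) (F n B))"

definition Lax :: "'a cubical \<Rightarrow> 'b cubical \<Rightarrow> (nat \<Rightarrow> 'a \<Rightarrow> 'b) cubical" where
  "Lax C D = \<lparr>
     cells = (\<lambda>p. {F. lax_transfor C D p F}),
     face = (\<lambda>p i \<alpha> F n. \<lambda>A \<in> cells C n. face D (n + p) i \<alpha> (F n A)),
     degen = (\<lambda>p i F n. \<lambda>A \<in> cells C n. degen D (n + p) i (F n A)),
     conn = (\<lambda>p i \<alpha> F n. \<lambda>A \<in> cells C n. conn D (n + p) i \<alpha> (F n A)),
     cube_comp = (\<lambda>p i F G n. \<lambda>A \<in> cells C n. cube_comp D (n + p) i (F n A) (G n A))\<rparr>"

definition OpLax :: "'a cubical \<Rightarrow> 'b cubical \<Rightarrow> (nat \<Rightarrow> 'a \<Rightarrow> 'b) cubical" where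
  "OpLax C D = \<lparr>
     cells = (\<lambda>p. {F. oplax_transfor C D p F}),
     face = (\<lambda>p i \<alpha> F n. \<lambda>A \<in> cells C n. face D (n + p) (n + i) \<alpha> (F n A)),
     degen = (\<lambda>p i F n. \<lambda>A \<in> cells C n. degen D (n + p) (n + i) (F n A)),
     conn = (\<lambda>p i \<alpha> F n. \<lambda>A \<in> cells C n. conn D (n + p) (n + i) \<alpha> (F n A)),
     cube_comp = (\<lambda>p i F G n. \<lambda>A \<in> cells C n. cube_comp D (n + p) (n + i) (F n A) (G n A))\<rparr>"

definition PsLax :: "'a cubical \<Rightarrow> 'b cubical \<Rightarrow> (nat \<Rightarrow> 'a \<Rightarrow> 'b) cubical" where
  "PsLax C D = (Lax C D)\<lparr>cells := (\<lambda>p. {F \<in> cells (Lax C D) p.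
     \<forall>n. \<forall>A \<in> cells C n. perm_invertible D (n + p) (rho n p) (F n A)})\<rparr>"

definition PsOpLax :: "'a cubical \<Rightarrow> 'b cubical \<Rightarrow> (nat \<Rightarrow> 'a \<Rightarrow> 'b) cubical" where
  "PsOpLax C D = (OpLax C D)\<lparr>cells := (\<lambda>p. {F \<in> cells (OpLax C D) p.
     \<forall>n. \<forall>A \<in> cells C n. perm_invertible D (n + p) (rho p n) (F n A)})\<rparr>"

end

theory Submission
  imports Defs
begin

text \<open>
  A lax transfor \<open>F\<close> is sent to the oplax transfor with values $\rho_{n,p} \cdot F_n(A)$. Everything rests
  on how $T_i$-inverses behave. In the double category formed by the directions $i$ and $i+1$, a cell is
  determined by its boundary and its fold, a 2-cell with trivial sides, and \<open>B\<close> is the $T_i$-inverse of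
  \<open>A\<close> iff their boundaries are interchanged and their folds are inverse for $\star_i$. So $T_i$-inverses
  are unique and compatible with all the operations in other directions; two facts remain, both proved
  by folding. If \<open>A\<close> is $T_i$-invertible with $T_j$-invertible inverse and $j + 2 \le i$, then \<open>A\<close> is
  $T_j$-invertible and the two operations commute. If \<open>B\<close> is the $T_i$-inverse of \<open>A\<close>, then $T_i$ followed
  by $T_{i+1}$ takes $\Gamma_{i+1}^\alpha A$ to $\Gamma_i^\alpha B$.

  A minimal word for $\rho_{n,p}$ moves the first $p$ directions to the end, one at a time past one of the
  other $n$. Marking these $p$ directions, the operations can be followed along such a word: those of $C$
  act in an unmarked direction and those on transfors in a marked one.
\<close>

text \<open>Invertibility is known only along one minimal word, while each operation asks for the
  moves in another order. Moves never exchange two marked or two unmarked directions, so the orders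
  differ by exchanges of distant moves. There the equation T_j T_i A = T_i T_j A is the easy part,
  by uniqueness; the obstacle is that A itself must be T_j-invertible. This is read off faces: a
  \<star>_k-invertible cell is \<star>_q-invertible, q < k, if its faces are, and folding turns
  T_i-invertibility into the former and T_j-invertibility into the latter.

  The fact about connections is reduced differently: a T_i-invertible cell is a composite of
  degeneracies, connections and one \<star>_{i+1}-invertible cell, and the claim passes to
  composites. Reversing all directions exchanges the signs, so one sign is enough.

  Reading the moves backwards with the marks complemented turns \<rho>_{n,p} into \<rho>_{p,n}. So
  only operations in unmarked directions need to be followed, and the passage from lax to oplax is a
  one-to-one relation that carries equations and closure properties both ways.\<close>

section \<open>Double categories with connections\<close>

text \<open>Below, \<open>Sq\<close>, \<open>Ed\<close> and \<open>Pt\<close> are the cells of dimension $n+2$, $n+1$ and $n$, and for the directions $i$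
  (vertical) and $i+1$ (horizontal) of squares the operations \<open>V\<close>, \<open>H\<close>, \<open>Gm\<close>, \<open>Gp\<close>, \<open>\<nabla>\<close> and \<open>\<rhd>\<close> are
  $\epsilon_i$, $\epsilon_{i+1}$, $\Gamma_i^-$, $\Gamma_i^+$, $\star_i$ and $\star_{i+1}$.\<close>

locale double_category =
  fixes Pt Ed Sq :: "'a set"
    and src tgt idt :: "'a \<Rightarrow> 'a" and ec :: "'a \<Rightarrow> 'a \<Rightarrow> 'a" (infixr "\<cdot>" 70)
    and top bot lef rig V H Gm Gp :: "'a \<Rightarrow> 'a"
    and vc :: "'a \<Rightarrow> 'a \<Rightarrow> 'a" (infixr "\<nabla>" 70)
    and hc :: "'a \<Rightarrow> 'a \<Rightarrow> 'a" (infixr "\<rhd>" 70)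
  assumes src_Pt [simp]: "e \<in> Ed \<Longrightarrow> src e \<in> Pt"
    and tgt_Pt [simp]: "e \<in> Ed \<Longrightarrow> tgt e \<in> Pt"
    and idt_Ed [simp]: "p \<in> Pt \<Longrightarrow> idt p \<in> Ed"
    and src_idt [simp]: "p \<in> Pt \<Longrightarrow> src (idt p) = p"
    and tgt_idt [simp]: "p \<in> Pt \<Longrightarrow> tgt (idt p) = p"
    and ec_Ed [simp]: "\<lbrakk>e \<in> Ed; f \<in> Ed; tgt e = src f\<rbrakk> \<Longrightarrow> e \<cdot> f \<in> Ed"
    and src_ec [simp]: "\<lbrakk>e \<in> Ed; f \<in> Ed; tgt e = src f\<rbrakk> \<Longrightarrow> src (e \<cdot> f) = src e"
    and tgt_ec [simp]: "\<lbrakk>e \<in> Ed; f \<in> Ed; tgt e = src f\<rbrakk> \<Longrightarrow> tgt (e \<cdot> f) = tgt f"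
    and ec_assoc [simp]: "\<lbrakk>e \<in> Ed; f \<in> Ed; g \<in> Ed; tgt e = src f; tgt f = src g\<rbrakk> \<Longrightarrow>
        (e \<cdot> f) \<cdot> g = e \<cdot> (f \<cdot> g)"
    and ec_idt_left: "e \<in> Ed \<Longrightarrow> idt (src e) \<cdot> e = e"
    and ec_idt_right: "e \<in> Ed \<Longrightarrow> e \<cdot> idt (tgt e) = e"
    and top_Ed [simp]: "X \<in> Sq \<Longrightarrow> top X \<in> Ed"
    and bot_Ed [simp]: "X \<in> Sq \<Longrightarrow> bot X \<in> Ed"
    and lef_Ed [simp]: "X \<in> Sq \<Longrightarrow> lef X \<in> Ed"
    and rig_Ed [simp]: "X \<in> Sq \<Longrightarrow> rig X \<in> Ed"
    and src_lef [simp]: "X \<in> Sq \<Longrightarrow> src (lef X) = src (top X)"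
    and src_rig [simp]: "X \<in> Sq \<Longrightarrow> src (rig X) = tgt (top X)"
    and tgt_lef [simp]: "X \<in> Sq \<Longrightarrow> tgt (lef X) = src (bot X)"
    and tgt_rig [simp]: "X \<in> Sq \<Longrightarrow> tgt (rig X) = tgt (bot X)"
    and V_Sq [simp]: "e \<in> Ed \<Longrightarrow> V e \<in> Sq"
    and top_V [simp]: "e \<in> Ed \<Longrightarrow> top (V e) = e"
    and bot_V [simp]: "e \<in> Ed \<Longrightarrow> bot (V e) = e"
    and lef_V [simp]: "e \<in> Ed \<Longrightarrow> lef (V e) = idt (src e)"
    and rig_V [simp]: "e \<in> Ed \<Longrightarrow> rig (V e) = idt (tgt e)"
    and H_Sq [simp]: "e \<in> Ed \<Longrightarrow> H e \<in> Sq"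
    and lef_H [simp]: "e \<in> Ed \<Longrightarrow> lef (H e) = e"
    and rig_H [simp]: "e \<in> Ed \<Longrightarrow> rig (H e) = e"
    and top_H [simp]: "e \<in> Ed \<Longrightarrow> top (H e) = idt (src e)"
    and bot_H [simp]: "e \<in> Ed \<Longrightarrow> bot (H e) = idt (tgt e)"
    and H_idt: "p \<in> Pt \<Longrightarrow> H (idt p) = V (idt p)"
    and V_ec: "\<lbrakk>e \<in> Ed; f \<in> Ed; tgt e = src f\<rbrakk> \<Longrightarrow> V (e \<cdot> f) = V e \<rhd> V f"
    and H_ec: "\<lbrakk>e \<in> Ed; f \<in> Ed; tgt e = src f\<rbrakk> \<Longrightarrow> H (e \<cdot> f) = H e \<nabla> H f"
    and hc_Sq [simp]: "\<lbrakk>X \<in> Sq; Y \<in> Sq; rig X = lef Y\<rbrakk> \<Longrightarrow> X \<rhd> Y \<in> Sq"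
    and top_hc [simp]: "\<lbrakk>X \<in> Sq; Y \<in> Sq; rig X = lef Y\<rbrakk> \<Longrightarrow> top (X \<rhd> Y) = top X \<cdot> top Y"
    and bot_hc [simp]: "\<lbrakk>X \<in> Sq; Y \<in> Sq; rig X = lef Y\<rbrakk> \<Longrightarrow> bot (X \<rhd> Y) = bot X \<cdot> bot Y"
    and lef_hc [simp]: "\<lbrakk>X \<in> Sq; Y \<in> Sq; rig X = lef Y\<rbrakk> \<Longrightarrow> lef (X \<rhd> Y) = lef X"
    and rig_hc [simp]: "\<lbrakk>X \<in> Sq; Y \<in> Sq; rig X = lef Y\<rbrakk> \<Longrightarrow> rig (X \<rhd> Y) = rig Y"
    and hc_assoc [simp]: "\<lbrakk>X \<in> Sq; Y \<in> Sq; Z \<in> Sq; rig X = lef Y; rig Y = lef Z\<rbrakk> \<Longrightarrow>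
        (X \<rhd> Y) \<rhd> Z = X \<rhd> (Y \<rhd> Z)"
    and hc_H_left: "X \<in> Sq \<Longrightarrow> H (lef X) \<rhd> X = X"
    and hc_H_right: "X \<in> Sq \<Longrightarrow> X \<rhd> H (rig X) = X"
    and vc_Sq [simp]: "\<lbrakk>X \<in> Sq; Y \<in> Sq; bot X = top Y\<rbrakk> \<Longrightarrow> X \<nabla> Y \<in> Sq"
    and lef_vc [simp]: "\<lbrakk>X \<in> Sq; Y \<in> Sq; bot X = top Y\<rbrakk> \<Longrightarrow> lef (X \<nabla> Y) = lef X \<cdot> lef Y"
    and rig_vc [simp]: "\<lbrakk>X \<in> Sq; Y \<in> Sq; bot X = top Y\<rbrakk> \<Longrightarrow> rig (X \<nabla> Y) = rig X \<cdot> rig Y"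
    and top_vc [simp]: "\<lbrakk>X \<in> Sq; Y \<in> Sq; bot X = top Y\<rbrakk> \<Longrightarrow> top (X \<nabla> Y) = top X"
    and bot_vc [simp]: "\<lbrakk>X \<in> Sq; Y \<in> Sq; bot X = top Y\<rbrakk> \<Longrightarrow> bot (X \<nabla> Y) = bot Y"
    and vc_assoc [simp]: "\<lbrakk>X \<in> Sq; Y \<in> Sq; Z \<in> Sq; bot X = top Y; bot Y = top Z\<rbrakk> \<Longrightarrow>
        (X \<nabla> Y) \<nabla> Z = X \<nabla> (Y \<nabla> Z)"
    and vc_V_left: "X \<in> Sq \<Longrightarrow> V (top X) \<nabla> X = X"
    and vc_V_right: "X \<in> Sq \<Longrightarrow> X \<nabla> V (bot X) = X"
    and exch: "\<lbrakk>X \<in> Sq; Y \<in> Sq; Z \<in> Sq; W \<in> Sq; rig X = lef Y; rig Z = lef W;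
        bot X = top Z; bot Y = top W\<rbrakk> \<Longrightarrow> (X \<rhd> Y) \<nabla> (Z \<rhd> W) = (X \<nabla> Z) \<rhd> (Y \<nabla> W)"
    and Gm_Sq [simp]: "e \<in> Ed \<Longrightarrow> Gm e \<in> Sq"
    and top_Gm [simp]: "e \<in> Ed \<Longrightarrow> top (Gm e) = e"
    and lef_Gm [simp]: "e \<in> Ed \<Longrightarrow> lef (Gm e) = e"
    and bot_Gm [simp]: "e \<in> Ed \<Longrightarrow> bot (Gm e) = idt (tgt e)"
    and rig_Gm [simp]: "e \<in> Ed \<Longrightarrow> rig (Gm e) = idt (tgt e)"
    and Gp_Sq [simp]: "e \<in> Ed \<Longrightarrow> Gp e \<in> Sq"
    and bot_Gp [simp]: "e \<in> Ed \<Longrightarrow> bot (Gp e) = e"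
    and rig_Gp [simp]: "e \<in> Ed \<Longrightarrow> rig (Gp e) = e"
    and top_Gp [simp]: "e \<in> Ed \<Longrightarrow> top (Gp e) = idt (src e)"
    and lef_Gp [simp]: "e \<in> Ed \<Longrightarrow> lef (Gp e) = idt (src e)"
    and Gm_idt: "p \<in> Pt \<Longrightarrow> Gm (idt p) = V (idt p)"
    and Gp_idt: "p \<in> Pt \<Longrightarrow> Gp (idt p) = V (idt p)"
    and Gm_ec: "\<lbrakk>e \<in> Ed; f \<in> Ed; tgt e = src f\<rbrakk> \<Longrightarrow>
        Gm (e \<cdot> f) = (Gm e \<nabla> H f) \<rhd> (V f \<nabla> Gm f)"
    and Gp_ec: "\<lbrakk>e \<in> Ed; f \<in> Ed; tgt e = src f\<rbrakk> \<Longrightarrow>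
        Gp (e \<cdot> f) = (Gp e \<nabla> V e) \<rhd> (H e \<nabla> Gp f)"
    and Gp_vc_Gm: "e \<in> Ed \<Longrightarrow> Gp e \<nabla> Gm e = H e"
    and Gp_hc_Gm: "e \<in> Ed \<Longrightarrow> Gp e \<rhd> Gm e = V e"
begin

text \<open>The axioms are symmetric in the two directions up to \<open>H_idt\<close>, which
  identifies the two identities on a point, and \<open>exch\<close>, which regroups the composites
  in \<open>Gm_ec\<close> and \<open>Gp_ec\<close>.\<close>

lemma transpose: "double_category Pt Ed Sq src tgt idt ec lef rig top bot H V Gm Gp hc vc"
  by unfold_locales
    (simp_all add: ec_idt_left ec_idt_right hc_H_left hc_H_right vc_V_left vc_V_right H_idt
      V_ec H_ec exch Gm_idt Gp_idt Gm_ec Gp_ec Gp_vc_Gm Gp_hc_Gm)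

lemma ec_unit [simp]:
  "\<lbrakk>e \<in> Ed; p = src e\<rbrakk> \<Longrightarrow> idt p \<cdot> e = e"
  "\<lbrakk>e \<in> Ed; p = tgt e\<rbrakk> \<Longrightarrow> e \<cdot> idt p = e"
  by (simp_all add: ec_idt_left ec_idt_right)

lemma hc_unit:
  "\<lbrakk>X \<in> Sq; e = lef X\<rbrakk> \<Longrightarrow> H e \<rhd> X = X"
  "\<lbrakk>X \<in> Sq; e = rig X\<rbrakk> \<Longrightarrow> X \<rhd> H e = X"
  by (simp_all add: hc_H_left hc_H_right)

lemma vc_unit:
  "\<lbrakk>X \<in> Sq; e = top X\<rbrakk> \<Longrightarrow> V e \<nabla> X = X"
  "\<lbrakk>X \<in> Sq; e = bot X\<rbrakk> \<Longrightarrow> X \<nabla> V e = X"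
  by (simp_all add: vc_V_left vc_V_right)

lemma hc_point [simp]:
  "\<lbrakk>X \<in> Sq; p \<in> Pt; lef X = idt p\<rbrakk> \<Longrightarrow> V (idt p) \<rhd> X = X"
  "\<lbrakk>X \<in> Sq; p \<in> Pt; rig X = idt p\<rbrakk> \<Longrightarrow> X \<rhd> V (idt p) = X"
  by (metis H_idt hc_H_left, metis H_idt hc_H_right)

lemma vc_point [simp]:
  "\<lbrakk>X \<in> Sq; p \<in> Pt; top X = idt p\<rbrakk> \<Longrightarrow> V (idt p) \<nabla> X = X"
  "\<lbrakk>X \<in> Sq; p \<in> Pt; bot X = idt p\<rbrakk> \<Longrightarrow> X \<nabla> V (idt p) = X"
  by (metis vc_V_left, metis vc_V_right)

text \<open>The fold of a square slides its sides onto its top and bottom.\<close>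

definition P :: "'a \<Rightarrow> 'a" where
  "P X = Gp (lef X) \<rhd> (X \<rhd> Gm (rig X))"

lemma P_Sq [simp]: "X \<in> Sq \<Longrightarrow> P X \<in> Sq"
  and top_P [simp]: "X \<in> Sq \<Longrightarrow> top (P X) = top X \<cdot> rig X"
  and bot_P [simp]: "X \<in> Sq \<Longrightarrow> bot (P X) = lef X \<cdot> bot X"
  and lef_P [simp]: "X \<in> Sq \<Longrightarrow> lef (P X) = idt (src (top X))"
  and rig_P [simp]: "X \<in> Sq \<Longrightarrow> rig (P X) = idt (tgt (bot X))"
  by (simp_all add: P_def)

text \<open>These are the thin squares: their folds are identities. In a fold they leave nothing but
  whiskering, and by \<open>P_inject\<close> they are determined by their boundaries.\<close>

lemma P_V [simp]: "e \<in> Ed \<Longrightarrow> P (V e) = V e"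
  and P_H [simp]: "e \<in> Ed \<Longrightarrow> P (H e) = V e"
  and P_Gm [simp]: "e \<in> Ed \<Longrightarrow> P (Gm e) = V e"
  and P_Gp [simp]: "e \<in> Ed \<Longrightarrow> P (Gp e) = V e"
  by (simp_all add: P_def hc_unit Gm_idt Gp_idt Gp_hc_Gm)

lemma P_glob: "\<lbrakk>X \<in> Sq; p \<in> Pt; q \<in> Pt; lef X = idt p; rig X = idt q\<rbrakk> \<Longrightarrow> P X = X"
  by (simp add: P_def Gm_idt Gp_idt)

text \<open>The connections on the composite sides split by \<open>Gp_ec\<close> and
  \<open>Gm_ec\<close> into two-by-two blocks; by \<open>exch\<close> one row holds the fold of
  \<open>X\<close>, the other that of \<open>Y\<close>, each whiskered by a side of the other
  square.\<close>

lemma P_vc: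
  assumes [simp]: "X \<in> Sq" "Y \<in> Sq" "bot X = top Y"
  shows "P (X \<nabla> Y) = (P X \<rhd> V (rig Y)) \<nabla> (V (lef X) \<rhd> P Y)"
proof -
  let ?c = "lef X" and ?c' = "lef Y" and ?d = "rig X" and ?d' = "rig Y"
  have [simp]: "src (bot X) = src (top Y)" "tgt (bot X) = tgt (top Y)" by simp_all
  have "(P X \<rhd> V ?d') \<nabla> (V ?c \<rhd> P Y) =
    (Gp ?c \<rhd> (H ?c \<rhd> (X \<rhd> (Gm ?d \<rhd> V ?d')))) \<nabla> (V ?c \<rhd> (Gp ?c' \<rhd> (Y \<rhd> (H ?d' \<rhd> Gm ?d'))))"
    by (simp add: P_def hc_unit)
  also have "\<dots> = (Gp ?c \<nabla> V ?c) \<rhd> ((H ?c \<nabla> Gp ?c') \<rhd> ((X \<nabla> Y) \<rhd> ((Gm ?d \<nabla> H ?d') \<rhd> (V ?d' \<nabla> Gm ?d'))))"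
    by (simp add: exch)
  also have "\<dots> = P (X \<nabla> Y)"
    by (simp add: P_def Gp_ec Gm_ec)
  finally show ?thesis by simp
qed

text \<open>The fold of the right factor comes first: pasting in this order puts \<open>Gp\<close>
  of the common side above its \<open>Gm\<close>, and the two merge into an identity by
  \<open>Gp_vc_Gm\<close>.\<close>

lemma P_hc:
  assumes [simp]: "X \<in> Sq" "Y \<in> Sq" "rig X = lef Y"
  shows "P (X \<rhd> Y) = (V (top X) \<rhd> P Y) \<nabla> (P X \<rhd> V (bot Y))"
proof -
  have c [simp]: "tgt (top X) = src (top Y)" "tgt (bot X) = src (bot Y)"
    using src_rig[of X] tgt_rig[of X] by simp_all
  let ?p = "V (idt (src (top X)))" and ?q = "V (idt (tgt (bot Y)))"
  have "(V (top X) \<rhd> P Y) \<nabla> (P X \<rhd> V (bot Y)) =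
     (?p \<rhd> (V (top X) \<rhd> (Gp (lef Y) \<rhd> (Y \<rhd> Gm (rig Y))))) \<nabla>
     (Gp (lef X) \<rhd> (X \<rhd> (Gm (lef Y) \<rhd> (V (bot Y) \<rhd> ?q))))"
    by (simp add: P_def)
  also have "\<dots> = (?p \<nabla> Gp (lef X)) \<rhd> ((V (top X) \<nabla> X) \<rhd> ((Gp (lef Y) \<nabla> Gm (lef Y)) \<rhd>
      ((Y \<nabla> V (bot Y)) \<rhd> (Gm (rig Y) \<nabla> ?q))))"
    by (simp add: exch del: hc_point vc_point)
  also have "\<dots> = P (X \<rhd> Y)"
    by (simp add: P_def Gp_vc_Gm vc_unit hc_unit)
  finally show ?thesis by simp
qed

text \<open>Connections at the top right and the bottom left bring the sides back from the top and
  bottom of the fold, so a square is recovered from its boundary and its fold.\<close>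

lemma unfold_P:
  assumes [simp]: "X \<in> Sq"
  shows "(V (top X) \<rhd> Gp (rig X)) \<nabla> (P X \<nabla> (Gm (lef X) \<rhd> V (bot X))) = X"
proof -
  let ?p = "V (idt (src (top X)))" and ?q = "V (idt (tgt (bot X)))"
  have "(V (top X) \<rhd> Gp (rig X)) \<nabla> (P X \<nabla> (Gm (lef X) \<rhd> V (bot X))) =
    (?p \<rhd> (V (top X) \<rhd> Gp (rig X))) \<nabla> ((Gp (lef X) \<rhd> (X \<rhd> Gm (rig X)))
       \<nabla> (Gm (lef X) \<rhd> (V (bot X) \<rhd> ?q)))"
    by (simp add: P_def)
  also have "\<dots> = (?p \<nabla> (Gp (lef X) \<nabla> Gm (lef X))) \<rhd> ((V (top X) \<nabla> (X \<nabla> V (bot X))) \<rhd>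
     (Gp (rig X) \<nabla> (Gm (rig X) \<nabla> ?q)))"
    by (simp add: exch del: hc_point vc_point)
  also have "\<dots> = X" by (simp add: Gp_vc_Gm vc_unit hc_unit)
  finally show ?thesis .
qed

lemma P_inject:
  assumes "X \<in> Sq" "Y \<in> Sq" "top X = top Y" "bot X = bot Y" "lef X = lef Y" "rig X = rig Y" "P X = P Y"
  shows "X = Y"
  using assms by (metis unfold_P)

lemma P_surj:
  assumes [simp]: "a \<in> Ed" "b \<in> Ed" "c \<in> Ed" "d \<in> Ed" "\<alpha> \<in> Sq"
    "src c = src a" "src d = tgt a" "src b = tgt c" "tgt d = tgt b"
    "top \<alpha> = a \<cdot> d" "bot \<alpha> = c \<cdot> b" "lef \<alpha> = idt (src a)" "rig \<alpha> = idt (tgt b)"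
  obtains X where "X \<in> Sq" "top X = a" "bot X = b" "lef X = c" "rig X = d" "P X = \<alpha>"
proof
  \<comment> \<open>The formula of \<open>unfold_P\<close>, with \<alpha> in place of the
    fold.\<close>
  let ?X = "(V a \<rhd> Gp d) \<nabla> (\<alpha> \<nabla> (Gm c \<rhd> V b))"
  show "?X \<in> Sq" "top ?X = a" "bot ?X = b" "lef ?X = c" "rig ?X = d" by simp_all
  have "P (\<alpha> \<nabla> (Gm c \<rhd> V b)) = \<alpha>"
    by (simp add: P_vc P_hc P_glob[of \<alpha> "src a" "tgt b"] vc_unit flip: V_ec)
  then show "P ?X = \<alpha>"
    by (subst P_vc) (simp_all add: P_hc vc_unit flip: V_ec)
qed

text \<open>\<open>Teq\<close> and \<open>Tp\<close> are \<open>T_equation\<close> and \<open>is_T_inverse\<close> for the two directions of the double category.\<close>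

definition Teq :: "'a \<Rightarrow> 'a \<Rightarrow> bool" where
  "Teq A B \<longleftrightarrow> (Gp (lef A) \<nabla> B) \<rhd> (A \<nabla> Gm (bot A)) = Gm (top A) \<nabla> Gp (rig A)"

definition swapped :: "'a \<Rightarrow> 'a \<Rightarrow> bool" where
  "swapped A B \<longleftrightarrow> A \<in> Sq \<and> B \<in> Sq \<and> top B = lef A \<and> lef B = top A \<and> bot B = rig A \<and> rig B = bot A"

definition Tp :: "'a \<Rightarrow> 'a \<Rightarrow> bool" where
  "Tp A B \<longleftrightarrow> swapped A B \<and> Teq A B \<and> Teq B A"

lemma swappedD:
  assumes "swapped A B"
  shows "A \<in> Sq" "B \<in> Sq" "top B = lef A" "lef B = top A" "bot B = rig A" "rig B = bot A"
  using assms by (auto simp: swapped_def)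

lemma swapped_sym: "swapped A B \<Longrightarrow> swapped B A"
  by (auto simp: swapped_def)

text \<open>Both sides of the T-equation have the same boundary, so by \<open>P_inject\<close> only
  their folds matter. Connections fold to identities and \<open>P_hc\<close> puts the right factor
  first, which leaves \<open>P A \<nabla> P B\<close> against an identity.\<close>

lemma Teq_iff_P:
  assumes "swapped A B"
  shows "Teq A B \<longleftrightarrow> P A \<nabla> P B = V (top A \<cdot> rig A)"
proof -
  note [simp] = swappedD[OF assms]
  let ?L = "(Gp (lef A) \<nabla> B) \<rhd> (A \<nabla> Gm (bot A))" and ?R = "Gm (top A) \<nabla> Gp (rig A)"
  have 1: "P (Gp (lef A) \<nabla> B) = P B"
    by (simp add: P_vc vc_unit flip: V_ec)
  have 2: "P (A \<nabla> Gm (bot A)) = P A"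
    by (simp add: P_vc vc_unit flip: V_ec)
  have "P ?L = P A \<nabla> P B" by (subst P_hc) (simp_all add: 1 2)
  moreover have "P ?R = V (top A \<cdot> rig A)" by (simp add: P_vc vc_unit flip: V_ec)
  moreover have "?L = ?R \<longleftrightarrow> P ?L = P ?R"
    using P_inject[of ?L ?R] by auto
  ultimately show ?thesis by (simp add: Teq_def)
qed

lemma Tp_iff:
  "Tp A B \<longleftrightarrow> swapped A B \<and> P A \<nabla> P B = V (top A \<cdot> rig A) \<and> P B \<nabla> P A = V (lef A \<cdot> bot A)"
proof (cases "swapped A B")
  case True
  then show ?thesis
    by (simp only: Tp_def Teq_iff_P[OF True] Teq_iff_P[OF swapped_sym[OF True]] swappedD(3,6)[OF True] simp_thms)
next
  case False
  then show ?thesis by (simp add: Tp_def)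
qed

lemma Tp_sym: "Tp A B \<Longrightarrow> Tp B A"
  by (auto simp: Tp_def swapped_def)

lemma vc_inverse_unique:
  assumes "X \<in> Sq" "Y \<in> Sq" "Z \<in> Sq" "bot Y = top X" "bot X = top Z"
    and "Y \<nabla> X = V (bot X)" "X \<nabla> Z = V (top X)"
  shows "Y = Z"
  by (metis assms vc_assoc bot_V top_V bot_vc top_vc top_Ed bot_Ed vc_V_left vc_V_right)

lemma Tp_unique:
  assumes "Tp A B" "Tp A B'"
  shows "B = B'"
proof -
  from assms have s: "swapped A B" "swapped A B'" by (auto simp: Tp_def)
  note [simp] = swappedD[OF s(1)] swappedD[OF s(2)]
  have "P B = P B'"
  proof (rule vc_inverse_unique)
    show "P B \<nabla> P A = V (bot (P A))" "P A \<nabla> P B' = V (top (P A))"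
      using assms by (simp_all add: Tp_iff)
  qed simp_all
  then show ?thesis by - (rule P_inject, simp_all)
qed

lemma Tp_V_H: "e \<in> Ed \<Longrightarrow> Tp (V e) (H e)"
  by (simp_all add: Tp_iff swapped_def vc_unit)

lemma Tp_Gm: "e \<in> Ed \<Longrightarrow> Tp (Gm e) (Gm e)"
  and Tp_Gp: "e \<in> Ed \<Longrightarrow> Tp (Gp e) (Gp e)"
  by (simp_all add: Tp_iff swapped_def vc_unit)

text \<open>\<open>P_vc\<close> and \<open>P_hc\<close> list the whiskered factors in opposite
  orders, as the inverse of a product demands: the inner pair cancels, then the outer one.\<close>

lemma Tp_vc:
  assumes T: "Tp A B" "Tp A' B'" and [simp]: "bot A = top A'"
  shows "Tp (A \<nabla> A') (B \<rhd> B')"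
proof -
  from T have s: "swapped A B" "swapped A' B'" by (auto simp: Tp_def)
  note [simp] = swappedD[OF s(1)] swappedD[OF s(2)]
  have [simp]: "rig B = lef B'" by simp
  have c [simp]: "src (bot A) = src (top A')" "tgt (bot A) = tgt (top A')" by simp_all
  have i: "P A \<nabla> P B = V (top A \<cdot> rig A)" "P B \<nabla> P A = V (lef A \<cdot> bot A)"
     "P A' \<nabla> P B' = V (top A' \<cdot> rig A')" "P B' \<nabla> P A' = V (lef A' \<cdot> bot A')"
    using T by (auto simp: Tp_iff)
  have PAB: "P (A \<nabla> A') = (P A \<rhd> V (rig A')) \<nabla> (V (lef A) \<rhd> P A')"
    by (rule P_vc) auto
  have PB: "P (B \<rhd> B') = (V (lef A) \<rhd> P B') \<nabla> (P B \<rhd> V (rig A'))"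
    by (subst P_hc) simp_all
  have s': "swapped (A \<nabla> A') (B \<rhd> B')"
    by (simp add: swapped_def)
  have e1: "(V (lef A) \<rhd> P A') \<nabla> (V (lef A) \<rhd> P B') = V (lef A \<cdot> (top A' \<cdot> rig A'))"
  proof -
    have "(V (lef A) \<rhd> P A') \<nabla> (V (lef A) \<rhd> P B') = (V (lef A) \<nabla> V (lef A)) \<rhd> (P A' \<nabla> P B')"
      by (rule exch) simp_all
    then show ?thesis by (simp add: i vc_unit V_ec)
  qed
  have e2: "(P A \<rhd> V (rig A')) \<nabla> (P B \<rhd> V (rig A')) = V (top A \<cdot> (rig A \<cdot> rig A'))"
  proof -
    have "(P A \<rhd> V (rig A')) \<nabla> (P B \<rhd> V (rig A')) = (P A \<nabla> P B) \<rhd> (V (rig A') \<nabla> V (rig A'))"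
      by (rule exch) simp_all
    then show ?thesis by (simp add: i vc_unit V_ec)
  qed
  have e3: "(P B \<rhd> V (rig A')) \<nabla> (P A \<rhd> V (rig A')) = V (lef A \<cdot> (top A' \<cdot> rig A'))"
  proof -
    have "(P B \<rhd> V (rig A')) \<nabla> (P A \<rhd> V (rig A')) = (P B \<nabla> P A) \<rhd> (V (rig A') \<nabla> V (rig A'))"
      by (rule exch) simp_all
    then show ?thesis by (simp add: i vc_unit V_ec)
  qed
  have e4: "(V (lef A) \<rhd> P B') \<nabla> (V (lef A) \<rhd> P A') = V (lef A \<cdot> (lef A' \<cdot> bot A'))"
  proof -
    have "(V (lef A) \<rhd> P B') \<nabla> (V (lef A) \<rhd> P A') = (V (lef A) \<nabla> V (lef A)) \<rhd> (P B' \<nabla> P A')"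
      by (rule exch) simp_all
    then show ?thesis by (simp add: i vc_unit V_ec)
  qed
  let ?X1 = "P A \<rhd> V (rig A')" and ?X2 = "V (lef A) \<rhd> P A'"
    and ?Y1 = "V (lef A) \<rhd> P B'" and ?Y2 = "P B \<rhd> V (rig A')"
  have "(?X1 \<nabla> ?X2) \<nabla> (?Y1 \<nabla> ?Y2) = ?X1 \<nabla> ((?X2 \<nabla> ?Y1) \<nabla> ?Y2)" by simp
  also have "\<dots> = ?X1 \<nabla> ?Y2" unfolding e1 by (subst vc_unit) simp_all
  finally have 1: "(?X1 \<nabla> ?X2) \<nabla> (?Y1 \<nabla> ?Y2) = V (top A \<cdot> (rig A \<cdot> rig A'))" unfolding e2 .
  have "(?Y1 \<nabla> ?Y2) \<nabla> (?X1 \<nabla> ?X2) = ?Y1 \<nabla> ((?Y2 \<nabla> ?X1) \<nabla> ?X2)" by simp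
  also have "\<dots> = ?Y1 \<nabla> ?X2" unfolding e3 by (subst vc_unit) simp_all
  finally have 2: "(?Y1 \<nabla> ?Y2) \<nabla> (?X1 \<nabla> ?X2) = V (lef A \<cdot> (lef A' \<cdot> bot A'))" unfolding e4 .
  have "top (A \<nabla> A') \<cdot> rig (A \<nabla> A') = top A \<cdot> (rig A \<cdot> rig A')"
    "lef (A \<nabla> A') \<cdot> bot (A \<nabla> A') = lef A \<cdot> (lef A' \<cdot> bot A')" by simp_all
  then show ?thesis
    unfolding Tp_iff PAB PB using s' 1 2 by metis
qed

lemma Tp_hc:
  assumes "Tp A B" "Tp A' B'" "rig A = lef A'"
  shows "Tp (A \<rhd> A') (B \<nabla> B')"
proof -
  have "bot B = top B'" using assms by (auto simp: Tp_def swapped_def)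
  then show ?thesis using assms by (blast intro: Tp_vc Tp_sym)
qed

section \<open>Squares invertible for one of the two compositions\<close>

definition epair :: "'a \<Rightarrow> 'a \<Rightarrow> bool" where
  "epair e f \<longleftrightarrow> e \<in> Ed \<and> f \<in> Ed \<and> tgt e = src f \<and> tgt f = src e \<and>
     e \<cdot> f = idt (src e) \<and> f \<cdot> e = idt (src f)"

definition vpair :: "'a \<Rightarrow> 'a \<Rightarrow> bool" where
  "vpair X Y \<longleftrightarrow> X \<in> Sq \<and> Y \<in> Sq \<and> bot X = top Y \<and> bot Y = top X \<and>
     X \<nabla> Y = V (top X) \<and> Y \<nabla> X = V (top Y)"

definition hpair :: "'a \<Rightarrow> 'a \<Rightarrow> bool" where
  "hpair X Y \<longleftrightarrow> X \<in> Sq \<and> Y \<in> Sq \<and> rig X = lef Y \<and> rig Y = lef X \<and>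
     X \<rhd> Y = H (lef X) \<and> Y \<rhd> X = H (lef Y)"

lemma vpairD:
  assumes "vpair X Y"
  shows "X \<in> Sq" "Y \<in> Sq" "bot X = top Y" "bot Y = top X" "X \<nabla> Y = V (top X)" "Y \<nabla> X = V (top Y)"
  using assms by (auto simp: vpair_def)

lemma hpairD:
  assumes "hpair X Y"
  shows "X \<in> Sq" "Y \<in> Sq" "rig X = lef Y" "rig Y = lef X" "X \<rhd> Y = H (lef X)" "Y \<rhd> X = H (lef Y)"
  using assms by (auto simp: hpair_def)

lemma epairD:
  assumes "epair X Y"
  shows "X \<in> Ed" "Y \<in> Ed" "tgt X = src Y" "tgt Y = src X" "X \<cdot> Y = idt (src X)" "Y \<cdot> X = idt (src Y)"
  using assms by (auto simp: epair_def)

lemma vpair_epair: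
  assumes "vpair X Y"
  shows "epair (lef X) (lef Y)" "epair (rig X) (rig Y)"
proof -
  note [simp] = vpairD(1-4)[OF assms]
  have "lef (X \<nabla> Y) = idt (src (top X))" "lef (Y \<nabla> X) = idt (src (top Y))"
    "rig (X \<nabla> Y) = idt (tgt (top X))" "rig (Y \<nabla> X) = idt (tgt (top Y))"
    using vpairD(5,6)[OF assms] by (simp_all del: lef_vc rig_vc)
  then show "epair (lef X) (lef Y)" "epair (rig X) (rig Y)"
    by (simp_all add: epair_def)
qed

lemma Tp_vpair: "Tp A B \<Longrightarrow> vpair (P A) (P B)"
  by (auto simp: Tp_iff vpair_def swapped_def)

text \<open>An inverse of the fold of \<open>A\<close> has the boundary of the fold of a square with
  the sides of \<open>A\<close> interchanged; \<open>P_surj\<close> supplies that square.\<close>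

lemma vpair_Tp:
  assumes A: "A \<in> Sq" and v: "vpair (P A) Y"
  obtains B where "Tp A B" "P B = Y"
proof -
  have Y: "Y \<in> Sq" by (rule vpairD(2)[OF v])
  have t: "top Y = lef A \<cdot> bot A" "bot Y = top A \<cdot> rig A"
    using vpairD(3,4)[OF v] A by simp_all
  have l: "lef Y = idt (src (top A))" "rig Y = idt (tgt (bot A))"
    using vpair_epair[OF v] A by (auto simp: epair_def)
  obtain B where B: "B \<in> Sq" "top B = lef A" "bot B = rig A" "lef B = top A" "rig B = bot A" "P B = Y"
    by (rule P_surj[of "lef A" "rig A" "top A" "bot A" Y]) (simp_all add: A Y l t)
  then have "Tp A B" using vpairD(5,6)[OF v] A t by (simp add: Tp_iff swapped_def)
  with B show thesis using that by blast
qed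

lemma vpair_imp_Tp:
  assumes v: "vpair X Y"
  obtains B where "Tp X B"
proof -
  note [simp] = vpairD(1-4)[OF v] epairD[OF vpair_epair(1)[OF v]] epairD[OF vpair_epair(2)[OF v]]
  \<comment> \<open>\<open>P Y\<close> runs from \<open>bot X \<cdot> rig Y\<close> to
    \<open>lef Y \<cdot> top X\<close>. Whiskering by \<open>lef X\<close> and \<open>rig X\<close>
    cancels the sides of \<open>Y\<close>, which are inverse to those of \<open>X\<close>, and gives
    the boundary required of an inverse of \<open>P X\<close>.\<close>
  let ?Z = "V (lef X) \<rhd> (P Y \<rhd> V (rig X))"
  have 1: "(P X \<rhd> V (rig Y)) \<nabla> (V (lef X) \<rhd> P Y) = V (top X)"
    "(P Y \<rhd> V (rig X)) \<nabla> (V (lef Y) \<rhd> P X) = V (top Y)"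
    using P_vc[of X Y] P_vc[of Y X] vpairD(5,6)[OF v] by auto
  have "P X \<nabla> ?Z = ((P X \<rhd> V (rig Y)) \<rhd> V (rig X)) \<nabla> ((V (lef X) \<rhd> P Y) \<rhd> V (rig X))"
    by (simp flip: V_ec)
  also have "\<dots> = ((P X \<rhd> V (rig Y)) \<nabla> (V (lef X) \<rhd> P Y)) \<rhd> (V (rig X) \<nabla> V (rig X))"
    by (subst exch) simp_all
  also have "\<dots> = V (top X \<cdot> rig X)" by (simp add: 1 vc_unit V_ec)
  finally have a: "P X \<nabla> ?Z = V (top X \<cdot> rig X)" .
  have "?Z \<nabla> P X = (V (lef X) \<rhd> (P Y \<rhd> V (rig X))) \<nabla> (V (lef X) \<rhd> (V (lef Y) \<rhd> P X))"
    by (simp flip: V_ec hc_assoc)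
  also have "\<dots> = (V (lef X) \<nabla> V (lef X)) \<rhd> ((P Y \<rhd> V (rig X)) \<nabla> (V (lef Y) \<rhd> P X))"
    by (subst exch) simp_all
  also have "\<dots> = V (lef X \<cdot> bot X)" by (simp add: 1 vc_unit V_ec)
  finally have b: "?Z \<nabla> P X = V (lef X \<cdot> bot X)" .
  have c: "top ?Z = lef X \<cdot> bot X" by simp
  have d: "bot ?Z = top X \<cdot> rig X" by (simp flip: ec_assoc)
  have e: "?Z \<in> Sq" by simp
  have X: "X \<in> Sq" by (rule vpairD(1)[OF v])
  have "vpair (P X) ?Z" unfolding vpair_def a b c d top_P[OF X] bot_P[OF X] using P_Sq[OF X] e by blast
  from vpair_Tp[OF X this] show thesis using that by blast
qed

text \<open>A converse of \<open>vpair_imp_Tp\<close> when the sides of \<open>X\<close> are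
  invertible. Their inverses become the sides of \<open>Y\<close>, and the fold of \<open>Y\<close>
  is that of the T-inverse whiskered by them.\<close>

lemma Tp_imp_vpair:
  assumes T: "Tp X B" and l: "epair (lef X) c'" and r: "epair (rig X) d'"
  obtains Y where "vpair X Y"
proof -
  from T have s: "swapped X B" by (simp add: Tp_def)
  note [simp] = swappedD[OF s] epairD[OF l] epairD[OF r]
  have [simp]: "src c' = src (bot X)" "tgt c' = src (top X)" "src d' = tgt (bot X)" "tgt d' = tgt (top X)"
    using epairD(3,4)[OF l] epairD(3,4)[OF r] swappedD(1)[OF s] by (metis tgt_lef tgt_rig src_lef src_rig)+
  have i: "P X \<nabla> P B = V (top X \<cdot> rig X)" "P B \<nabla> P X = V (lef X \<cdot> bot X)"
    using T by (auto simp: Tp_iff)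
  obtain Y where Y [simp]: "Y \<in> Sq" "top Y = bot X" "bot Y = top X" "lef Y = c'" "rig Y = d'"
    and PY: "P Y = V c' \<rhd> (P B \<rhd> V d')"
    by (rule P_surj[of "bot X" "top X" c' d' "V c' \<rhd> (P B \<rhd> V d')"]) (simp_all flip: ec_assoc, simp)
  have 1: "P (X \<nabla> Y) = V (top X)"
  proof -
    have "P (X \<nabla> Y) = (P X \<rhd> V d') \<nabla> ((V (lef X) \<rhd> V c') \<rhd> (P B \<rhd> V d'))"
      by (simp add: P_vc PY)
    also have "\<dots> = (P X \<nabla> P B) \<rhd> (V d' \<nabla> V d')"
      by (simp add: exch flip: V_ec)
    also have "\<dots> = V (top X)" by (simp add: i vc_unit flip: V_ec)
    finally show ?thesis .
  qed
  have 2: "P (Y \<nabla> X) = V (bot X)"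
  proof -
    have "P (Y \<nabla> X) = (V c' \<rhd> (P B \<rhd> (V d' \<rhd> V (rig X)))) \<nabla> (V c' \<rhd> P X)"
      by (simp add: P_vc PY)
    also have "\<dots> = (V c' \<nabla> V c') \<rhd> (P B \<nabla> P X)"
      by (simp add: exch flip: V_ec)
    also have "\<dots> = V (bot X)" by (simp add: i vc_unit flip: V_ec) (simp flip: ec_assoc)
    finally show ?thesis .
  qed
  have "X \<nabla> Y = V (top X)" by (rule P_inject) (simp_all add: 1)
  moreover have "Y \<nabla> X = V (top Y)" by (rule P_inject) (simp_all add: 2)
  ultimately have "vpair X Y" by (simp add: vpair_def)
  then show thesis using that by blast
qed

text \<open>With trivial top and bottom no whiskering is left in \<open>P_hc\<close>, so folding
  turns horizontal inverses into vertical ones; \<open>P U'\<close> has trivial sides and is its own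
  fold.\<close>

lemma hpair_Tp_P:
  assumes h: "hpair U U'" and [simp]: "p \<in> Pt" "q \<in> Pt" "top U = idt p" "bot U = idt q"
    "top U' = idt p" "bot U' = idt q"
  shows "Tp U (P U')"
proof -
  note [simp] = hpairD(1-4)[OF h]
  have [simp]: "src (lef U) = p" "tgt (lef U) = q" "src (lef U') = p" "tgt (lef U') = q"
    by simp_all
  have 1: "P U' \<nabla> P U = V (lef U)" "P U \<nabla> P U' = V (lef U')"
    using P_hc[of U U'] P_hc[of U' U] hpairD(5,6)[OF h] by simp_all
  show ?thesis
    by (simp add: Tp_iff swapped_def P_glob[of "P U'" p q] 1)
qed

lemma vpair_P_imp_Tp:
  assumes s: "swapped M Z" and v: "vpair (P M) Z" and p: "p \<in> Pt" "q \<in> Pt" "lef Z = idt p" "rig Z = idt q"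
  shows "Tp M Z"
proof -
  have [simp]: "M \<in> Sq" "Z \<in> Sq" using s by (auto simp: swapped_def)
  have "P Z = Z" by (rule P_glob[OF _ p]) simp
  moreover have "top Z = lef M \<cdot> bot M" using vpairD(3)[OF v] by simp
  ultimately show ?thesis using s vpairD(5,6)[OF v] by (simp add: Tp_iff)
qed

text \<open>Pasting \<open>H (lef X) \<nabla> Gp (bot X)\<close> to the left of
  \<open>X \<nabla> Gm (bot X)\<close> restores \<open>X\<close>. Hence an equation may be tested
  after absorbing a connection, where the transport laws apply.\<close>

lemma vc_Gm_cancel:
  assumes [simp]: "X \<in> Sq" "Y \<in> Sq" "bot X = bot Y" "lef X = lef Y"
    and e: "X \<nabla> Gm (bot X) = Y \<nabla> Gm (bot Y)"
  shows "X = Y"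
proof -
  have *: "(H (lef Z) \<nabla> Gp (bot Z)) \<rhd> (Z \<nabla> Gm (bot Z)) = Z" if [simp]: "Z \<in> Sq" for Z
  proof -
    have "(H (lef Z) \<nabla> Gp (bot Z)) \<rhd> (Z \<nabla> Gm (bot Z)) = (H (lef Z) \<rhd> Z) \<nabla> (Gp (bot Z) \<rhd> Gm (bot Z))"
      by (subst exch) simp_all
    then show ?thesis by (simp add: Gp_hc_Gm hc_unit vc_unit)
  qed
  have "Y = (H (lef Y) \<nabla> Gp (bot Y)) \<rhd> (Y \<nabla> Gm (bot Y))" by (rule *[OF assms(2), symmetric])
  also have "\<dots> = (H (lef X) \<nabla> Gp (bot X)) \<rhd> (X \<nabla> Gm (bot X))" unfolding assms(3,4) using e by (simp only: assms(3))
  also have "\<dots> = X" by (rule *[OF assms(1)])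
  finally show ?thesis ..
qed

text \<open>The fold for the transposed double category: top and bottom slide onto the left and
  right sides.\<close>

definition Q :: "'a \<Rightarrow> 'a" where
  "Q X = Gp (top X) \<nabla> (X \<nabla> Gm (bot X))"

text \<open>The property \<open>R\<close> is left open: these closure lemmas carry invertibility for
  a composition, T-invertibility and compatibility with connections through folding and
  unfolding.\<close>

lemma P_closed:
  assumes "X \<in> Sq" "R (Gp (lef X))" "R X" "R (Gm (rig X))"
    and hc: "\<And>X Y. \<lbrakk>X \<in> Sq; Y \<in> Sq; rig X = lef Y; R X; R Y\<rbrakk> \<Longrightarrow> R (X \<rhd> Y)"
  shows "R (P X)"
  unfolding P_def by (intro hc) (simp_all add: assms)

lemma Q_closed:
  assumes "X \<in> Sq" "R (Gp (top X))" "R X" "R (Gm (bot X))"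
    and vc: "\<And>X Y. \<lbrakk>X \<in> Sq; Y \<in> Sq; bot X = top Y; R X; R Y\<rbrakk> \<Longrightarrow> R (X \<nabla> Y)"
  shows "R (Q X)"
  unfolding Q_def by (intro vc) (simp_all add: assms)

lemma unfold_P_closed:
  assumes "X \<in> Sq" "R (V (top X))" "R (Gp (rig X))" "R (P X)" "R (Gm (lef X))" "R (V (bot X))"
    and vc: "\<And>X Y. \<lbrakk>X \<in> Sq; Y \<in> Sq; bot X = top Y; R X; R Y\<rbrakk> \<Longrightarrow> R (X \<nabla> Y)"
    and hc: "\<And>X Y. \<lbrakk>X \<in> Sq; Y \<in> Sq; rig X = lef Y; R X; R Y\<rbrakk> \<Longrightarrow> R (X \<rhd> Y)"
  shows "R X"
proof -
  have "R ((V (top X) \<rhd> Gp (rig X)) \<nabla> (P X \<nabla> (Gm (lef X) \<rhd> V (bot X))))"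
    by (intro hc vc) (simp_all add: assms)
  then show ?thesis by (simp only: unfold_P[OF assms(1)])
qed

text \<open>Decomposing \<open>Gm\<close> of the identities \<open>u \<cdot> u'\<close> and
  \<open>u' \<cdot> u\<close> exhibits \<open>Gm u\<close> as a factor of an identity on either
  side.\<close>

lemma vpair_Gm:
  assumes u: "epair u u'"
  shows "vpair (Gm u) (Gm u' \<rhd> V u)"
proof -
  note [simp] = epairD[OF u]
  have Gm_ec': "Gm (e \<cdot> f) = (Gm e \<rhd> V f) \<nabla> Gm f" if [simp]: "e \<in> Ed" "f \<in> Ed" "tgt e = src f" for e f
  proof -
    have "(Gm e \<rhd> V f) \<nabla> (H f \<rhd> Gm f) = (Gm e \<nabla> H f) \<rhd> (V f \<nabla> Gm f)"
      by (rule exch) simp_all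
    then show ?thesis by (simp add: Gm_ec hc_unit)
  qed
  have V: "V u \<rhd> V u' = V (idt (src u))" "V u' \<rhd> V u = V (idt (src u'))"
    by (simp_all flip: V_ec)
  have 1: "(Gm u' \<rhd> V u) \<nabla> Gm u = V (idt (src u'))"
    by (simp add: Gm_idt flip: Gm_ec')
  have "Gm u \<nabla> (Gm u' \<rhd> V u) = ((Gm u \<rhd> V u') \<rhd> V u) \<nabla> (Gm u' \<rhd> V u)"
    by (simp add: V)
  also have "\<dots> = ((Gm u \<rhd> V u') \<nabla> Gm u') \<rhd> (V u \<nabla> V u)"
    by (rule exch) simp_all
  also have "\<dots> = V u" by (simp add: Gm_idt vc_unit flip: Gm_ec')
  finally show ?thesis by (simp add: vpair_def 1)
qed

text \<open>A thin upper factor enters the fold only through its left side.\<close>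

lemma P_thin_vc:
  assumes "X \<in> Sq" "Y \<in> Sq" "bot X = top Y" "P X = V (lef X \<cdot> bot X)"
  shows "P (X \<nabla> Y) = V (lef X) \<rhd> P Y"
proof -
  note [simp] = assms(1-3)
  have [simp]: "src (bot X) = src (top Y)" "tgt (bot X) = tgt (top Y)" by simp_all
  have "P (X \<nabla> Y) = (V (lef X \<cdot> bot X) \<rhd> V (rig Y)) \<nabla> (V (lef X) \<rhd> P Y)"
    by (simp only: P_vc assms)
  also have "\<dots> = V (lef X) \<rhd> P Y" by (simp add: vc_unit flip: V_ec)
  finally show ?thesis .
qed

lemma P_Gm_V: "\<lbrakk>e \<in> Ed; f \<in> Ed; tgt e = src f\<rbrakk> \<Longrightarrow> P (Gm e \<rhd> V f) = V (e \<cdot> f)"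
  by (subst P_hc) (simp_all add: vc_unit flip: V_ec)

lemma Gm_H_Gm: "\<lbrakk>e \<in> Ed; f \<in> Ed; tgt e = src f\<rbrakk> \<Longrightarrow> (Gm e \<nabla> H f) \<rhd> Gm f = Gm (e \<cdot> f)"
  by (simp add: Gm_ec vc_unit)

lemma top_Q [simp]: "X \<in> Sq \<Longrightarrow> top (Q X) = idt (src (top X))"
  and bot_Q [simp]: "X \<in> Sq \<Longrightarrow> bot (Q X) = idt (tgt (bot X))"
  and Q_Sq [simp]: "X \<in> Sq \<Longrightarrow> Q X \<in> Sq"
  by (simp_all add: Q_def)

text \<open>Both sides are the diagonal of a two-by-two composite whose other corners are identities
  on the common point.\<close>

lemma Gm_Gp_diagonal:
  assumes [simp]: "e \<in> Ed" "f \<in> Ed" "tgt e = src f"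
  shows "Gm e \<rhd> Gp f = Gm e \<nabla> Gp f"
proof -
  have "(Gm e \<rhd> V (idt (tgt e))) \<nabla> (V (idt (src f)) \<rhd> Gp f) =
    (Gm e \<nabla> V (idt (src f))) \<rhd> (V (idt (tgt e)) \<nabla> Gp f)"
    by (subst exch) simp_all
  then show ?thesis by simp
qed

text \<open>The left side is the T-equation of the transposed double category. It is the original
  one with the cells exchanged, so \<open>Tp\<close>, which asks for both, is self-dual.\<close>

lemma Teq_transpose:
  assumes "swapped A B"
  shows "(Gp (top A) \<rhd> B) \<nabla> (A \<rhd> Gm (rig A)) = Gm (lef A) \<rhd> Gp (bot A) \<longleftrightarrow> Teq B A"
proof -
  note [simp] = swappedD[OF assms]
  have "(Gp (top A) \<rhd> B) \<nabla> (A \<rhd> Gm (rig A)) = (Gp (top A) \<nabla> A) \<rhd> (B \<nabla> Gm (rig A))"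
    by (subst exch) simp_all
  moreover have "Gm (lef A) \<rhd> Gp (bot A) = Gm (lef A) \<nabla> Gp (bot A)"
    by (rule Gm_Gp_diagonal) simp_all
  ultimately show ?thesis by (simp add: Teq_def)
qed

context
begin

private abbreviation "tr_P \<equiv> double_category.P top bot Gm Gp vc"
private abbreviation "tr_swapped \<equiv> double_category.swapped Sq lef rig top bot"
private abbreviation "tr_Tp \<equiv> double_category.Tp Sq lef rig top bot Gm Gp hc vc"
private abbreviation "tr_vpair \<equiv> double_category.vpair Sq lef rig H hc"

lemma tr_P: "tr_P X = Q X"
  by (simp add: Q_def double_category.P_def[OF transpose])

lemma tr_swapped: "tr_swapped A B \<longleftrightarrow> swapped A B"
  unfolding swapped_def double_category.swapped_def[OF transpose] by auto

lemma tr_Tp: "tr_Tp A B \<longleftrightarrow> Tp A B"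
  unfolding Tp_def double_category.Tp_def[OF transpose] tr_swapped double_category.Teq_def[OF transpose]
  using Teq_transpose[of A B] Teq_transpose[of B A] swapped_sym[of A B] by blast

lemma tr_vpair: "tr_vpair = hpair"
  by (intro ext) (simp add: hpair_def double_category.vpair_def[OF transpose])

text \<open>Transposition fixes \<open>Tp\<close> and turns \<open>vpair\<close> into
  \<open>hpair\<close> and \<open>P\<close> into \<open>Q\<close>; results on vertical inverses thus
  yield results on horizontal ones.\<close>

lemmas hpair_imp_Tp = double_category.vpair_imp_Tp[OF transpose, unfolded tr_vpair tr_Tp]
lemmas hpair_Q_Tp = double_category.vpair_Tp[OF transpose, unfolded tr_vpair tr_Tp tr_P]
lemmas Tp_hpair_Q = double_category.Tp_vpair[OF transpose, unfolded tr_vpair tr_Tp tr_P]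
lemmas unfold_Q_closed = double_category.unfold_P_closed[OF transpose, unfolded tr_P]
lemmas hpair_Gm = double_category.vpair_Gm[OF transpose, unfolded tr_vpair]
lemmas hc_Gm_cancel = double_category.vc_Gm_cancel[OF transpose]

end

end

section \<open>$T_i$-inverses and the cubical operations\<close>

lemma polarity_cases_eq: "(\<forall>\<alpha>. P \<alpha>) \<longleftrightarrow> P Minus \<and> P Plus"
  using polarity.exhaust by metis

context cubical_omega_category
begin

abbreviation "cl \<equiv> cells C"
abbreviation "fc \<equiv> face C"
abbreviation "dg \<equiv> degen C"
abbreviation "cn \<equiv> conn C"
abbreviation "cp \<equiv> cube_comp C"

section \<open>The axioms with successor dimensions, as rewrite rules\<close>

lemma fc_cl [simp]: "\<lbrakk>A \<in> cl (Suc n); 1 \<le> i; i \<le> Suc n\<rbrakk> \<Longrightarrow> fc (Suc n) i \<alpha> A \<in> cl n"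
  using face_cell[of A "Suc n" i] by simp
lemma dg_cl [simp]: "\<lbrakk>A \<in> cl n; 1 \<le> i; i \<le> Suc n\<rbrakk> \<Longrightarrow> dg n i A \<in> cl (Suc n)"
  using degen_cell[of A n i] by simp
lemma cn_cl [simp]: "\<lbrakk>A \<in> cl n; 1 \<le> i; i \<le> n\<rbrakk> \<Longrightarrow> cn n i \<alpha> A \<in> cl (Suc n)"
  using conn_cell[of A n i] by simp
lemma cp_cl [simp]:
  "\<lbrakk>A \<in> cl n; B \<in> cl n; 1 \<le> i; i \<le> n; fc n i Plus A = fc n i Minus B\<rbrakk> \<Longrightarrow> cp n i A B \<in> cl n"
  using comp_cell[of n i A B] by (simp add: composable_def)

lemma fc_fc: "\<lbrakk>A \<in> cl (Suc (Suc n)); 1 \<le> i; i \<le> j; j \<le> Suc n\<rbrakk> \<Longrightarrow>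
    fc (Suc n) j \<alpha> (fc (Suc (Suc n)) i \<beta> A) = fc (Suc n) i \<beta> (fc (Suc (Suc n)) (Suc j) \<alpha> A)"
  using face_face[of A "Suc (Suc n)" i "Suc j"] by simp

lemma fc_dg_less: "\<lbrakk>A \<in> cl (Suc n); 1 \<le> i; i < j; j \<le> Suc (Suc n)\<rbrakk> \<Longrightarrow>
    fc (Suc (Suc n)) i \<alpha> (dg (Suc n) j A) = dg n (j - 1) (fc (Suc n) i \<alpha> A)"
  using face_degen[of A "Suc n" i j] by (simp add: down_def)
lemma fc_dg_greater: "\<lbrakk>A \<in> cl (Suc n); 1 \<le> j; j < i; i \<le> Suc (Suc n)\<rbrakk> \<Longrightarrow>
    fc (Suc (Suc n)) i \<alpha> (dg (Suc n) j A) = dg n j (fc (Suc n) (i - 1) \<alpha> A)"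
  using face_degen[of A "Suc n" i j] by (simp add: down_def)
lemma fc_dg [simp]: "\<lbrakk>A \<in> cl n; 1 \<le> i; i \<le> Suc n\<rbrakk> \<Longrightarrow> fc (Suc n) i \<alpha> (dg n i A) = A"
  using face_degen_same[of A n i] by simp

lemma fc_cn_less: "\<lbrakk>A \<in> cl (Suc n); 1 \<le> i; i < j; j \<le> Suc n\<rbrakk> \<Longrightarrow>
    fc (Suc (Suc n)) i \<alpha> (cn (Suc n) j \<beta> A) = cn n (j - 1) \<beta> (fc (Suc n) i \<alpha> A)"
  using face_conn[of A "Suc n" i j] by (simp add: down_def)
lemma fc_cn_greater: "\<lbrakk>A \<in> cl (Suc n); 1 \<le> j; Suc j < i; i \<le> Suc (Suc n)\<rbrakk> \<Longrightarrow>
    fc (Suc (Suc n)) i \<alpha> (cn (Suc n) j \<beta> A) = cn n j \<beta> (fc (Suc n) (i - 1) \<alpha> A)"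
  using face_conn[of A "Suc n" i j] by (simp add: down_def)
lemma fc_cn_same [simp]:
  "\<lbrakk>A \<in> cl n; 1 \<le> j; j \<le> n\<rbrakk> \<Longrightarrow> fc (Suc n) j \<alpha> (cn n j \<alpha> A) = A"
  "\<lbrakk>A \<in> cl n; 1 \<le> j; j \<le> n\<rbrakk> \<Longrightarrow> fc (Suc n) (Suc j) \<alpha> (cn n j \<alpha> A) = A"
  using face_conn_same[of A n j] by simp_all
lemma fc_cn_opposite:
  "\<lbrakk>A \<in> cl (Suc n); 1 \<le> j; j \<le> Suc n; \<beta> \<noteq> \<alpha>\<rbrakk> \<Longrightarrow>
     fc (Suc (Suc n)) j \<alpha> (cn (Suc n) j \<beta> A) = dg n j (fc (Suc n) j \<alpha> A)"
  "\<lbrakk>A \<in> cl (Suc n); 1 \<le> j; j \<le> Suc n; \<beta> \<noteq> \<alpha>\<rbrakk> \<Longrightarrow>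
     fc (Suc (Suc n)) (Suc j) \<alpha> (cn (Suc n) j \<beta> A) = dg n j (fc (Suc n) j \<alpha> A)"
  using face_conn_opposite[of A "Suc n" j] by simp_all

lemma dg_dg: "\<lbrakk>A \<in> cl n; 1 \<le> i; i \<le> j; j \<le> Suc n\<rbrakk> \<Longrightarrow>
    dg (Suc n) i (dg n j A) = dg (Suc n) (Suc j) (dg n i A)"
  using degen_degen[of A n i j] by simp
lemma cn_cn: "\<lbrakk>A \<in> cl n; 1 \<le> i; i < j; j \<le> n\<rbrakk> \<Longrightarrow>
    cn (Suc n) i \<alpha> (cn n j \<beta> A) = cn (Suc n) (Suc j) \<beta> (cn n i \<alpha> A)"
  using conn_conn[of A n i j] by simp
lemma cn_cn_same: "\<lbrakk>A \<in> cl n; 1 \<le> i; i \<le> n\<rbrakk> \<Longrightarrow>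
    cn (Suc n) (Suc i) \<alpha> (cn n i \<alpha> A) = cn (Suc n) i \<alpha> (cn n i \<alpha> A)"
  using conn_conn_same[of A n i] by simp
lemma cn_dg_less: "\<lbrakk>A \<in> cl n; 1 \<le> i; i < j; j \<le> Suc n\<rbrakk> \<Longrightarrow>
    cn (Suc n) i \<alpha> (dg n j A) = dg (Suc n) (Suc j) (cn n i \<alpha> A)"
  using conn_degen[of A n i j] by (simp add: down_def up_def)
lemma cn_dg_greater: "\<lbrakk>A \<in> cl n; 1 \<le> j; j < i; i \<le> Suc n\<rbrakk> \<Longrightarrow>
    cn (Suc n) i \<alpha> (dg n j A) = dg (Suc n) j (cn n (i - 1) \<alpha> A)"
  using conn_degen[of A n i j] by (simp add: down_def up_def)
lemma cn_dg_same: "\<lbrakk>A \<in> cl n; 1 \<le> i; i \<le> Suc n\<rbrakk> \<Longrightarrow>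
    cn (Suc n) i \<alpha> (dg n i A) = dg (Suc n) i (dg n i A)"
  using conn_degen_same[of A n i] by simp

lemma fc_cp_less: "\<lbrakk>A \<in> cl (Suc n); B \<in> cl (Suc n); fc (Suc n) j Plus A = fc (Suc n) j Minus B;
    1 \<le> i; i < j; j \<le> Suc n\<rbrakk> \<Longrightarrow>
    fc (Suc n) i \<alpha> (cp (Suc n) j A B) = cp n (j - 1) (fc (Suc n) i \<alpha> A) (fc (Suc n) i \<alpha> B)"
  using face_comp[of "Suc n" j A B i] by (simp add: down_def composable_def)
lemma fc_cp_greater: "\<lbrakk>A \<in> cl (Suc n); B \<in> cl (Suc n); fc (Suc n) j Plus A = fc (Suc n) j Minus B;
    1 \<le> j; j < i; i \<le> Suc n\<rbrakk> \<Longrightarrow>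
    fc (Suc n) i \<alpha> (cp (Suc n) j A B) = cp n j (fc (Suc n) i \<alpha> A) (fc (Suc n) i \<alpha> B)"
  using face_comp[of "Suc n" j A B i] by (simp add: down_def composable_def)
lemma fc_cp [simp]:
  "\<lbrakk>A \<in> cl n; B \<in> cl n; 1 \<le> i; i \<le> n; fc n i Plus A = fc n i Minus B\<rbrakk> \<Longrightarrow>
     fc n i Minus (cp n i A B) = fc n i Minus A"
  "\<lbrakk>A \<in> cl n; B \<in> cl n; 1 \<le> i; i \<le> n; fc n i Plus A = fc n i Minus B\<rbrakk> \<Longrightarrow>
     fc n i Plus (cp n i A B) = fc n i Plus B"
  using face_comp_Minus[of n i A B] face_comp_Plus[of n i A B] by (simp_all add: composable_def)

lemma cp_assoc: "\<lbrakk>A \<in> cl n; B \<in> cl n; E \<in> cl n; 1 \<le> i; i \<le> n; fc n i Plus A = fc n i Minus B;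
    fc n i Plus B = fc n i Minus E\<rbrakk> \<Longrightarrow> cp n i (cp n i A B) E = cp n i A (cp n i B E)"
  using comp_assoc[of n i A B E] by (simp add: composable_def)
lemma cp_dg:
  "\<lbrakk>A \<in> cl (Suc n); 1 \<le> i; i \<le> Suc n; e = fc (Suc n) i Minus A\<rbrakk> \<Longrightarrow> cp (Suc n) i (dg n i e) A = A"
  "\<lbrakk>A \<in> cl (Suc n); 1 \<le> i; i \<le> Suc n; e = fc (Suc n) i Plus A\<rbrakk> \<Longrightarrow> cp (Suc n) i A (dg n i e) = A"
  using comp_degen_left[of A "Suc n" i] comp_degen_right[of A "Suc n" i] by simp_all

lemma cp_exch:
  "\<lbrakk>A \<in> cl n; B \<in> cl n; E \<in> cl n; F \<in> cl n; 1 \<le> i; i \<le> n; 1 \<le> j; j \<le> n; i \<noteq> j;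
    fc n i Plus A = fc n i Minus B; fc n i Plus E = fc n i Minus F;
    fc n j Plus A = fc n j Minus E; fc n j Plus B = fc n j Minus F\<rbrakk> \<Longrightarrow>
    cp n j (cp n i A B) (cp n i E F) = cp n i (cp n j A E) (cp n j B F)"
  using interchange[of n i A B E F j] by (simp add: composable_def)

lemma dg_cp_le: "\<lbrakk>A \<in> cl n; B \<in> cl n; fc n j Plus A = fc n j Minus B; 1 \<le> i; i \<le> j; j \<le> n\<rbrakk> \<Longrightarrow>
    dg n i (cp n j A B) = cp (Suc n) (Suc j) (dg n i A) (dg n i B)"
  using degen_comp[of n j A B i] by (simp add: up_def composable_def)
lemma dg_cp_greater: "\<lbrakk>A \<in> cl n; B \<in> cl n; fc n j Plus A = fc n j Minus B; 1 \<le> j; j < i; j \<le> n; i \<le> Suc n\<rbrakk> \<Longrightarrow>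
    dg n i (cp n j A B) = cp (Suc n) j (dg n i A) (dg n i B)"
  using degen_comp[of n j A B i] by (simp add: up_def composable_def)
lemma cn_cp_less: "\<lbrakk>A \<in> cl n; B \<in> cl n; fc n j Plus A = fc n j Minus B; 1 \<le> i; i < j; j \<le> n\<rbrakk> \<Longrightarrow>
    cn n i \<alpha> (cp n j A B) = cp (Suc n) (Suc j) (cn n i \<alpha> A) (cn n i \<alpha> B)"
  using conn_comp[of n j A B i] by (simp add: up_def composable_def)
lemma cn_cp_greater: "\<lbrakk>A \<in> cl n; B \<in> cl n; fc n j Plus A = fc n j Minus B; 1 \<le> j; j < i; i \<le> n\<rbrakk> \<Longrightarrow>
    cn n i \<alpha> (cp n j A B) = cp (Suc n) j (cn n i \<alpha> A) (cn n i \<alpha> B)"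
  using conn_comp[of n j A B i] by (simp add: up_def composable_def)
lemma cn_cp_Minus: "\<lbrakk>A \<in> cl n; B \<in> cl n; fc n i Plus A = fc n i Minus B; 1 \<le> i; i \<le> n\<rbrakk> \<Longrightarrow>
    cn n i Minus (cp n i A B) = cp (Suc n) (Suc i) (cp (Suc n) i (cn n i Minus A) (dg n (Suc i) B))
      (cp (Suc n) i (dg n i B) (cn n i Minus B))"
  using conn_comp_Minus[of n i A B] by (simp add: composable_def)
lemma cn_cp_Plus: "\<lbrakk>A \<in> cl n; B \<in> cl n; fc n i Plus A = fc n i Minus B; 1 \<le> i; i \<le> n\<rbrakk> \<Longrightarrow>
    cn n i Plus (cp n i A B) = cp (Suc n) (Suc i) (cp (Suc n) i (cn n i Plus A) (dg n i A))
      (cp (Suc n) i (dg n (Suc i) A) (cn n i Plus B))"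
  using conn_comp_Plus[of n i A B] by (simp add: composable_def)
lemma cn_transport:
  "\<lbrakk>A \<in> cl n; 1 \<le> i; i \<le> n\<rbrakk> \<Longrightarrow> cp (Suc n) i (cn n i Plus A) (cn n i Minus A) = dg n (Suc i) A"
  "\<lbrakk>A \<in> cl n; 1 \<le> i; i \<le> n\<rbrakk> \<Longrightarrow> cp (Suc n) (Suc i) (cn n i Plus A) (cn n i Minus A) = dg n i A"
  using conn_transport[of A n i] conn_transport_Suc[of A n i] by simp_all

lemma double_category_directions:
  assumes "1 \<le> i" "i \<le> Suc n"
  shows "double_category (cl n) (cl (Suc n)) (cl (Suc (Suc n)))
    (fc (Suc n) i Minus) (fc (Suc n) i Plus) (dg n i) (cp (Suc n) i)
    (fc (Suc (Suc n)) i Minus) (fc (Suc (Suc n)) i Plus)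
    (fc (Suc (Suc n)) (Suc i) Minus) (fc (Suc (Suc n)) (Suc i) Plus)
    (dg (Suc n) i) (dg (Suc n) (Suc i)) (cn (Suc n) i Minus) (cn (Suc n) i Plus)
    (cp (Suc (Suc n)) i) (cp (Suc (Suc n)) (Suc i))"
  using assms
  by unfold_locales
    (simp_all add: fc_fc fc_dg_less fc_dg_greater fc_cn_opposite fc_cp_less fc_cp_greater cp_assoc
      cp_dg dg_cp_le dg_cp_greater cn_cp_Minus cn_cp_Plus cn_transport cn_dg_same dg_dg cp_exch)

text \<open>Two-sided inverses for \<star>_i. For the double category of directions i and i+1 this
  is \<open>vpair\<close>, and with i+1 in place of i it is \<open>hpair\<close>.\<close>

definition Rp :: "nat \<Rightarrow> nat \<Rightarrow> 'a \<Rightarrow> 'a \<Rightarrow> bool" where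
  "Rp n i X Y \<longleftrightarrow> 1 \<le> i \<and> i \<le> n \<and> X \<in> cl n \<and> Y \<in> cl n \<and>
     fc n i Plus X = fc n i Minus Y \<and> fc n i Plus Y = fc n i Minus X \<and>
     cp n i X Y = dg (n - 1) i (fc n i Minus X) \<and> cp n i Y X = dg (n - 1) i (fc n i Minus Y)"

definition Pf :: "nat \<Rightarrow> nat \<Rightarrow> 'a \<Rightarrow> 'a" where
  "Pf n i X = cp n (Suc i) (cn (n - 1) i Plus (fc n (Suc i) Minus X))
    (cp n (Suc i) X (cn (n - 1) i Minus (fc n (Suc i) Plus X)))"

definition Qf :: "nat \<Rightarrow> nat \<Rightarrow> 'a \<Rightarrow> 'a" where
  "Qf n i X = cp n i (cn (n - 1) i Plus (fc n i Minus X))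
    (cp n i X (cn (n - 1) i Minus (fc n i Plus X)))"

abbreviation "Tp \<equiv> is_T_inverse C"

section \<open>Results on double categories, read in the directions i and i+1\<close>

context
  fixes n i :: nat
  assumes i: "1 \<le> i" "i \<le> Suc n"
begin

lemmas dc = double_category_directions[OF i]

lemma dc_Tp: "double_category.Tp (cl (Suc (Suc n)))
    (fc (Suc (Suc n)) i Minus) (fc (Suc (Suc n)) i Plus)
    (fc (Suc (Suc n)) (Suc i) Minus) (fc (Suc (Suc n)) (Suc i) Plus)
    (cn (Suc n) i Minus) (cn (Suc n) i Plus)
    (cp (Suc (Suc n)) i) (cp (Suc (Suc n)) (Suc i)) = Tp (Suc (Suc n)) i"
  using i by (intro ext) (auto simp: is_T_inverse_def T_equation_def polarity_cases_eq
    double_category.Tp_def[OF dc] double_category.Teq_def[OF dc] double_category.swapped_def[OF dc])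

lemma dc_vpair: "double_category.vpair (cl (Suc (Suc n)))
    (fc (Suc (Suc n)) i Minus) (fc (Suc (Suc n)) i Plus) (dg (Suc n) i) (cp (Suc (Suc n)) i) =
    Rp (Suc (Suc n)) i"
  using i by (intro ext) (auto simp: double_category.vpair_def[OF dc] Rp_def)

lemma dc_hpair: "double_category.hpair (cl (Suc (Suc n)))
    (fc (Suc (Suc n)) (Suc i) Minus) (fc (Suc (Suc n)) (Suc i) Plus) (dg (Suc n) (Suc i))
    (cp (Suc (Suc n)) (Suc i)) = Rp (Suc (Suc n)) (Suc i)"
  using i by (intro ext) (auto simp: double_category.hpair_def[OF dc] Rp_def)

lemma dc_epair: "double_category.epair (cl (Suc n)) (fc (Suc n) i Minus) (fc (Suc n) i Plus)
    (dg n i) (cp (Suc n) i) = Rp (Suc n) i"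
  using i by (intro ext) (auto simp: double_category.epair_def[OF dc] Rp_def)

lemma dc_P: "double_category.P (fc (Suc (Suc n)) (Suc i) Minus) (fc (Suc (Suc n)) (Suc i) Plus)
    (cn (Suc n) i Minus) (cn (Suc n) i Plus) (cp (Suc (Suc n)) (Suc i)) = Pf (Suc (Suc n)) i"
  by (rule ext) (simp add: double_category.P_def[OF dc] Pf_def)

lemma dc_Q: "double_category.Q (fc (Suc (Suc n)) i Minus) (fc (Suc (Suc n)) i Plus)
    (cn (Suc n) i Minus) (cn (Suc n) i Plus) (cp (Suc (Suc n)) i) = Qf (Suc (Suc n)) i"
  by (rule ext) (simp add: double_category.Q_def[OF dc] Qf_def)

lemmas dc_unfold = dc_Tp dc_vpair dc_hpair dc_epair dc_P dc_Q

lemmas Tp_unique_aux = double_category.Tp_unique[OF dc, unfolded dc_unfold]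
lemmas Tp_vc = double_category.Tp_vc[OF dc, unfolded dc_unfold]
lemmas Tp_hc = double_category.Tp_hc[OF dc, unfolded dc_unfold]
lemmas Tp_dg = double_category.Tp_V_H[OF dc, unfolded dc_unfold]
lemmas Tp_cn_Minus = double_category.Tp_Gm[OF dc, unfolded dc_unfold]
lemmas Tp_cn_Plus = double_category.Tp_Gp[OF dc, unfolded dc_unfold]
lemmas Rp_Suc_imp_Tp = double_category.hpair_imp_Tp[OF dc, unfolded dc_unfold]
lemmas Tp_imp_Rp = double_category.Tp_imp_vpair[OF dc, unfolded dc_unfold]
lemmas Tp_Rp_Pf = double_category.Tp_vpair[OF dc, unfolded dc_unfold]
lemmas Rp_Qf_Tp = double_category.hpair_Q_Tp[OF dc, unfolded dc_unfold]
lemmas Tp_Rp_Qf = double_category.Tp_hpair_Q[OF dc, unfolded dc_unfold]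
lemmas Pf_closed = double_category.P_closed[OF dc, unfolded dc_unfold]
lemmas Qf_closed = double_category.Q_closed[OF dc, unfolded dc_unfold]
lemmas unfold_Pf_closed = double_category.unfold_P_closed[OF dc, unfolded dc_unfold]
lemmas unfold_Qf_closed = double_category.unfold_Q_closed[OF dc, unfolded dc_unfold]
lemmas Rp_cn_same = double_category.vpair_Gm[OF dc, unfolded dc_unfold]
lemmas Rp_cn_Suc = double_category.hpair_Gm[OF dc, unfolded dc_unfold dc_epair]
lemmas Pf_thin_cp = double_category.P_thin_vc[OF dc, unfolded dc_unfold]
lemmas Pf_cn_dg = double_category.P_Gm_V[OF dc, unfolded dc_unfold]
lemmas Pf_glob = double_category.P_glob[OF dc, unfolded dc_unfold]
lemmas Pf_dg = double_category.P_H[OF dc, unfolded dc_unfold]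
lemmas cn_dg_cn = double_category.Gm_H_Gm[OF dc, unfolded dc_unfold]
lemmas Rp_Tp_Pf = double_category.hpair_Tp_P[OF dc, unfolded dc_unfold]
lemmas Rp_Pf_imp_Tp = double_category.vpair_P_imp_Tp[OF dc, unfolded dc_unfold double_category.swapped_def[OF dc]]

lemmas Pf_cl = double_category.P_Sq[OF dc, unfolded dc_unfold]
lemmas fc_Pf_same = double_category.top_P[OF dc, unfolded dc_unfold]
  double_category.bot_P[OF dc, unfolded dc_unfold]
lemmas fc_Pf_Suc = double_category.lef_P[OF dc, unfolded dc_unfold]
  double_category.rig_P[OF dc, unfolded dc_unfold]
lemmas fc_Qf_same = double_category.top_Q[OF dc, unfolded dc_unfold]
  double_category.bot_Q[OF dc, unfolded dc_unfold]
lemmas cn_cancel = double_category.vc_Gm_cancel[OF dc, unfolded dc_unfold]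
lemmas cn_cancel_Suc = double_category.hc_Gm_cancel[OF dc, unfolded dc_unfold]

end

section \<open>T_i-inverses under operations in other directions\<close>

lemma TpD:
  assumes "Tp n i A B"
  shows "1 \<le> i" "i < n" "A \<in> cl n" "B \<in> cl n" "fc n i \<alpha> A = fc n (Suc i) \<alpha> B" "fc n (Suc i) \<alpha> A = fc n i \<alpha> B"
  using assms by (auto simp: is_T_inverse_def)

lemma Tp_dim:
  assumes "Tp n i A B"
  obtains m where "n = Suc (Suc m)" "Suc 0 \<le> i" "i \<le> Suc m"
  using TpD(1,2)[OF assms] that[of "n - 2"] by force

lemma Tp_equation:
  assumes "Tp n i A B"
  shows "cp n (Suc i) (cp n i (cn (n - 1) i Plus (fc n (Suc i) Minus A)) B)
      (cp n i A (cn (n - 1) i Minus (fc n i Plus A))) =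
    cp n i (cn (n - 1) i Minus (fc n i Minus A)) (cn (n - 1) i Plus (fc n (Suc i) Plus A))"
  using assms unfolding is_T_inverse_def T_equation_def Suc_eq_plus1 by blast

lemma Tp_sym: "Tp n i A B \<Longrightarrow> Tp n i B A"
  by (auto simp: is_T_inverse_def)

lemma Tp_unique: "\<lbrakk>Tp n i A B; Tp n i A B'\<rbrakk> \<Longrightarrow> B = B'"
  by (metis Tp_dim Tp_unique_aux One_nat_def)

text \<open>\<open>f\<close> stands for a face, degeneracy or connection in a direction other than i
  and i+1, \<open>g\<close> for the same operation one dimension lower, and \<open>i'\<close> for
  the new number of direction i. The T-equation is written with operations in the directions i and
  i+1 only, so \<open>f\<close> carries it over.\<close>

lemma Tp_functor:
  assumes T: "Tp n i A B" and i': "1 \<le> i'" "i' < n'"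
    and f: "\<And>X. X \<in> cl n \<Longrightarrow> f X \<in> cl n'"
    and f_fc: "\<And>X \<alpha>. X \<in> cl n \<Longrightarrow> fc n' i' \<alpha> (f X) = g (fc n i \<alpha> X)"
      "\<And>X \<alpha>. X \<in> cl n \<Longrightarrow> fc n' (Suc i') \<alpha> (f X) = g (fc n (Suc i) \<alpha> X)"
    and f_cn: "\<And>e \<alpha>. e \<in> cl (n - 1) \<Longrightarrow> f (cn (n - 1) i \<alpha> e) = cn (n' - 1) i' \<alpha> (g e)"
    and f_cp: "\<And>X Y. \<lbrakk>X \<in> cl n; Y \<in> cl n; fc n i Plus X = fc n i Minus Y\<rbrakk> \<Longrightarrow>
        f (cp n i X Y) = cp n' i' (f X) (f Y)"
      "\<And>X Y. \<lbrakk>X \<in> cl n; Y \<in> cl n; fc n (Suc i) Plus X = fc n (Suc i) Minus Y\<rbrakk> \<Longrightarrow>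
        f (cp n (Suc i) X Y) = cp n' (Suc i') (f X) (f Y)"
  shows "Tp n' i' (f A) (f B)"
proof -
  obtain m where n: "n = Suc (Suc m)" "Suc 0 \<le> i" "i \<le> Suc m" using T by (rule Tp_dim)
  have *: "T_equation C n' i' (f A) (f B)" if T: "Tp n i A B" for A B
  proof -
    note [simp] = TpD(3,4)[OF T, unfolded n(1)] n(2,3) le_SucI[OF n(3)]
    have [simp]: "fc (Suc (Suc m)) i \<alpha> B = fc (Suc (Suc m)) (Suc i) \<alpha> A"
      "fc (Suc (Suc m)) (Suc i) \<alpha> B = fc (Suc (Suc m)) i \<alpha> A" for \<alpha>
      using TpD(5,6)[OF T] n(1) by auto
    note f' = f_fc[unfolded n(1), simplified] f_cn[unfolded n(1), simplified] f_cp[unfolded n(1), simplified]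
    have "f (cp n (Suc i) (cp n i (cn (n - 1) i Plus (fc n (Suc i) Minus A)) B)
        (cp n i A (cn (n - 1) i Minus (fc n i Plus A)))) =
      f (cp n i (cn (n - 1) i Minus (fc n i Minus A)) (cn (n - 1) i Plus (fc n (Suc i) Plus A)))"
      using Tp_equation[OF T] by (rule arg_cong)
    then show ?thesis
      unfolding T_equation_def n(1)
      by (simp add: f' fc_fc fc_cn_opposite fc_cp_less fc_cp_greater)
  qed
  have s: "fc n i \<alpha> A = fc n (Suc i) \<alpha> B \<and> fc n (Suc i) \<alpha> A = fc n i \<alpha> B" for \<alpha>
    using TpD(5,6)[OF T] by auto
  show ?thesis
    unfolding is_T_inverse_def
    using * T Tp_sym[OF T] i' TpD(3,4)[OF T] by (simp add: f f_fc s)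
qed

lemma Tp_fc_less:
  assumes "Tp (Suc n) (Suc i) A B" "1 \<le> k" "k \<le> i"
  shows "Tp n i (fc (Suc n) k \<alpha> A) (fc (Suc n) k \<alpha> B)"
proof -
  obtain m where [simp]: "n = Suc (Suc m)" using assms TpD(2)[OF assms(1)] by (cases n; cases "n - 1") auto
  have "i \<le> Suc m" using TpD(2)[OF assms(1)] by simp
  then show ?thesis using assms
    by (intro Tp_functor[of _ _ _ _ i n "fc (Suc n) k \<alpha>" "fc n k \<alpha>"])
      (auto simp: fc_fc fc_cn_less fc_cp_less)
qed

lemma Tp_fc_greater:
  assumes "Tp (Suc n) i A B" "Suc i < k" "k \<le> Suc n"
  shows "Tp n i (fc (Suc n) k \<alpha> A) (fc (Suc n) k \<alpha> B)"
proof -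
  obtain m where [simp]: "n = Suc (Suc m)" using assms TpD(1,2)[OF assms(1)] by (cases n; cases "n - 1") auto
  obtain k' where [simp]: "k = Suc k'" using assms by (cases k) auto
  have "1 \<le> i" using TpD(1)[OF assms(1)] by simp
  then show ?thesis using assms
    by (intro Tp_functor[of _ _ _ _ i n "fc (Suc n) k \<alpha>" "fc n k' \<alpha>"])
      (auto simp: fc_fc fc_cn_greater fc_cp_greater)
qed

lemma Tp_dg_le:
  assumes T: "Tp n i A B" and k: "1 \<le> k" "k \<le> i"
  shows "Tp (Suc n) (Suc i) (dg n k A) (dg n k B)"
proof -
  from T obtain m where [simp]: "n = Suc (Suc m)" and i: "Suc 0 \<le> i" "i \<le> Suc m" by (rule Tp_dim)
  show ?thesis using T k i
    by (intro Tp_functor[of _ _ _ _ _ _ "dg n k" "dg (Suc m) k"])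
      (auto simp: fc_dg_greater cn_dg_greater dg_cp_le)
qed

lemma Tp_dg_greater:
  assumes T: "Tp n i A B" and k: "Suc i < k" "k \<le> Suc n"
  shows "Tp (Suc n) i (dg n k A) (dg n k B)"
proof -
  from T obtain m where [simp]: "n = Suc (Suc m)" and i: "Suc 0 \<le> i" "i \<le> Suc m" by (rule Tp_dim)
  obtain k' where [simp]: "k = Suc k'" using assms by (cases k) auto
  show ?thesis using T k i
    by (intro Tp_functor[of _ _ _ _ _ _ "dg n k" "dg (Suc m) k'"])
      (auto simp: fc_dg_less cn_dg_less dg_cp_greater)
qed

lemma Tp_cn_less:
  assumes T: "Tp n i A B" and k: "1 \<le> k" "k < i"
  shows "Tp (Suc n) (Suc i) (cn n k \<alpha> A) (cn n k \<alpha> B)"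
proof -
  from T obtain m where [simp]: "n = Suc (Suc m)" and i: "Suc 0 \<le> i" "i \<le> Suc m" by (rule Tp_dim)
  show ?thesis using T k i
    by (intro Tp_functor[of _ _ _ _ _ _ "cn n k \<alpha>" "cn (Suc m) k \<alpha>"])
      (auto simp: fc_cn_greater cn_cn cn_cp_less)
qed

lemma Tp_cn_greater:
  assumes T: "Tp n i A B" and k: "Suc i < k" "k \<le> n"
  shows "Tp (Suc n) i (cn n k \<alpha> A) (cn n k \<alpha> B)"
proof -
  from T obtain m where [simp]: "n = Suc (Suc m)" and i: "Suc 0 \<le> i" "i \<le> Suc m" by (rule Tp_dim)
  obtain k' where [simp]: "k = Suc k'" using assms by (cases k) auto
  show ?thesis using T k i
    by (intro Tp_functor[of _ _ _ _ _ _ "cn n k \<alpha>" "cn (Suc m) k' \<alpha>"])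
      (auto simp: fc_cn_less cn_cn cn_cp_greater)
qed

text \<open>Faces of T-inverses are T-inverses of faces, so uniqueness carries the equation over.
  This provides composability in \<open>Tp_cp\<close>.\<close>

lemma Tp_fc_eq:
  assumes T: "Tp n i A B" "Tp n i A' B'" and k: "1 \<le> k" "k \<le> n" "k \<noteq> i" "k \<noteq> Suc i"
    and e: "fc n k \<alpha> A = fc n k \<beta> A'"
  shows "fc n k \<alpha> B = fc n k \<beta> B'"
proof -
  obtain m where n: "n = Suc m" using k by (cases n) auto
  show ?thesis
  proof (cases "k < i")
    case True
    then obtain i' where "i = Suc i'" by (cases i) auto
    then show ?thesis using Tp_fc_less[of m i' A B k \<alpha>] Tp_fc_less[of m i' A' B' k \<beta>] T True k e Tp_unique n
      by (metis less_Suc_eq_le)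
  next
    case False
    then show ?thesis using Tp_fc_greater[of m i A B k \<alpha>] Tp_fc_greater[of m i A' B' k \<beta>] T k e Tp_unique n
      by (metis Suc_leI le_neq_implies_less not_less)
  qed
qed

text \<open>Both sides of the T-equation distribute over \<star>_k by interchange, so the equation
  for the composites is the \<star>_k-composite of the two given ones.\<close>

lemma Tp_cp:
  assumes T: "Tp n i A B" "Tp n i A' B'" and k: "1 \<le> k" "k \<le> n" "k \<noteq> i" "k \<noteq> Suc i"
    and e: "fc n k Plus A = fc n k Minus A'"
  shows "Tp n i (cp n k A A') (cp n k B B')"
proof -
  have eB: "fc n k Plus B = fc n k Minus B'" using Tp_fc_eq[OF T k e] .
  have *: "T_equation C n i (cp n k A A') (cp n k B B') \<and>
    (\<forall>\<alpha>. fc n i \<alpha> (cp n k A A') = fc n (Suc i) \<alpha> (cp n k B B'))"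
    if T: "Tp n i A B" "Tp n i A' B'" and e: "fc n k Plus A = fc n k Minus A'"
      "fc n k Plus B = fc n k Minus B'" for A A' B B'
  proof -
    obtain m where n: "n = Suc (Suc m)" "Suc 0 \<le> i" "i \<le> Suc m" using T(1) by (rule Tp_dim)
    note [simp] = TpD(3,4)[OF T(1), unfolded n(1)] TpD(3,4)[OF T(2), unfolded n(1)] n(2,3) le_SucI[OF n(3)] e[unfolded n(1)]
    note [simp] = TpD(5,6)[OF T(1), unfolded n(1), symmetric] TpD(5,6)[OF T(2), unfolded n(1), symmetric]
    let ?L = "\<lambda>A B. cp n (Suc i) (cp n i (cn (n - 1) i Plus (fc n (Suc i) Minus A)) B)
        (cp n i A (cn (n - 1) i Minus (fc n i Plus A)))"
    let ?R = "\<lambda>A B. cp n i (cn (n - 1) i Minus (fc n i Minus A)) (cn (n - 1) i Plus (fc n (Suc i) Plus A))"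
    have q: "?L A B = ?R A B" "?L A' B' = ?R A' B'"
      using Tp_equation[OF T(1)] Tp_equation[OF T(2)] by auto
    have ks: "k \<le> Suc (Suc m)" "Suc 0 \<le> k" using k n by auto
    have e': "fc (Suc (Suc m)) k Plus A = fc (Suc (Suc m)) k Minus A'" using e n by simp
    consider "k < i" | "Suc i < k" using k by linarith
    then have "?L (cp n k A A') (cp n k B B') = cp n k (?L A B) (?L A' B') \<and>
      ?R (cp n k A A') (cp n k B B') = cp n k (?R A B) (?R A' B') \<and>
      (\<forall>\<alpha>. fc n i \<alpha> (cp n k A A') = fc n (Suc i) \<alpha> (cp n k B B'))"
    proof cases
      case 1
      then have "k \<le> i - Suc 0" "i - Suc 0 \<le> Suc m" using n(3) by linarith+
      then have [simp]: "fc (Suc m) k Plus (fc (Suc (Suc m)) i \<alpha> A) = fc (Suc m) k Minus (fc (Suc (Suc m)) i \<alpha> A')"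
          "fc (Suc m) k Plus (fc (Suc (Suc m)) (Suc i) \<alpha> A) = fc (Suc m) k Minus (fc (Suc (Suc m)) (Suc i) \<alpha> A')" for \<alpha>
        using e' 1 ks fc_fc[of A m k "i - 1" \<alpha> Plus] fc_fc[of A' m k "i - 1" \<alpha> Minus]
          fc_fc[of A m k i \<alpha> Plus] fc_fc[of A' m k i \<alpha> Minus] by simp_all
      show ?thesis using 1 ks unfolding n(1)
        by (simp add: fc_cp_greater cn_cp_less cn_cp_greater fc_cn_less cp_exch[where i=k] fc_cn_opposite
            fc_cp_less fc_fc)
    next
      case 2
      then have "i \<le> k - Suc 0" "Suc i \<le> k - Suc 0" "k - Suc 0 \<le> Suc m" using ks by linarith+
      then have [simp]: "fc (Suc m) (k - Suc 0) Plus (fc (Suc (Suc m)) i \<alpha> A) = fc (Suc m) (k - Suc 0) Minus (fc (Suc (Suc m)) i \<alpha> A')"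
          "fc (Suc m) (k - Suc 0) Plus (fc (Suc (Suc m)) (Suc i) \<alpha> A) = fc (Suc m) (k - Suc 0) Minus (fc (Suc (Suc m)) (Suc i) \<alpha> A')" for \<alpha>
        using e' 2 ks fc_fc[of A m i "k - 1" Plus \<alpha>] fc_fc[of A' m i "k - 1" Minus \<alpha>]
          fc_fc[of A m "Suc i" "k - 1" Plus \<alpha>] fc_fc[of A' m "Suc i" "k - 1" Minus \<alpha>] by simp_all
      show ?thesis using 2 ks unfolding n(1)
        by (simp add: fc_cp_greater fc_cp_less cn_cp_less cn_cp_greater fc_cn_greater
            cp_exch[where i=k] fc_cn_opposite fc_fc)
    qed
    then show ?thesis unfolding T_equation_def Suc_eq_plus1[symmetric] q[symmetric] using q by metis
  qed
  show ?thesis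
    unfolding is_T_inverse_def
    using *[OF T e eB] *[OF Tp_sym[OF T(1)] Tp_sym[OF T(2)] eB e] TpD(1-4)[OF T(1)] TpD(3,4)[OF T(2)] k e eB
    by auto
qed

section \<open>Inverses for a single composition\<close>

lemma RpD:
  assumes "Rp n i X Y"
  shows "1 \<le> i" "i \<le> n" "X \<in> cl n" "Y \<in> cl n" "fc n i Plus X = fc n i Minus Y"
    "fc n i Plus Y = fc n i Minus X" "cp n i X Y = dg (n - 1) i (fc n i Minus X)"
    "cp n i Y X = dg (n - 1) i (fc n i Minus Y)"
  using assms by (auto simp: Rp_def)

lemma Rp_sym: "Rp n i X Y \<Longrightarrow> Rp n i Y X"
  by (auto simp: Rp_def)

lemma Rp_unique:
  assumes "Rp n i X Y" "Rp n i X Y'"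
  shows "Y = Y'"
proof -
  note D = RpD[OF assms(1)] and D' = RpD[OF assms(2)]
  obtain m where n: "n = Suc m" using D(1,2) by (cases n) auto
  have "Y = cp n i Y (dg m i (fc n i Minus X))" using D n by (simp add: cp_dg)
  also have "\<dots> = cp n i Y (cp n i X Y')" using D'(7) n by simp
  also have "\<dots> = cp n i (cp n i Y X) Y'" by (rule cp_assoc[symmetric]) (use D D' in auto)
  also have "\<dots> = Y'" using D D' n by (simp add: cp_dg)
  finally show ?thesis .
qed

text \<open>As in \<open>Tp_functor\<close>, \<open>f\<close> is an operation in another direction
  and \<open>g\<close> its version one dimension lower.\<close>

lemma Rp_functor:
  assumes R: "Rp n q X Y" and q': "1 \<le> q'" "q' \<le> n'"
    and f: "\<And>X. X \<in> cl n \<Longrightarrow> f X \<in> cl n'"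
    and f_fc: "\<And>X \<alpha>. X \<in> cl n \<Longrightarrow> fc n' q' \<alpha> (f X) = g (fc n q \<alpha> X)"
    and f_dg: "\<And>e. e \<in> cl (n - 1) \<Longrightarrow> f (dg (n - 1) q e) = dg (n' - 1) q' (g e)"
    and f_cp: "\<And>X Y. \<lbrakk>X \<in> cl n; Y \<in> cl n; fc n q Plus X = fc n q Minus Y\<rbrakk> \<Longrightarrow>
        f (cp n q X Y) = cp n' q' (f X) (f Y)"
  shows "Rp n' q' (f X) (f Y)"
proof -
  note D = RpD[OF R]
  have "fc n q Minus X \<in> cl (n - 1)" "fc n q Minus Y \<in> cl (n - 1)" using D face_cell[of X n q] face_cell[of Y n q] by auto
  then have "cp n' q' (f X) (f Y) = dg (n' - 1) q' (fc n' q' Minus (f X))"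
    "cp n' q' (f Y) (f X) = dg (n' - 1) q' (fc n' q' Minus (f Y))"
    using D f_cp[of X Y, symmetric] f_cp[of Y X, symmetric] f_dg f_fc by simp_all
  then show ?thesis unfolding Rp_def using D q' by (simp add: f f_fc)
qed

lemma Rp_fc_less:
  assumes R: "Rp (Suc n) (Suc q) A B" and k: "1 \<le> k" "k \<le> q"
  shows "Rp n q (fc (Suc n) k \<alpha> A) (fc (Suc n) k \<alpha> B)"
proof -
  have q: "q \<le> n" using RpD[OF R] by simp
  then obtain m where n: "n = Suc m" using k by (cases n) auto
  show ?thesis using R k q unfolding n
    by (intro Rp_functor[of _ _ _ _ _ _ "fc (Suc (Suc m)) k \<alpha>" "fc (Suc m) k \<alpha>"])
      (auto simp: fc_fc fc_dg_less fc_cp_less)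
qed

lemma Rp_fc_greater:
  assumes R: "Rp (Suc n) q A B" and k: "q < k" "k \<le> Suc n"
  shows "Rp n q (fc (Suc n) k \<alpha> A) (fc (Suc n) k \<alpha> B)"
proof -
  have q: "1 \<le> q" using RpD[OF R] by simp
  then obtain m where n: "n = Suc m" using k by (cases n) auto
  obtain k' where k': "k = Suc k'" using k by (cases k) auto
  show ?thesis using R k q unfolding n k'
    by (intro Rp_functor[of _ _ _ _ _ _ "fc (Suc (Suc m)) (Suc k') \<alpha>" "fc (Suc m) k' \<alpha>"])
      (auto simp: fc_fc fc_dg_greater fc_cp_greater)
qed

lemma Rp_dg_greater:
  assumes R: "Rp n q A B" and k: "q < k" "k \<le> Suc n"
  shows "Rp (Suc n) q (dg n k A) (dg n k B)"
proof -
  have q: "1 \<le> q" "q \<le> n" using RpD[OF R] by simp_all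
  then obtain m where n: "n = Suc m" using k by (cases n) auto
  obtain k' where k': "k = Suc k'" using k by (cases k) auto
  show ?thesis using R k q unfolding n k'
    by (intro Rp_functor[of _ _ _ _ _ _ "dg (Suc m) (Suc k')" "dg m k'"])
      (auto simp: dg_dg fc_dg_less dg_cp_greater)
qed

lemma Rp_cn_less:
  assumes R: "Rp n q A B" and k: "1 \<le> k" "k < q"
  shows "Rp (Suc n) (Suc q) (cn n k \<alpha> A) (cn n k \<alpha> B)"
proof -
  have q: "1 \<le> q" "q \<le> n" using RpD[OF R] by simp_all
  then obtain m where n: "n = Suc m" using k by (cases n) auto
  show ?thesis using R k q unfolding n
    by (intro Rp_functor[of _ _ _ _ _ _ "cn (Suc m) k \<alpha>" "cn m k \<alpha>"])
      (auto simp: fc_cn_greater cn_dg_less cn_cp_less)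
qed

lemma Rp_cn_greater:
  assumes R: "Rp n q A B" and k: "q < k" "k \<le> n"
  shows "Rp (Suc n) q (cn n k \<alpha> A) (cn n k \<alpha> B)"
proof -
  have q: "1 \<le> q" "q \<le> n" using RpD[OF R] by simp_all
  then obtain m where n: "n = Suc m" using k by (cases n) auto
  obtain k' where k': "k = Suc k'" using k by (cases k) auto
  show ?thesis using R k q unfolding n k'
    by (intro Rp_functor[of _ _ _ _ _ _ "cn (Suc m) (Suc k') \<alpha>" "cn m k' \<alpha>"])
      (auto simp: fc_cn_less cn_dg_greater cn_cp_greater)
qed

lemma Rp_dg_same:
  assumes "A \<in> cl n" "1 \<le> q" "q \<le> Suc n"
  shows "Rp (Suc n) q (dg n q A) (dg n q A)"
  using assms by (simp add: Rp_def cp_dg)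

lemma Rp_fc_eq:
  assumes T: "Rp n i A B" "Rp n i A' B'" and k: "1 \<le> k" "k \<le> n" "k \<noteq> i"
    and e: "fc n k \<alpha> A = fc n k \<beta> A'"
  shows "fc n k \<alpha> B = fc n k \<beta> B'"
proof -
  obtain m where n: "n = Suc m" using k by (cases n) auto
  show ?thesis
  proof (cases "k < i")
    case True
    then obtain i' where i: "i = Suc i'" "k \<le> i'" by (cases i) auto
    show ?thesis using Rp_fc_less[of m i' A B k \<alpha>] Rp_fc_less[of m i' A' B' k \<beta>] T k e Rp_unique
      unfolding n i(1) using i(2) by metis
  next
    case False
    then have "i < k" using k by simp
    then show ?thesis using Rp_fc_greater[of m i A B k \<alpha>] Rp_fc_greater[of m i A' B' k \<beta>] T k e Rp_unique
      unfolding n by metis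
  qed
qed

lemma Rp_cp:
  assumes T: "Rp n i A B" "Rp n i A' B'" and k: "1 \<le> k" "k \<le> n" "k \<noteq> i"
    and e: "fc n k Plus A = fc n k Minus A'"
  shows "Rp n i (cp n k A A') (cp n k B B')"
proof -
  have eB: "fc n k Plus B = fc n k Minus B'" using Rp_fc_eq[OF T k e] .
  have *: "cp n i (cp n k A A') (cp n k B B') = dg (n - 1) i (fc n i Minus (cp n k A A')) \<and>
    fc n i Plus (cp n k A A') = fc n i Minus (cp n k B B')"
    if T: "Rp n i A B" "Rp n i A' B'" and e: "fc n k Plus A = fc n k Minus A'"
      "fc n k Plus B = fc n k Minus B'" for A A' B B'
  proof -
    note D = RpD[OF T(1)] and D' = RpD[OF T(2)]
    obtain m where n: "n = Suc m" using k by (cases n) auto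
    have i: "1 \<le> i" "i \<le> Suc m" using D n by auto
    have a: "cp n i (cp n k A A') (cp n k B B') = cp n k (cp n i A B) (cp n i A' B')"
      using D D' k e by (intro cp_exch) auto
    show ?thesis
    proof (cases "k < i")
      case True
      then obtain l where m: "m = Suc l" using i k by (cases m) auto
      have "fc (Suc l) k Plus (fc (Suc (Suc l)) i Minus A) = fc (Suc l) k Minus (fc (Suc (Suc l)) i Minus A')"
        using fc_fc[of A l k "i - 1" Minus Plus] fc_fc[of A' l k "i - 1" Minus Minus] e D D' k True i unfolding n m
        by (cases i) auto
      then show ?thesis unfolding a using D D' True k i e unfolding n m
        by (simp add: fc_cp_greater dg_cp_greater)
    next
      case False
      then have ik: "i < k" using k by simp
      then obtain l where m: "m = Suc l" using i k n by (cases m) auto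
      have "fc (Suc l) (k - 1) Plus (fc (Suc (Suc l)) i Minus A) = fc (Suc l) (k - 1) Minus (fc (Suc (Suc l)) i Minus A')"
        using fc_fc[of A l i "k - 1" Plus Minus] fc_fc[of A' l i "k - 1" Minus Minus] e D D' k ik i unfolding n m
        by (cases k) auto
      then show ?thesis unfolding a using D D' ik k i e unfolding n m
        by (cases k) (simp_all add: fc_cp_less dg_cp_le)
    qed
  qed
  show ?thesis
    unfolding Rp_def
    using *[OF T e eB] *[OF Rp_sym[OF T(1)] Rp_sym[OF T(2)] eB e] RpD[OF T(1)] RpD[OF T(2)] k e eB
    by auto
qed

section \<open>Folds, faces and invertibility\<close>

lemma fc_Pf_less:
  assumes "X \<in> cl (Suc (Suc (Suc n)))" "1 \<le> m" "m \<le> i" "i \<le> Suc n"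
  shows "fc (Suc (Suc (Suc n))) m \<alpha> (Pf (Suc (Suc (Suc n))) (Suc i) X) =
    Pf (Suc (Suc n)) i (fc (Suc (Suc (Suc n))) m \<alpha> X)"
  using assms unfolding Pf_def
  by (simp add: fc_cp_less fc_cn_less fc_fc fc_cp_greater fc_cn_opposite)

lemma fc_Pf_greater:
  assumes "X \<in> cl (Suc (Suc (Suc n)))" "Suc i < m" "1 \<le> i" "m \<le> Suc (Suc (Suc n))"
  shows "fc (Suc (Suc (Suc n))) m \<alpha> (Pf (Suc (Suc (Suc n))) i X) =
    Pf (Suc (Suc n)) i (fc (Suc (Suc (Suc n))) m \<alpha> X)"
  using assms unfolding Pf_def
  by (cases m) (simp_all add: fc_cp_less fc_cn_greater fc_fc fc_cp_greater fc_cn_opposite)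

lemma fc_Qf_less:
  assumes "X \<in> cl (Suc (Suc (Suc n)))" "1 \<le> m" "m \<le> i" "i \<le> Suc n"
  shows "fc (Suc (Suc (Suc n))) m \<alpha> (Qf (Suc (Suc (Suc n))) (Suc i) X) =
    Qf (Suc (Suc n)) i (fc (Suc (Suc (Suc n))) m \<alpha> X)"
  using assms unfolding Qf_def
  by (simp add: fc_cp_less fc_cn_less fc_fc fc_cp_greater fc_cn_opposite)

lemma fc_Qf_greater:
  assumes "X \<in> cl (Suc (Suc (Suc n)))" "Suc i < m" "1 \<le> i" "m \<le> Suc (Suc (Suc n))"
  shows "fc (Suc (Suc (Suc n))) m \<alpha> (Qf (Suc (Suc (Suc n))) i X) =
    Qf (Suc (Suc n)) i (fc (Suc (Suc (Suc n))) m \<alpha> X)"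
  using assms unfolding Qf_def
  by (cases m) (simp_all add: fc_cp_less fc_cn_greater fc_fc fc_cp_greater fc_cn_opposite)

definition Rinv :: "nat \<Rightarrow> nat \<Rightarrow> 'a \<Rightarrow> bool" where
  "Rinv n i X \<longleftrightarrow> (\<exists>Y. Rp n i X Y)"

abbreviation "Tinv \<equiv> T_invertible C"

lemma Rinv_cl: "Rinv n i X \<Longrightarrow> X \<in> cl n"
  by (auto simp: Rinv_def Rp_def)

lemma Tinv_cl: "Tinv n i X \<Longrightarrow> X \<in> cl n"
  by (auto simp: T_invertible_def is_T_inverse_def)

lemma Rinv_fc_greater: "\<lbrakk>Rinv (Suc n) q X; q < k; k \<le> Suc n\<rbrakk> \<Longrightarrow> Rinv n q (fc (Suc n) k \<alpha> X)"
  unfolding Rinv_def using Rp_fc_greater by blast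
lemma Rinv_fc_less: "\<lbrakk>Rinv (Suc n) (Suc q) X; 1 \<le> k; k \<le> q\<rbrakk> \<Longrightarrow> Rinv n q (fc (Suc n) k \<alpha> X)"
  unfolding Rinv_def using Rp_fc_less by blast
lemma Rinv_dg_greater: "\<lbrakk>Rinv n q X; q < k; k \<le> Suc n\<rbrakk> \<Longrightarrow> Rinv (Suc n) q (dg n k X)"
  unfolding Rinv_def using Rp_dg_greater by blast
lemma Rinv_cn_greater: "\<lbrakk>Rinv n q X; q < k; k \<le> n\<rbrakk> \<Longrightarrow> Rinv (Suc n) q (cn n k \<alpha> X)"
  unfolding Rinv_def using Rp_cn_greater by blast
lemma Rinv_cn_less: "\<lbrakk>Rinv n q X; 1 \<le> k; k < q\<rbrakk> \<Longrightarrow> Rinv (Suc n) (Suc q) (cn n k \<alpha> X)"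
  unfolding Rinv_def using Rp_cn_less by blast
lemma Rinv_cp: "\<lbrakk>Rinv n q X; Rinv n q Y; 1 \<le> k; k \<le> n; k \<noteq> q; fc n k Plus X = fc n k Minus Y\<rbrakk> \<Longrightarrow>
    Rinv n q (cp n k X Y)"
  unfolding Rinv_def using Rp_cp by blast

lemma Tinv_fc_greater: "\<lbrakk>Tinv (Suc n) q X; Suc q < k; k \<le> Suc n\<rbrakk> \<Longrightarrow> Tinv n q (fc (Suc n) k \<alpha> X)"
  unfolding T_invertible_def using Tp_fc_greater by blast
lemma Tinv_fc_less: "\<lbrakk>Tinv (Suc n) (Suc q) X; 1 \<le> k; k \<le> q\<rbrakk> \<Longrightarrow> Tinv n q (fc (Suc n) k \<alpha> X)"
  unfolding T_invertible_def using Tp_fc_less by blast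
lemma Tinv_dg_greater: "\<lbrakk>Tinv n q X; Suc q < k; k \<le> Suc n\<rbrakk> \<Longrightarrow> Tinv (Suc n) q (dg n k X)"
  unfolding T_invertible_def using Tp_dg_greater by blast
lemma Tinv_cn_greater: "\<lbrakk>Tinv n q X; Suc q < k; k \<le> n\<rbrakk> \<Longrightarrow> Tinv (Suc n) q (cn n k \<alpha> X)"
  unfolding T_invertible_def using Tp_cn_greater by blast
lemma Tinv_cp: "\<lbrakk>Tinv n q X; Tinv n q Y; 1 \<le> k; k \<le> n; k \<noteq> q; k \<noteq> Suc q; fc n k Plus X = fc n k Minus Y\<rbrakk> \<Longrightarrow>
    Tinv n q (cp n k X Y)"
  unfolding T_invertible_def using Tp_cp by blast

text \<open>Folding along i uses only faces, connections and compositions in the directions i and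
  i+1; these preserve \<star>_q-invertibility because q < i.\<close>

lemma Rinv_Pf:
  assumes R: "Rinv (Suc (Suc n)) q X" and q: "1 \<le> q" "q < i" "i \<le> Suc n"
  shows "Rinv (Suc (Suc n)) q (Pf (Suc (Suc n)) i X)"
proof (rule Pf_closed)
  have f: "Rinv (Suc n) q (fc (Suc (Suc n)) (Suc i) \<alpha> X)" for \<alpha>
    using R q by (intro Rinv_fc_greater) auto
  show "Rinv (Suc (Suc n)) q (cn (Suc n) i Plus (fc (Suc (Suc n)) (Suc i) Minus X))"
    "Rinv (Suc (Suc n)) q (cn (Suc n) i Minus (fc (Suc (Suc n)) (Suc i) Plus X))"
    using q by (auto intro!: Rinv_cn_greater f)
qed (use R q Rinv_cl Rinv_cp in auto)

lemma Tinv_Pf: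
  assumes R: "Tinv (Suc (Suc n)) q X" and q: "1 \<le> q" "Suc q < i" "i \<le> Suc n"
  shows "Tinv (Suc (Suc n)) q (Pf (Suc (Suc n)) i X)"
proof (rule Pf_closed)
  have f: "Tinv (Suc n) q (fc (Suc (Suc n)) (Suc i) \<alpha> X)" for \<alpha>
    using R q by (intro Tinv_fc_greater) auto
  show "Tinv (Suc (Suc n)) q (cn (Suc n) i Plus (fc (Suc (Suc n)) (Suc i) Minus X))"
    "Tinv (Suc (Suc n)) q (cn (Suc n) i Minus (fc (Suc (Suc n)) (Suc i) Plus X))"
    using q by (auto intro!: Tinv_cn_greater f)
qed (use R q Tinv_cl Tinv_cp in auto)

lemma Rinv_Qf:
  assumes R: "Rinv (Suc (Suc n)) q X" and q: "1 \<le> i" "Suc i < q" "q \<le> Suc (Suc n)"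
  shows "Rinv (Suc (Suc n)) q (Qf (Suc (Suc n)) i X)"
proof (rule Qf_closed)
  obtain q' where q': "q = Suc q'" "i < q'" using q by (cases q) auto
  have f: "Rinv (Suc n) q' (fc (Suc (Suc n)) i \<alpha> X)" for \<alpha>
    using R q q' by (intro Rinv_fc_less) auto
  show "Rinv (Suc (Suc n)) q (cn (Suc n) i Plus (fc (Suc (Suc n)) i Minus X))"
    "Rinv (Suc (Suc n)) q (cn (Suc n) i Minus (fc (Suc (Suc n)) i Plus X))"
    using q q' by (auto intro!: Rinv_cn_less f)
qed (use R q Rinv_cl Rinv_cp in auto)

text \<open>Folding along the direction $k$ turns a $\star_{k+1}$-invertible cell into a $\star_k$-invertible one;
  this is repeated until the direction $q$ is reached.\<close>

lemma Rinv_from_faces: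
  assumes "Rinv n k X" "1 \<le> q" "q < k"
    and "\<And>m \<alpha>. \<lbrakk>1 \<le> m; m \<le> n; m \<noteq> q\<rbrakk> \<Longrightarrow> Rinv (n - 1) (down q m) (fc n m \<alpha> X)"
  shows "Rinv n q X"
  using assms
proof (induction k arbitrary: X)
  case 0
  then show ?case by simp
next
  case (Suc k)
  have X: "X \<in> cl n" and kn: "Suc k \<le> n" using Suc.prems(1) by (auto simp: Rinv_def Rp_def)
  obtain l where n: "n = Suc (Suc l)" using kn Suc.prems by (cases n; cases "n - 1") auto
  have k: "1 \<le> k" "k \<le> Suc l" using Suc.prems kn n by auto
  from Suc.prems(1) obtain Y where "Rp n (Suc k) X Y" by (auto simp: Rinv_def)
  \<comment> \<open>\<star>_{k+1}-invertibility gives T_k-invertibility by the transpose of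
    \<open>vpair_imp_Tp\<close>.\<close>
  then obtain B where B: "Tp n k X B" using Rp_Suc_imp_Tp[OF k] n by blast
  have F: "Rinv (Suc l) q (fc n m \<alpha> X)" if "q < m" "m \<le> n" for m \<alpha>
    using Suc.prems(4)[of m \<alpha>] that n by (simp add: down_def)
  show ?case
  proof (cases "k = q")
    case True
    \<comment> \<open>The hypothesis on the faces in direction q+1 supplies the inverses of the
      sides that \<open>Tp_imp_Rp\<close> asks for.\<close>
    obtain c' d' where "Rp (Suc l) k (fc n (Suc k) Minus X) c'" "Rp (Suc l) k (fc n (Suc k) Plus X) d'"
      using F[of "Suc k" Minus] F[of "Suc k" Plus] True kn unfolding Rinv_def by blast
    then show ?thesis using Tp_imp_Rp[OF k B[unfolded n]] True n unfolding Rinv_def by metis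
  next
    case False
    then have qk: "q < k" using Suc.prems by simp
    then obtain l' k' where l': "l = Suc l'" and k': "k = Suc k'" using k Suc.prems by (cases l; cases k) auto
    let ?X = "Pf n k X"
    have X': "X \<in> cl (Suc (Suc (Suc l')))" using X n l' by simp
    have fX [simp]: "fc n m \<alpha> X \<in> cl (Suc (Suc l'))" if "1 \<le> m" "m \<le> n" for m \<alpha>
      using X n l' that by simp
    \<comment> \<open>The fold is \<star>_k-invertible, so the induction hypothesis applies once its
      faces are known: in direction k they are composites of faces of \<open>X\<close>, in direction
      k+1 degenerate, and elsewhere folds of faces of \<open>X\<close>.\<close>
    have "Rinv n q ?X"
    proof (rule Suc.IH)
      show "Rinv n k ?X" using Tp_Rp_Pf[OF k B[unfolded n]] n by (auto simp: Rinv_def)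
      fix m \<alpha> assume m: "1 \<le> m" "m \<le> n" "m \<noteq> q"
      consider "m < k" | "m = k" | "m = Suc k" | "Suc k < m" by linarith
      then show "Rinv (n - 1) (down q m) (fc n m \<alpha> ?X)"
      proof cases
        case 1
        then have "fc n m \<alpha> ?X = Pf (Suc (Suc l')) k' (fc n m \<alpha> X)"
          using fc_Pf_less[OF X', of m k'] m k n l' k' by simp
        moreover have "Rinv (Suc (Suc l')) (down q m) (Pf (Suc (Suc l')) k' (fc n m \<alpha> X))"
          using Suc.prems(4)[OF m, of \<alpha>] m k k' l' n 1 qk Suc.prems(2)
          by (intro Rinv_Pf) (auto simp: down_def)
        ultimately show ?thesis using n l' by simp
      next
        case 2
        have c: "fc (Suc l) k Plus (fc n k Minus X) = fc (Suc l) k Minus (fc n (Suc k) Plus X)"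
          "fc (Suc l) k Plus (fc n (Suc k) Minus X) = fc (Suc l) k Minus (fc n k Plus X)"
          using fc_fc[of X l k k] X n k by simp_all
        have "Rinv (Suc l) q (cp (Suc l) k (fc n k Minus X) (fc n (Suc k) Plus X))"
          "Rinv (Suc l) q (cp (Suc l) k (fc n (Suc k) Minus X) (fc n k Plus X))"
          using c qk k kn by (auto intro!: Rinv_cp F)
        then show ?thesis using fc_Pf_same[OF k, of X] X n 2 qk by (cases \<alpha>) (simp_all add: down_def)
      next
        case 3
        have "Rinv l q (fc (Suc l) k \<beta> (fc n k \<gamma> X))" for \<beta> \<gamma>
          using qk k kn by (intro Rinv_fc_greater F) auto
        then have "Rinv (Suc l) q (dg l k (fc (Suc l) k \<beta> (fc n k \<gamma> X)))" for \<beta> \<gamma>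
          using qk k by (intro Rinv_dg_greater) auto
        then show ?thesis using fc_Pf_Suc[OF k, of X] X n 3 qk by (cases \<alpha>) (simp_all add: down_def)
      next
        case 4
        then have "fc n m \<alpha> ?X = Pf (Suc (Suc l')) k (fc n m \<alpha> X)"
          using fc_Pf_greater[OF X', of k m] m k n l' by simp
        moreover have "Rinv (Suc (Suc l')) q (Pf (Suc (Suc l')) k (fc n m \<alpha> X))"
          using F[of m \<alpha>] m k l' n 4 qk Suc.prems(2) by (intro Rinv_Pf) auto
        ultimately show ?thesis using n l' 4 qk by (simp add: down_def)
      qed
    qed (use qk Suc.prems in auto)
    then have P: "Rinv (Suc (Suc l)) q (Pf (Suc (Suc l)) k X)" using n by simp
    have "Rinv (Suc (Suc l)) q X"
    proof (rule unfold_Pf_closed[OF k])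
      have f: "Rinv (Suc l) q (fc (Suc (Suc l)) k \<alpha> X)" "Rinv (Suc l) q (fc (Suc (Suc l)) (Suc k) \<alpha> X)" for \<alpha>
        using F qk kn n by auto
      then show "Rinv (Suc (Suc l)) q (dg (Suc l) k (fc (Suc (Suc l)) k Minus X))"
        "Rinv (Suc (Suc l)) q (dg (Suc l) k (fc (Suc (Suc l)) k Plus X))"
        "Rinv (Suc (Suc l)) q (cn (Suc l) k Plus (fc (Suc (Suc l)) (Suc k) Plus X))"
        "Rinv (Suc (Suc l)) q (cn (Suc l) k Minus (fc (Suc (Suc l)) (Suc k) Minus X))"
        using qk k by (auto intro!: Rinv_dg_greater Rinv_cn_greater)
    qed (use P X n qk k Rinv_cp in auto)
    then show ?thesis using n by simp
  qed
qed

lemma Tp_Tinv: "Tp n i A B \<Longrightarrow> Tinv n i A" "Tp n i A B \<Longrightarrow> Tinv n i B"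
  unfolding T_invertible_def using Tp_sym by blast+

lemma Rinv_dg_same: "\<lbrakk>A \<in> cl n; 1 \<le> q; q \<le> Suc n\<rbrakk> \<Longrightarrow> Rinv (Suc n) q (dg n q A)"
  unfolding Rinv_def using Rp_dg_same by blast

lemma Tinv_Rinv_Qf: "\<lbrakk>1 \<le> i; i \<le> Suc n; Tinv (Suc (Suc n)) i X\<rbrakk> \<Longrightarrow> Rinv (Suc (Suc n)) (Suc i) (Qf (Suc (Suc n)) i X)"
  unfolding T_invertible_def Rinv_def using Tp_Rp_Qf by blast

text \<open>The fold of \<open>A\<close> along $i$ is $\star_i$-invertible. Folding it along $j$ as well gives a cell to which
  \<open>Rinv_from_faces\<close> applies; its faces are dealt with by induction on the dimension.\<close>

lemma Tinv_from_Tp_far: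
  assumes "Tp n i A B" "Tinv n j B" "1 \<le> j" "Suc (Suc j) \<le> i"
  shows "Tinv n j A"
  using assms
proof (induction n arbitrary: i j A B)
  case 0
  then show ?case using TpD(2) by fastforce
next
  case (Suc n)
  note T = Suc.prems(1) and Bj = Suc.prems(2) and ij = Suc.prems(3,4)
  have A: "A \<in> cl (Suc n)" and B: "B \<in> cl (Suc n)" and i: "i \<le> n" using TpD[OF T] by auto
  obtain l where n: "n = Suc (Suc l)" using i ij by (cases n; cases "n - 1") auto
  obtain i' where i': "i = Suc i'" using ij by (cases i) auto
  have iS: "1 \<le> i" "i \<le> Suc (Suc l)" "j \<le> Suc (Suc l)" using i ij n by auto
  \<comment> \<open>In the directions i and i+1 the faces of \<open>A\<close> are faces of
    \<open>B\<close>; elsewhere the induction hypothesis applies to the faces of \<open>A\<close>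
    and \<open>B\<close>.\<close>
  have FA: "Tinv n (down j m) (fc (Suc n) m \<alpha> A)"
    if m: "1 \<le> m" "m \<le> Suc n" "m \<noteq> j" "m \<noteq> Suc j" for m \<alpha>
  proof -
    consider "m < j" | "Suc j < m" "m < i" | "m = i" | "m = Suc i" | "Suc i < m" using m by linarith
    then show ?thesis
    proof cases
      case 1
      then obtain j' where j': "j = Suc j'" by (cases j) auto
      have "Tp n i' (fc (Suc n) m \<alpha> A) (fc (Suc n) m \<alpha> B)"
        using T 1 m ij unfolding i' by (intro Tp_fc_less) auto
      moreover have "Tinv n j' (fc (Suc n) m \<alpha> B)" using Bj 1 m unfolding j' by (intro Tinv_fc_less) auto
      ultimately show ?thesis using Suc.IH[of i' _ _ j'] 1 m ij i' j' by (simp add: down_def)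
    next
      case 2
      have "Tp n i' (fc (Suc n) m \<alpha> A) (fc (Suc n) m \<alpha> B)"
        using T 2 m ij unfolding i' by (intro Tp_fc_less) auto
      moreover have "Tinv n j (fc (Suc n) m \<alpha> B)" using Bj 2 m by (intro Tinv_fc_greater) auto
      ultimately show ?thesis using Suc.IH[of i' _ _ j] 2 m ij i' by (simp add: down_def)
    next
      case 3
      have "Tinv n j (fc (Suc n) (Suc i) \<alpha> B)" using Bj ij i by (intro Tinv_fc_greater) auto
      then show ?thesis using 3 TpD(5)[OF T, of \<alpha>] ij by (simp add: down_def)
    next
      case 4
      have "Tinv n j (fc (Suc n) i \<alpha> B)" using Bj ij i by (intro Tinv_fc_greater) auto
      then show ?thesis using 4 TpD(6)[OF T, of \<alpha>] ij by (simp add: down_def)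
    next
      case 5
      have "Tp n i (fc (Suc n) m \<alpha> A) (fc (Suc n) m \<alpha> B)"
        using T 5 m by (intro Tp_fc_greater) auto
      moreover have "Tinv n j (fc (Suc n) m \<alpha> B)" using Bj 5 m ij by (intro Tinv_fc_greater) auto
      ultimately show ?thesis using Suc.IH[of i _ _ j] 5 ij by (simp add: down_def)
    qed
  qed
  let ?N = "Suc (Suc (Suc l))"
  have A': "A \<in> cl ?N" using A n by simp
  let ?X0 = "Pf ?N i A"
  have X0: "?X0 \<in> cl ?N" using A' iS by (intro Pf_cl) auto
  have F0: "Tinv n (down j m) (fc (Suc n) m \<alpha> ?X0)"
    if m: "1 \<le> m" "m \<le> Suc n" "m \<noteq> j" "m \<noteq> Suc j" for m \<alpha>
  proof -
    consider "m < i" | "m = i" | "m = Suc i" | "Suc i < m" using m by linarith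
    then show ?thesis
    proof cases
      case 1
      then have "fc ?N m \<alpha> ?X0 = Pf (Suc (Suc l)) i' (fc ?N m \<alpha> A)"
        using fc_Pf_less[OF A', of m i'] m iS i' by simp
      moreover have "Tinv (Suc (Suc l)) (down j m) (Pf (Suc (Suc l)) i' (fc ?N m \<alpha> A))"
        using FA[OF m, of \<alpha>] m i' n 1 ij iS by (intro Tinv_Pf) (auto simp: down_def)
      ultimately show ?thesis using n by simp
    next
      case 2
      have c: "fc (Suc (Suc l)) i Plus (fc ?N i Minus A) = fc (Suc (Suc l)) i Minus (fc ?N (Suc i) Plus A)"
        "fc (Suc (Suc l)) i Plus (fc ?N (Suc i) Minus A) = fc (Suc (Suc l)) i Minus (fc ?N i Plus A)"
        using fc_fc[of A "Suc l" i i] A' n iS by simp_all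
      have "Tinv (Suc (Suc l)) j (fc ?N i \<beta> A)" "Tinv (Suc (Suc l)) j (fc ?N (Suc i) \<beta> A)" for \<beta>
        using FA[of i \<beta>] FA[of "Suc i" \<beta>] ij iS n by (simp_all add: down_def)
      then have "Tinv (Suc (Suc l)) j (cp (Suc (Suc l)) i (fc ?N i Minus A) (fc ?N (Suc i) Plus A))"
        "Tinv (Suc (Suc l)) j (cp (Suc (Suc l)) i (fc ?N (Suc i) Minus A) (fc ?N i Plus A))"
        using c ij iS by (auto intro!: Tinv_cp)
      then show ?thesis using fc_Pf_same[OF iS(1,2), of A] A' n 2 ij by (cases \<alpha>) (simp_all add: down_def)
    next
      case 3
      have h: "Tinv (Suc (Suc l)) j (fc ?N i \<gamma> A)" for \<gamma>
        using FA[of i \<gamma>] ij iS n by (simp add: down_def)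
      have "Tinv (Suc l) j (fc (Suc (Suc l)) i \<beta> (fc ?N i \<gamma> A))" for \<beta> \<gamma>
        by (rule Tinv_fc_greater[OF h]) (use ij iS in auto)
      then have "Tinv (Suc (Suc l)) j (dg (Suc l) i (fc (Suc (Suc l)) i \<beta> (fc ?N i \<gamma> A)))" for \<beta> \<gamma>
        using ij iS by (intro Tinv_dg_greater) auto
      then show ?thesis using fc_Pf_Suc[OF iS(1,2), of A] A' n 3 ij by (cases \<alpha>) (simp_all add: down_def)
    next
      case 4
      then have "fc ?N m \<alpha> ?X0 = Pf (Suc (Suc l)) i (fc ?N m \<alpha> A)"
        using fc_Pf_greater[OF A', of i m] m iS n by simp
      moreover have "Tinv (Suc (Suc l)) j (Pf (Suc (Suc l)) i (fc ?N m \<alpha> A))"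
        using FA[OF m, of \<alpha>] m n 4 ij iS by (intro Tinv_Pf) (auto simp: down_def)
      ultimately show ?thesis using n 4 ij by (simp add: down_def)
    qed
  qed
  let ?X1 = "Qf ?N j ?X0"
  \<comment> \<open>T_j-invertibility of \<open>?X0\<close> follows from \<star>_{j+1}-invertibility
    of its fold along j, by \<open>Rp_Qf_Tp\<close>. That fold is still \<star>_i-invertible, and
    j+1 < i leaves room for the descent.\<close>
  have "Rinv ?N (Suc j) ?X1"
  proof (rule Rinv_from_faces)
    have "Rinv ?N i ?X0" using Tp_Rp_Pf[OF iS(1,2)] T n by (auto simp: Rinv_def)
    then show "Rinv ?N i ?X1" using ij iS by (intro Rinv_Qf) auto
    fix m \<alpha> assume m: "1 \<le> m" "m \<le> ?N" "m \<noteq> Suc j"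
    consider "m < j" | "m = j" | "Suc j < m" using m by linarith
    then show "Rinv (?N - 1) (down (Suc j) m) (fc ?N m \<alpha> ?X1)"
    proof cases
      case 1
      then obtain j' where j': "j = Suc j'" by (cases j) auto
      have "fc ?N m \<alpha> ?X1 = Qf (Suc (Suc l)) j' (fc ?N m \<alpha> ?X0)"
        using fc_Qf_less[OF X0, of m j'] m 1 iS unfolding j' by simp
      moreover have "Rinv (Suc (Suc l)) (Suc j') (Qf (Suc (Suc l)) j' (fc ?N m \<alpha> ?X0))"
        using F0[of m \<alpha>] m 1 iS j' n by (intro Tinv_Rinv_Qf) (auto simp: down_def)
      ultimately show ?thesis using 1 j' by (simp add: down_def)
    next
      case 2
      have "fc ?N j \<gamma> ?X0 \<in> cl (Suc (Suc l))" for \<gamma> using X0 ij iS by simp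
      then have "Rinv (Suc (Suc l)) j (dg (Suc l) j (fc (Suc (Suc l)) j \<beta> (fc ?N j \<gamma> ?X0)))" for \<beta> \<gamma>
        using ij iS by (intro Rinv_dg_same) auto
      then show ?thesis using fc_Qf_same[of j "Suc l" ?X0] X0 2 ij iS by (cases \<alpha>) (simp_all add: down_def)
    next
      case 3
      then have "fc ?N m \<alpha> ?X1 = Qf (Suc (Suc l)) j (fc ?N m \<alpha> ?X0)"
        using fc_Qf_greater[OF X0, of j m] m ij by simp
      moreover have "Rinv (Suc (Suc l)) (Suc j) (Qf (Suc (Suc l)) j (fc ?N m \<alpha> ?X0))"
        using F0[of m \<alpha>] m 3 ij iS n by (intro Tinv_Rinv_Qf) (auto simp: down_def)
      ultimately show ?thesis using 3 by (simp add: down_def)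
    qed
  qed (use ij in auto)
  then obtain Y where "Rp ?N (Suc j) ?X1 Y" by (auto simp: Rinv_def)
  then have P: "Tinv ?N j ?X0"
    using Rp_Qf_Tp[OF ij(1) iS(3) X0] Tp_Tinv(1) by metis
  have "Tinv ?N j A"
  proof (rule unfold_Pf_closed[OF iS(1,2)])
    have f: "Tinv (Suc (Suc l)) j (fc ?N i \<gamma> A)" "Tinv (Suc (Suc l)) j (fc ?N (Suc i) \<gamma> A)" for \<gamma>
      using FA[of i \<gamma>] FA[of "Suc i" \<gamma>] ij iS n by (simp_all add: down_def)
    then show "Tinv ?N j (dg (Suc (Suc l)) i (fc ?N i Minus A))" "Tinv ?N j (dg (Suc (Suc l)) i (fc ?N i Plus A))"
      "Tinv ?N j (cn (Suc (Suc l)) i Plus (fc ?N (Suc i) Plus A))"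
      "Tinv ?N j (cn (Suc (Suc l)) i Minus (fc ?N (Suc i) Minus A))"
      using ij iS by (auto intro!: Tinv_dg_greater Tinv_cn_greater)
  qed (use P A' ij iS Tinv_cp in auto)
  then show ?case using n by simp
qed

text \<open>T_j passes through every operation in the T_i-equation for \<open>X\<close> and
  \<open>X1\<close>. Its two sides have the same T_j-inverse by uniqueness, which is the
  T_i-equation for \<open>X'\<close> and \<open>X1'\<close>.\<close>

lemma Tp_far_square:
  assumes T: "Tp n i X X1" and j: "Tp n j X X'" "Tp n j X1 X1'" and ij: "Suc (Suc j) \<le> i"
  shows "Tp n i X' X1'"
proof -
  have *: "T_equation C n i X' X1' \<and> (\<forall>\<alpha>. fc n i \<alpha> X' = fc n (Suc i) \<alpha> X1')"
    if T: "Tp n i X X1" and j: "Tp n j X X'" "Tp n j X1 X1'" for X X1 X' X1'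
  proof -
    obtain m where n: "n = Suc (Suc m)" and i: "Suc 0 \<le> i" "i \<le> Suc m" using T by (rule Tp_dim)
    note [simp] = TpD(3,4)[OF T, unfolded n] i le_SucI[OF i(2)]
    have [simp]: "fc (Suc (Suc m)) i \<alpha> X1 = fc (Suc (Suc m)) (Suc i) \<alpha> X"
      "fc (Suc (Suc m)) (Suc i) \<alpha> X1 = fc (Suc (Suc m)) i \<alpha> X" for \<alpha>
      using TpD(5,6)[OF T] n by auto
    have f: "Tp (Suc m) j (fc n k \<alpha> X) (fc n k \<alpha> X')" "Tp (Suc m) j (fc n k \<alpha> X1) (fc n k \<alpha> X1')"
      if "k = i \<or> k = Suc i" for k \<alpha>
      using j that ij i unfolding n by (auto intro!: Tp_fc_greater)
    have g: "Tp n j (cn (Suc m) i \<beta> (fc n k \<alpha> X)) (cn (Suc m) i \<beta> (fc n k \<alpha> X'))"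
      if "k = i \<or> k = Suc i" for k \<alpha> \<beta>
      using f(1)[OF that, of \<alpha>] ij i unfolding n by (intro Tp_cn_greater) auto
    have L: "Tp n j (cp n (Suc i) (cp n i (cn (Suc m) i Plus (fc n (Suc i) Minus X)) X1)
          (cp n i X (cn (Suc m) i Minus (fc n i Plus X))))
        (cp n (Suc i) (cp n i (cn (Suc m) i Plus (fc n (Suc i) Minus X')) X1')
          (cp n i X' (cn (Suc m) i Minus (fc n i Plus X'))))"
      using ij i by (intro Tp_cp g j) (simp_all add: n fc_cp_greater)
    have R: "Tp n j (cp n i (cn (Suc m) i Minus (fc n i Minus X)) (cn (Suc m) i Plus (fc n (Suc i) Plus X)))
        (cp n i (cn (Suc m) i Minus (fc n i Minus X')) (cn (Suc m) i Plus (fc n (Suc i) Plus X')))"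
      using ij i by (intro Tp_cp g j) (simp_all add: n fc_cn_opposite fc_fc)
    have "T_equation C n i X' X1'"
      unfolding T_equation_def using Tp_unique[OF L] R Tp_equation[OF T] n by simp
    moreover have "fc n i \<alpha> X' = fc n (Suc i) \<alpha> X1'" for \<alpha>
      using f(1)[of i \<alpha>] f(2)[of "Suc i" \<alpha>] Tp_unique n by (metis TpD(5)[OF T])
    ultimately show ?thesis by simp
  qed
  show ?thesis
    unfolding is_T_inverse_def
    using *[OF T j] *[OF Tp_sym[OF T] j(2,1)] TpD[OF T] TpD[OF j(1)] TpD[OF j(2)] by auto
qed

lemma Tp_far:
  assumes T: "Tp n i X X1" "Tp n j X1 X1'" and ij: "1 \<le> j" "Suc (Suc j) \<le> i"
  obtains X' where "Tp n j X X'" "Tp n i X' X1'"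
proof -
  have "Tinv n j X" using Tinv_from_Tp_far[OF T(1) _ ij] Tp_Tinv(1)[OF T(2)] by blast
  then obtain X' where "Tp n j X X'" by (auto simp: T_invertible_def)
  with Tp_far_square[OF T(1) this T(2) ij(2)] show thesis using that by blast
qed

section \<open>Connections and T_i-inverses in overlapping directions\<close>

text \<open>\<open>conn_compat n i A B\<close>: the $T_i$- and $T_{i+1}$-inverses move the connection in the
  direction $i+1$ of \<open>A\<close> past the direction $i$.\<close>

definition conn_compat :: "nat \<Rightarrow> nat \<Rightarrow> 'a \<Rightarrow> 'a \<Rightarrow> bool" where
  "conn_compat n i A B \<longleftrightarrow> Tp n i A B \<and>
     (\<exists>M. Tp (Suc n) i (cn n (Suc i) Minus A) M \<and> Tp (Suc n) (Suc i) M (cn n i Minus B))"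

context
  fixes m i :: nat
  assumes i: "1 \<le> i" "i \<le> Suc m"
begin

lemma conn_compat_dg_Suc:
  assumes e: "e \<in> cl (Suc m)"
  shows "conn_compat (Suc (Suc m)) i (dg (Suc m) (Suc i) e) (dg (Suc m) i e)"
  unfolding conn_compat_def
proof (intro conjI exI)
  show "Tp (Suc (Suc m)) i (dg (Suc m) (Suc i) e) (dg (Suc m) i e)"
    by (rule Tp_sym[OF Tp_dg[OF i e]])
  let ?M = "dg (Suc (Suc m)) i (dg (Suc m) (Suc i) e)"
  show "Tp (Suc (Suc (Suc m))) i (cn (Suc (Suc m)) (Suc i) Minus (dg (Suc m) (Suc i) e)) ?M"
    using Tp_sym[OF Tp_dg[of i "Suc m" "dg (Suc m) (Suc i) e"]] e i by (simp add: cn_dg_same)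
  show "Tp (Suc (Suc (Suc m))) (Suc i) ?M (cn (Suc (Suc m)) i Minus (dg (Suc m) i e))"
    using Tp_sym[OF Tp_dg[of "Suc i" "Suc m" "dg (Suc m) i e"]] e i by (simp add: cn_dg_same dg_dg)
qed

text \<open>The double connection is, as a function on cubes, e(x_1 \<or> x_2 \<or> x_3); by
  \<open>cn_cn_same\<close> it is its own inverse for both T_i and T_{i+1}.\<close>

lemma conn_compat_cn_Minus:
  assumes e: "e \<in> cl (Suc m)"
  shows "conn_compat (Suc (Suc m)) i (cn (Suc m) i Minus e) (cn (Suc m) i Minus e)"
  unfolding conn_compat_def
proof (intro conjI exI)
  let ?E = "cn (Suc m) i Minus e" and ?N = "Suc (Suc (Suc m))"
  show "Tp (Suc (Suc m)) i ?E ?E"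
    by (rule Tp_cn_Minus[OF i e])
  show "Tp ?N i (cn (Suc (Suc m)) (Suc i) Minus ?E) (cn (Suc (Suc m)) (Suc i) Minus ?E)"
    using Tp_cn_Minus[of i "Suc m" ?E] e i by (simp add: cn_cn_same)
  show "Tp ?N (Suc i) (cn (Suc (Suc m)) (Suc i) Minus ?E) (cn (Suc (Suc m)) i Minus ?E)"
    using Tp_cn_Minus[of "Suc i" "Suc m" ?E] e i by (simp add: cn_cn_same)
qed

text \<open>The double connection with opposite signs is, as a function on cubes, $e(x_2 \wedge (x_1 \vee x_3))$
  for the intermediate cell; it has two decompositions in the direction $i+1$, one adapted to $T_i$
  and one to $T_{i+1}$.\<close>

lemma conn_compat_cn_Plus:
  assumes e: "e \<in> cl (Suc m)"
  shows "conn_compat (Suc (Suc m)) i (cn (Suc m) i Plus e) (cn (Suc m) i Plus e)"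
proof -
  define E F where "E = cn (Suc m) i Minus e" and "F = cn (Suc m) i Plus e"
  let ?n = "Suc (Suc m)" and ?N = "Suc (Suc (Suc m))"
  note [simp] = e i le_SucI[OF i(2)] le_SucI[OF le_SucI[OF i(2)]]
  have [simp]: "Suc 0 \<le> i" using i by simp
  have [simp]: "E \<in> cl ?n" "F \<in> cl ?n" by (simp_all add: E_def F_def)
  have fE [simp]: "fc ?n i Minus E = e" "fc ?n (Suc i) Minus E = e"
    "fc ?n i Plus E = dg m i (fc (Suc m) i Plus e)" "fc ?n (Suc i) Plus E = dg m i (fc (Suc m) i Plus e)"
    by (simp_all add: E_def fc_cn_opposite)
  have fF [simp]: "fc ?n i Plus F = e" "fc ?n (Suc i) Plus F = e"
    "fc ?n i Minus F = dg m i (fc (Suc m) i Minus e)" "fc ?n (Suc i) Minus F = dg m i (fc (Suc m) i Minus e)"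
    by (simp_all add: F_def fc_cn_opposite)
  have EE: "cn ?n (Suc i) Minus E = cn ?n i Minus E" by (simp add: E_def cn_cn_same)
  have FE: "cp ?n i F E = dg (Suc m) (Suc i) e" "cp ?n (Suc i) F E = dg (Suc m) i e"
    by (simp_all add: E_def F_def cn_transport)
  let ?M = "cp ?N (Suc i) (dg ?n i F) (cn ?n i Plus E)"
  let ?M' = "cp ?N (Suc i) (dg ?n (Suc (Suc i)) F) (cn ?n (Suc i) Plus E)"
  let ?L = "cp ?N i (dg ?n (Suc i) F) (cn ?n i Plus E)"
  let ?L' = "cp ?N (Suc (Suc i)) (dg ?n (Suc i) F) (cn ?n (Suc i) Plus E)"
  have TM: "Tp ?N i ?M ?L"
    using i by (intro Tp_hc Tp_dg Tp_cn_Plus) (simp_all add: fc_dg_greater fc_cn_opposite)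
  have TM': "Tp ?N (Suc i) ?M' ?L'"
    using i by (intro Tp_vc Tp_sym[OF Tp_dg] Tp_cn_Plus) (simp_all add: fc_dg_less fc_cn_opposite)
  \<comment> \<open>Absorbing \<Gamma>_i^- E leaves a degeneracy of F \<star>_i E on the left and a
    connection of it on the right. They agree because F \<star>_i E is itself degenerate in
    direction i+1. The next two equations are treated in the same manner.\<close>
  have L: "?L = cn ?n (Suc i) Minus F"
  proof (rule cn_cancel[of i "Suc m"])
    have "cp ?N i ?L (cn ?n i Minus E) = cp ?N i (dg ?n (Suc i) F) (cp ?N i (cn ?n i Plus E) (cn ?n i Minus E))"
      by (rule cp_assoc) (simp_all add: fc_dg_greater fc_dg_less fc_cn_opposite)
    also have "\<dots> = dg ?n (Suc i) (cp ?n i F E)" by (simp add: cn_transport dg_cp_greater)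
    also have "\<dots> = cn ?n (Suc i) Minus (cp ?n i F E)" by (simp add: FE cn_dg_same)
    also have "\<dots> = cp ?N i (cn ?n (Suc i) Minus F) (cn ?n i Minus E)"
      by (simp add: cn_cp_greater EE)
    finally show "cp ?N i ?L (cn ?n i Minus (fc ?N i Plus ?L)) =
      cp ?N i (cn ?n (Suc i) Minus F) (cn ?n i Minus (fc ?N i Plus (cn ?n (Suc i) Minus F)))"
      by (simp add: fc_dg_less fc_cn_opposite fc_cn_less flip: E_def)
    show "fc ?N (Suc i) Minus ?L = fc ?N (Suc i) Minus (cn ?n (Suc i) Minus F)"
      by (simp add: fc_dg_less fc_dg_greater fc_cn_opposite fc_cp_greater cp_dg)
  qed (simp_all add: fc_dg_less fc_cn_opposite fc_cn_less flip: E_def)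
  have L': "?L' = cn ?n i Minus F"
  proof (rule cn_cancel_Suc[of "Suc i" "Suc m"])
    have "cp ?N (Suc (Suc i)) ?L' (cn ?n (Suc i) Minus E) =
        cp ?N (Suc (Suc i)) (dg ?n (Suc i) F) (cp ?N (Suc (Suc i)) (cn ?n (Suc i) Plus E) (cn ?n (Suc i) Minus E))"
      by (rule cp_assoc) (simp_all add: fc_dg_greater fc_dg_less fc_cn_opposite)
    also have "\<dots> = dg ?n (Suc i) (cp ?n (Suc i) F E)" by (simp add: cn_transport dg_cp_le)
    also have "\<dots> = cn ?n i Minus (cp ?n (Suc i) F E)" by (simp add: FE cn_dg_same dg_dg)
    also have "\<dots> = cp ?N (Suc (Suc i)) (cn ?n i Minus F) (cn ?n (Suc i) Minus E)"
      by (simp add: cn_cp_less EE)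
    finally show "cp ?N (Suc (Suc i)) ?L' (cn ?n (Suc i) Minus (fc ?N (Suc (Suc i)) Plus ?L')) =
      cp ?N (Suc (Suc i)) (cn ?n i Minus F) (cn ?n (Suc i) Minus (fc ?N (Suc (Suc i)) Plus (cn ?n i Minus F)))"
      by (simp add: fc_dg_greater fc_cn_opposite fc_cn_greater flip: E_def)
    show "fc ?N (Suc i) Minus ?L' = fc ?N (Suc i) Minus (cn ?n i Minus F)"
      by (simp add: fc_dg_less fc_dg_greater fc_cn_opposite fc_cp_less cp_dg)
  qed (simp_all add: fc_dg_greater fc_cn_opposite fc_cn_greater flip: E_def)
  have M: "?M = ?M'"
  proof (rule cn_cancel_Suc[of i "Suc m"])
    have "cp ?N (Suc i) ?M (cn ?n i Minus E) =
        cp ?N (Suc i) (dg ?n i F) (cp ?N (Suc i) (cn ?n i Plus E) (cn ?n i Minus E))"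
      by (rule cp_assoc) (simp_all add: fc_dg_greater fc_dg_less fc_cn_opposite)
    also have "\<dots> = dg ?n i (cp ?n i F E)" by (simp add: cn_transport dg_cp_le)
    also have "\<dots> = dg ?n (Suc (Suc i)) (cp ?n (Suc i) F E)" by (simp add: FE dg_dg)
    also have "\<dots> = cp ?N (Suc i) (dg ?n (Suc (Suc i)) F) (cp ?N (Suc i) (cn ?n (Suc i) Plus E) (cn ?n (Suc i) Minus E))"
      by (simp add: cn_transport dg_cp_greater)
    also have "\<dots> = cp ?N (Suc i) ?M' (cn ?n (Suc i) Minus E)"
      by (rule cp_assoc[symmetric]) (simp_all add: fc_dg_greater fc_dg_less fc_cn_opposite)
    finally show "cp ?N (Suc i) ?M (cn ?n i Minus (fc ?N (Suc i) Plus ?M)) =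
      cp ?N (Suc i) ?M' (cn ?n i Minus (fc ?N (Suc i) Plus ?M'))"
      by (simp add: fc_dg_greater fc_dg_less fc_cn_opposite fc_cn_greater EE)
    show "fc ?N i Minus ?M = fc ?N i Minus ?M'"
      by (simp add: fc_dg_less fc_dg_greater fc_cn_opposite fc_cp_less fc_cn_less cp_dg
          dg_dg[of _ m i i, symmetric] flip: F_def)
  qed (simp_all add: fc_dg_greater fc_dg_less fc_cn_opposite fc_cn_greater)
  show ?thesis unfolding conn_compat_def
    using TM TM' L L' M Tp_cn_Plus[OF i e] Tp_sym[of ?N i ?M ?L] unfolding F_def by auto
qed

text \<open>As functions on cubes: for fixed x_2 and x_3, the edge x_1 \<or> (x_2 \<and> x_3) runs
  from x_2 \<and> x_3 to 1 and is cut at x_3 into (x_1 \<or> x_2) \<and> x_3 followed by x_1 \<or>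
  x_3.\<close>

lemma cn_Plus_cn_Minus:
  assumes e: "e \<in> cl (Suc m)"
  shows "cp (Suc (Suc (Suc m))) i (cn (Suc (Suc m)) i Minus (cn (Suc m) i Plus e))
      (dg (Suc (Suc m)) (Suc i) (cn (Suc m) i Minus e)) =
    cn (Suc (Suc m)) (Suc i) Plus (cn (Suc m) i Minus e)"
proof -
  define E F where "E = cn (Suc m) i Minus e" and "F = cn (Suc m) i Plus e"
  let ?n = "Suc (Suc m)" and ?N = "Suc (Suc (Suc m))"
  note [simp] = e i le_SucI[OF i(2)] le_SucI[OF le_SucI[OF i(2)]]
  have [simp]: "Suc 0 \<le> i" using i by simp
  have [simp]: "E \<in> cl ?n" "F \<in> cl ?n" by (simp_all add: E_def F_def)
  have fE [simp]: "fc ?n i Minus E = e" "fc ?n (Suc i) Minus E = e"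
    "fc ?n i Plus E = dg m i (fc (Suc m) i Plus e)" "fc ?n (Suc i) Plus E = dg m i (fc (Suc m) i Plus e)"
    by (simp_all add: E_def fc_cn_opposite)
  have fF [simp]: "fc ?n i Plus F = e" "fc ?n (Suc i) Plus F = e"
    "fc ?n i Minus F = dg m i (fc (Suc m) i Minus e)" "fc ?n (Suc i) Minus F = dg m i (fc (Suc m) i Minus e)"
    by (simp_all add: F_def fc_cn_opposite)
  have EE: "cn ?n (Suc i) Minus E = cn ?n i Minus E" by (simp add: E_def cn_cn_same)
  have FE: "cp ?n i F E = dg (Suc m) (Suc i) e" by (simp add: E_def F_def cn_transport)
  let ?K = "cp ?N i (cn ?n i Minus F) (dg ?n (Suc i) E)"
  have "?K = cn ?n (Suc i) Plus E"
  proof (rule cn_cancel[of "Suc i" "Suc m"])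
    have "cp ?N (Suc i) ?K (cn ?n i Minus E) = cn ?n i Minus (cp ?n i F E)"
      by (rule cn_dg_cn[OF i(1)]) simp_all
    also have "\<dots> = cp ?N (Suc i) (cn ?n (Suc i) Plus E) (cn ?n (Suc i) Minus E)"
      by (simp add: FE cn_transport cn_dg_less flip: E_def)
    finally show "cp ?N (Suc i) ?K (cn ?n (Suc i) Minus (fc ?N (Suc i) Plus ?K)) =
      cp ?N (Suc i) (cn ?n (Suc i) Plus E) (cn ?n (Suc i) Minus (fc ?N (Suc i) Plus (cn ?n (Suc i) Plus E)))"
      by (simp add: fc_dg_less fc_cn_opposite fc_cp_greater fc_dg_greater cp_dg EE)
    show "fc ?N (Suc (Suc i)) Minus ?K = fc ?N (Suc (Suc i)) Minus (cn ?n (Suc i) Plus E)"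
      by (simp add: fc_dg_less fc_dg_greater fc_cn_opposite fc_cp_greater fc_cn_greater cn_dg_same cp_dg)
  qed (simp_all add: fc_dg_greater fc_dg_less fc_cn_opposite fc_cn_greater fc_cp_greater cp_dg)
  then show ?thesis by (simp only: E_def F_def)
qed

text \<open>\<Gamma>_{i+1}^- distributes over \<star>_i without extra terms, so the two intermediate
  cells simply compose.\<close>

lemma conn_compat_cp:
  assumes A: "conn_compat (Suc (Suc m)) i A B" "conn_compat (Suc (Suc m)) i A' B'"
    and e: "fc (Suc (Suc m)) i Plus A = fc (Suc (Suc m)) i Minus A'"
  shows "conn_compat (Suc (Suc m)) i (cp (Suc (Suc m)) i A A') (cp (Suc (Suc m)) (Suc i) B B')"
proof -
  let ?n = "Suc (Suc m)" and ?N = "Suc (Suc (Suc m))"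
  from A obtain M M' where T: "Tp ?n i A B" "Tp ?n i A' B'"
    and M: "Tp ?N i (cn ?n (Suc i) Minus A) M" "Tp ?N (Suc i) M (cn ?n i Minus B)"
    and M': "Tp ?N i (cn ?n (Suc i) Minus A') M'" "Tp ?N (Suc i) M' (cn ?n i Minus B')"
    by (auto simp: conn_compat_def)
  note cells = TpD(3,4)[OF T(1)] TpD(3,4)[OF T(2)]
  have eB: "fc ?n (Suc i) Plus B = fc ?n (Suc i) Minus B'"
    using e TpD(5)[OF T(1)] TpD(5)[OF T(2)] by metis
  have c: "fc ?N i Plus (cn ?n (Suc i) Minus A) = fc ?N i Minus (cn ?n (Suc i) Minus A')"
    using cells e i by (simp add: fc_cn_less)
  have cM: "fc ?N (Suc i) Plus M = fc ?N (Suc i) Minus M'"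
    using c TpD(5)[OF M(1)] TpD(5)[OF M'(1)] by metis
  have 1: "Tp ?N i (cn ?n (Suc i) Minus (cp ?n i A A')) (cp ?N (Suc i) M M')"
    using Tp_vc[OF i(1) _ M(1) M'(1) c] cells e i by (simp add: cn_cp_greater)
  have 2: "Tp ?N (Suc i) (cp ?N (Suc i) M M') (cn ?n i Minus (cp ?n (Suc i) B B'))"
    using Tp_vc[OF _ _ M(2) M'(2) cM] cells eB i by (simp add: cn_cp_less)
  show ?thesis unfolding conn_compat_def using Tp_vc[OF i T e] 1 2 by blast
qed

text \<open>Here \<Gamma>_{i+1}^- of the composite is a two-by-two block of two connections and two
  degeneracies. T_i and T_{i+1} are applied to the four entries, and the outcome is the block for
  \<Gamma>_i^- of the composite of \<open>B\<close> and \<open>B'\<close>.\<close>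

lemma conn_compat_cp_Suc:
  assumes A: "conn_compat (Suc (Suc m)) i A B" "conn_compat (Suc (Suc m)) i A' B'"
    and e: "fc (Suc (Suc m)) (Suc i) Plus A = fc (Suc (Suc m)) (Suc i) Minus A'"
  shows "conn_compat (Suc (Suc m)) i (cp (Suc (Suc m)) (Suc i) A A') (cp (Suc (Suc m)) i B B')"
proof -
  let ?n = "Suc (Suc m)" and ?N = "Suc (Suc (Suc m))"
  from A obtain M M' where T: "Tp ?n i A B" "Tp ?n i A' B'"
    and M: "Tp ?N i (cn ?n (Suc i) Minus A) M" "Tp ?N (Suc i) M (cn ?n i Minus B)"
    and M': "Tp ?N i (cn ?n (Suc i) Minus A') M'" "Tp ?N (Suc i) M' (cn ?n i Minus B')"
    by (auto simp: conn_compat_def)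
  note cells = TpD(3,4)[OF T(1)] TpD(3,4)[OF T(2)]
  note Mcells = TpD(4)[OF M(1)] TpD(4)[OF M'(1)]
  have eB: "fc ?n i Plus B = fc ?n i Minus B'"
    using e TpD(6)[OF T(1)] TpD(6)[OF T(2)] by metis
  let ?X = "cp ?N (Suc i) (cn ?n (Suc i) Minus A) (dg ?n (Suc (Suc i)) A')"
  let ?X' = "cp ?N (Suc i) (dg ?n (Suc i) A') (cn ?n (Suc i) Minus A')"
  let ?Y = "cp ?N i M (dg ?n (Suc (Suc i)) B')"
  let ?Y' = "cp ?N i (dg ?n i A') M'"
  have X: "Tp ?N i ?X ?Y"
    using i cells e
    by (intro Tp_hc M(1) Tp_dg_greater T) (auto simp: fc_cn_opposite fc_dg_less)
  have X': "Tp ?N i ?X' ?Y'"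
    using i cells by (intro Tp_hc M'(1) Tp_sym[OF Tp_dg]) auto
  have c: "fc ?N (Suc (Suc i)) Plus ?X = fc ?N (Suc (Suc i)) Minus ?X'"
    using i cells e by (simp add: fc_cn_opposite fc_dg_less fc_cp_greater fc_dg_greater cp_dg)
  have cn: "cn ?n (Suc i) Minus (cp ?n (Suc i) A A') = cp ?N (Suc (Suc i)) ?X ?X'"
    using cn_cp_Minus[of A ?n A' "Suc i"] cells e i by simp
  have 1: "Tp ?N i (cn ?n (Suc i) Minus (cp ?n (Suc i) A A')) (cp ?N (Suc (Suc i)) ?Y ?Y')"
    unfolding cn using i by (intro Tp_cp X X' c) auto
  have cY: "fc ?N (Suc (Suc i)) Plus ?Y = fc ?N (Suc (Suc i)) Minus ?Y'"
    using Tp_fc_eq[OF X X' _ _ _ _ c] i by simp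
  have cB: "cn ?n i Minus (cp ?n i B B') =
    cp ?N (Suc i) (cp ?N i (cn ?n i Minus B) (dg ?n (Suc i) B')) (cp ?N i (dg ?n i B') (cn ?n i Minus B'))"
    using cn_cp_Minus[of B ?n B' i] cells eB i by simp
  have f: "fc ?N i Plus M = fc ?N i Minus (dg ?n (Suc (Suc i)) B')"
    "fc ?N i Plus (dg ?n i A') = fc ?N i Minus M'"
    using TpD(6)[OF M(1), of Plus] TpD(6)[OF M'(1), of Minus] i cells e TpD(6)[OF T(1)] TpD(6)[OF T(2)]
    by (simp_all add: fc_cn_opposite fc_dg_less)
  have Y: "Tp ?N (Suc i) ?Y (cp ?N i (cn ?n i Minus B) (dg ?n (Suc i) B'))"
    using i cells by (intro Tp_cp M(2) Tp_sym[OF Tp_dg] f) auto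
  have Y': "Tp ?N (Suc i) ?Y' (cp ?N i (dg ?n i B') (cn ?n i Minus B'))"
    using i by (intro Tp_cp M'(2) Tp_dg_le T f) auto
  have 2: "Tp ?N (Suc i) (cp ?N (Suc (Suc i)) ?Y ?Y') (cn ?n i Minus (cp ?n i B B'))"
    unfolding cB using i by (intro Tp_hc Y Y' cY) auto
  show ?thesis unfolding conn_compat_def using Tp_hc[OF i T e] 1 2 by blast
qed

end

text \<open>The rows are padded to D1, X1, X2 and Y1, Y2, D2, which shifts one against the other;
  interchange then composes by columns. The hypotheses on degeneracies make each padding cell an
  identity for both compositions.\<close>

lemma cp_staggered:
  assumes X: "X1 \<in> cl (Suc n)" "X2 \<in> cl (Suc n)" "Y1 \<in> cl (Suc n)" "Y2 \<in> cl (Suc n)"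
    and ik: "1 \<le> i" "i \<le> Suc n" "1 \<le> k" "k \<le> Suc n" "i \<noteq> k"
    and e: "fc (Suc n) k Plus X1 = fc (Suc n) k Minus X2" "fc (Suc n) k Plus Y1 = fc (Suc n) k Minus Y2"
      "fc (Suc n) i Plus X1 = fc (Suc n) i Minus Y2"
    and d1: "dg n k (fc (Suc n) k Minus X1) = dg n i (fc (Suc n) i Minus Y1)"
    and d2: "dg n k (fc (Suc n) k Plus Y2) = dg n i (fc (Suc n) i Plus X2)"
  shows "cp (Suc n) i (cp (Suc n) k X1 X2) (cp (Suc n) k Y1 Y2) =
    cp (Suc n) k Y1 (cp (Suc n) k (cp (Suc n) i X1 Y2) X2)"
proof -
  let ?N = "Suc n"
  define D1 where "D1 = dg n k (fc ?N k Minus X1)"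
  define D2 where "D2 = dg n k (fc ?N k Plus Y2)"
  note [simp] = X e
  have D [simp]: "D1 \<in> cl ?N" "D2 \<in> cl ?N" using ik by (simp_all add: D1_def D2_def)
  have Dk: "fc ?N k \<alpha> D1 = fc ?N k Minus X1" "fc ?N k \<alpha> D2 = fc ?N k Plus Y2" for \<alpha>
    using ik by (simp_all add: D1_def D2_def)
  have Di: "fc ?N i \<alpha> D1 = fc ?N i Minus Y1" "fc ?N i \<alpha> D2 = fc ?N i Plus X2" for \<alpha>
    using ik unfolding D1_def D2_def d1 d2 by simp_all
  have u: "cp ?N k D1 X1 = X1" "cp ?N k Y2 D2 = Y2" "cp ?N i D1 Y1 = Y1" "cp ?N i X2 D2 = X2"
    using ik unfolding D1_def D2_def by (simp_all add: cp_dg) (simp_all add: d1 d2 cp_dg)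
  let ?Y = "cp ?N k Y1 Y2"
  have k: "fc ?N k Minus Y2 = fc ?N k Plus Y1" by simp
  have f: "fc ?N k \<alpha> (cp ?N i A B) = cp n (down i k) (fc ?N k \<alpha> A) (fc ?N k \<alpha> B)"
    "fc ?N i \<alpha> (cp ?N k A' B') = cp n (down k i) (fc ?N i \<alpha> A') (fc ?N i \<alpha> B')"
    if "A \<in> cl ?N" "B \<in> cl ?N" "fc ?N i Plus A = fc ?N i Minus B"
      "A' \<in> cl ?N" "B' \<in> cl ?N" "fc ?N k Plus A' = fc ?N k Minus B'" for \<alpha> A B A' B'
    using face_comp[of ?N i A B k \<alpha>] face_comp[of ?N k A' B' i \<alpha>] that ik by (simp_all add: composable_def)
  have iD: "fc ?N i Plus (cp ?N k D1 X1) = fc ?N i Minus ?Y"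
    using f(2)[of D1 Y1 D1 X1 Plus] f(2)[of D1 Y1 Y1 Y2 Minus] Dk Di by simp
  have kY: "fc ?N k Plus ?Y = fc ?N k Minus D2" using ik by (simp add: Dk)
  have "cp ?N i (cp ?N k X1 X2) ?Y = cp ?N i (cp ?N k (cp ?N k D1 X1) X2) (cp ?N k ?Y D2)"
  proof -
    have "cp ?N k ?Y D2 = ?Y" using ik Dk u by (simp add: cp_assoc)
    then show ?thesis by (simp only: u)
  qed
  also have "\<dots> = cp ?N k (cp ?N i (cp ?N k D1 X1) ?Y) (cp ?N i X2 D2)"
    using ik iD kY by (intro cp_exch) (simp_all add: u Dk Di)
  also have "cp ?N i (cp ?N k D1 X1) ?Y = cp ?N k (cp ?N i D1 Y1) (cp ?N i X1 Y2)"
    using ik by (intro cp_exch) (simp_all add: Dk Di)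
  also have "cp ?N k (cp ?N k (cp ?N i D1 Y1) (cp ?N i X1 Y2)) (cp ?N i X2 D2) =
     cp ?N k (cp ?N k Y1 (cp ?N i X1 Y2)) X2" by (simp only: u)
  also have "\<dots> = cp ?N k Y1 (cp ?N k (cp ?N i X1 Y2) X2)"
  proof (rule cp_assoc)
    show "fc ?N k Plus Y1 = fc ?N k Minus (cp ?N i X1 Y2)"
      using f(1)[of X1 Y2 D1 X1 Minus] f(1)[of D1 Y1 D1 X1 Plus] Dk Di u(3) by simp
    show "fc ?N k Plus (cp ?N i X1 Y2) = fc ?N k Minus X2"
      using f(1)[of X1 Y2 D1 X1 Plus] f(1)[of X2 D2 D1 X1 Minus] Dk Di u(4) by simp
  qed (use ik in simp_all)
  finally show ?thesis .
qed

text \<open>For an invertible cell with trivial i-faces the T_i-inverse is the fold of its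
  \<star>_{i+1}-inverse, and this applies to \<open>U\<close> and to \<Gamma>_{i+1}^- U. It remains
  to see that the fold of the resulting intermediate cell is inverse to \<Gamma>_i^- B, an identity
  between explicit composites.\<close>

lemma conn_compat_Rp:
  assumes i: "1 \<le> i" "i \<le> Suc m" and R: "Rp (Suc (Suc m)) (Suc i) U U'" and pq: "p \<in> cl m" "q \<in> cl m"
    and fU: "fc (Suc (Suc m)) i Minus U = dg m i p" "fc (Suc (Suc m)) i Plus U = dg m i q"
      "fc (Suc (Suc m)) i Minus U' = dg m i p" "fc (Suc (Suc m)) i Plus U' = dg m i q"
  shows "conn_compat (Suc (Suc m)) i U (Pf (Suc (Suc m)) i U')"
proof -
  let ?m = "Suc m" and ?n = "Suc (Suc m)" and ?N = "Suc (Suc (Suc m))"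
  define a c where "a = fc ?n (Suc i) Plus U" and "c = fc ?n (Suc i) Minus U"
  define B B' where "B = Pf ?n i U'" and "B' = Pf ?n i U"
  note [simp] = i le_SucI[OF i(2)] le_SucI[OF le_SucI[OF i(2)]] pq
  have [simp]: "Suc 0 \<le> i" using i by simp
  note RD = RpD[OF R]
  have U [simp]: "U \<in> cl ?n" "U' \<in> cl ?n" by (rule RD)+
  have ac [simp]: "a \<in> cl ?m" "c \<in> cl ?m" by (simp_all add: a_def c_def)
  have fU' [simp]: "fc ?n (Suc i) Plus U = a" "fc ?n (Suc i) Minus U = c"
    "fc ?n (Suc i) Minus U' = a" "fc ?n (Suc i) Plus U' = c"
    using RD(5,6) by (simp_all add: a_def c_def)
  note [simp] = fU
  have pt: "dg ?m (Suc i) (dg m i r) = dg ?m i (dg m i r)" if "r \<in> cl m" for r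
    using dg_dg[of r m i i] that by simp
  have pt2: "dg ?n (Suc (Suc i)) (dg ?m i (dg m i r)) = dg ?n i (dg ?m i (dg m i r))" if "r \<in> cl m" for r
    using dg_dg[of "dg m i r" ?m i "Suc i"] pt[OF that] that by simp
  have "fc ?m i \<beta> (fc ?n (Suc i) \<alpha> U) = fc ?m i \<alpha> (fc ?n i \<beta> U)" for \<alpha> \<beta>
    by (rule fc_fc[symmetric]) simp_all
  from this[of Minus Plus] this[of Minus Minus] this[of Plus Plus] this[of Plus Minus]
  have fac [simp]: "fc ?m i Minus a = p" "fc ?m i Minus c = p" "fc ?m i Plus a = q" "fc ?m i Plus c = q"
    by simp_all
  have T: "Tp ?n i U B" unfolding B_def by (rule Rp_Tp_Pf[OF i R pq fU])
  have B [simp]: "B \<in> cl ?n" "B' \<in> cl ?n" by (simp_all add: B_def B'_def Pf_cl[OF i])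
  have fB [simp]: "fc ?n i Minus B = c" "fc ?n i Plus B = a" "fc ?n (Suc i) Minus B = dg m i p" "fc ?n (Suc i) Plus B = dg m i q"
    "fc ?n i Minus B' = a" "fc ?n i Plus B' = c" "fc ?n (Suc i) Minus B' = dg m i p" "fc ?n (Suc i) Plus B' = dg m i q"
    unfolding B_def B'_def
    by (simp_all add: fc_Pf_same[OF i] fc_Pf_Suc[OF i] cp_dg)
  have "Pf ?n i B = B" by (rule Pf_glob[OF i _ pq]) simp_all
  then have RB: "Rp ?n i B B'" using Rp_sym[OF Tp_Rp_Pf[OF i T]] by (simp add: B'_def)
  \<comment> \<open>The formula of \<open>vpair_Gm\<close> for the inverse of a connection on an
    invertible cell.\<close>
  define N' where "N' = cp ?N (Suc (Suc i)) (cn ?n (Suc i) Minus U') (dg ?n (Suc i) U)"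
  have RN: "Rp ?N (Suc i) (cn ?n (Suc i) Minus U) N'"
    unfolding N'_def by (rule Rp_cn_same) (use R in simp_all)
  have N' [simp]: "N' \<in> cl ?N" using RpD[OF RN] by simp
  have ptu: "cp ?n (Suc i) (dg ?m i (dg m i r)) (dg ?m i (dg m i r)) = dg ?m i (dg m i r)" if "r \<in> cl m" for r
    using that by (simp add: cp_dg flip: pt)
  have fN' [simp]: "fc ?N i Minus N' = dg ?m i (dg m i p)" "fc ?N i Plus N' = dg ?m i (dg m i q)"
    "fc ?N (Suc (Suc i)) Minus N' = U'" "fc ?N (Suc (Suc i)) Plus N' = dg ?m (Suc i) a"
    "fc ?N (Suc i) Minus N' = dg ?m (Suc i) a" "fc ?N (Suc i) Plus N' = U"
    using RpD(5,6)[OF RN]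
    by (simp_all add: N'_def fc_cp_less fc_cn_less fc_dg_less fc_dg_greater cn_dg_same ptu fc_cn_opposite)
  define M where "M = Pf ?N i N'"
  have T1: "Tp ?N i (cn ?n (Suc i) Minus U) M"
    unfolding M_def
    by (rule Rp_Tp_Pf[of i ?m _ _ "dg m i p" "dg m i q"])
      (use RN in \<open>simp_all add: fc_cn_less cn_dg_same\<close>)
  have M [simp]: "M \<in> cl ?N" by (rule TpD[OF T1])
  define Fa Ea Fc Ec where "Fa = cn ?m i Plus a" and "Ea = cn ?m i Minus a"
    and "Fc = cn ?m i Plus c" and "Ec = cn ?m i Minus c"
  have EF [simp]: "Fa \<in> cl ?n" "Ea \<in> cl ?n" "Fc \<in> cl ?n" "Ec \<in> cl ?n"
    by (simp_all add: Fa_def Ea_def Fc_def Ec_def)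
  have fEF [simp]: "fc ?n i Minus Fa = dg m i p" "fc ?n (Suc i) Minus Fa = dg m i p"
     "fc ?n i Plus Fa = a" "fc ?n (Suc i) Plus Fa = a"
     "fc ?n i Minus Fc = dg m i p" "fc ?n (Suc i) Minus Fc = dg m i p"
     "fc ?n i Plus Fc = c" "fc ?n (Suc i) Plus Fc = c"
     "fc ?n i Plus Ea = dg m i q" "fc ?n (Suc i) Plus Ea = dg m i q"
     "fc ?n i Minus Ea = a" "fc ?n (Suc i) Minus Ea = a"
     "fc ?n i Plus Ec = dg m i q" "fc ?n (Suc i) Plus Ec = dg m i q"
     "fc ?n i Minus Ec = c" "fc ?n (Suc i) Minus Ec = c"
    by (simp_all add: Fa_def Ea_def Fc_def Ec_def fc_cn_opposite)
  let ?M3 = "cn ?n i Minus U"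
  have Meq: "M = cp ?N (Suc i) (dg ?n (Suc (Suc i)) Fa) (cp ?N (Suc i) N' ?M3)"
    unfolding M_def Pf_def by (simp add: cn_dg_less Fa_def)
  have P3: "Pf ?N (Suc i) ?M3 = cp ?N (Suc (Suc i)) (cn ?n (Suc i) Plus Ec)
     (cp ?N (Suc (Suc i)) ?M3 (cn ?n (Suc i) Minus Ea))"
    unfolding Pf_def by (simp add: fc_cn_greater Ec_def Ea_def)
  \<comment> \<open>\<open>N'\<close> and the degenerate factor of \<open>M\<close> are thin in the
    directions i+1 and i+2, so in the fold of \<open>M\<close> they leave only their left
    sides.\<close>
  have PN: "Pf ?N (Suc i) N' = dg ?n (Suc i) (cp ?n (Suc i) U' U)"
    unfolding N'_def by (rule Pf_cn_dg) simp_all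
  have "Pf ?N (Suc i) (cp ?N (Suc i) N' ?M3) = cp ?N (Suc (Suc i)) (dg ?n (Suc i) (fc ?N (Suc (Suc i)) Minus N')) (Pf ?N (Suc i) ?M3)"
    by (rule Pf_thin_cp) (simp_all add: PN)
  then have P2: "Pf ?N (Suc i) (cp ?N (Suc i) N' ?M3) = cp ?N (Suc (Suc i)) (dg ?n (Suc i) U') (Pf ?N (Suc i) ?M3)"
    by simp
  have "Pf ?N (Suc i) M = cp ?N (Suc (Suc i)) (dg ?n (Suc i) (fc ?N (Suc (Suc i)) Minus (dg ?n (Suc (Suc i)) Fa)))
      (Pf ?N (Suc i) (cp ?N (Suc i) N' ?M3))"
    unfolding Meq
    by (rule Pf_thin_cp) (simp_all add: Pf_dg[of "Suc i" ?m] fc_dg_less cp_dg)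
  then have PM: "Pf ?N (Suc i) M = cp ?N (Suc (Suc i)) (dg ?n (Suc i) Fa) (cp ?N (Suc (Suc i)) (dg ?n (Suc i) U')
      (cp ?N (Suc (Suc i)) (cn ?n (Suc i) Plus Ec) (cp ?N (Suc (Suc i)) ?M3 (cn ?n (Suc i) Minus Ea))))"
    by (simp add: P2 P3)
  \<comment> \<open>The inverse of \<Gamma>_i^- B, by the transpose of \<open>vpair_Gm\<close>; it
    is to be matched with the fold of \<open>M\<close>.\<close>
  define W where "W = cp ?N i (cn ?n i Minus B') (dg ?n (Suc i) B)"
  have RW: "Rp ?N (Suc i) (cn ?n i Minus B) W"
    unfolding W_def by (rule Rp_cn_Suc[OF i(1)]) (use RB in simp_all)
  have B'eq: "B' = cp ?n (Suc i) Fc (cp ?n (Suc i) U Ea)"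
    unfolding B'_def Pf_def by (simp add: Fc_def Ea_def)
  have Beq: "B = cp ?n (Suc i) Fa (cp ?n (Suc i) U' Ec)"
    unfolding B_def Pf_def by (simp add: Fa_def Ec_def)
  let ?k = "Suc (Suc i)"
  have cB': "cn ?n i Minus B' = cp ?N ?k (cn ?n i Minus Fc) (cp ?N ?k ?M3 (cn ?n i Minus Ea))"
    unfolding B'eq by (simp add: cn_cp_less)
  have dB: "dg ?n (Suc i) B = cp ?N ?k (cp ?N ?k (dg ?n (Suc i) Fa) (dg ?n (Suc i) U')) (dg ?n (Suc i) Ec)"
    unfolding Beq by (simp add: dg_cp_le cp_assoc fc_dg_greater)
  \<comment> \<open>The factors of \<Gamma>_i^- B' and \<epsilon>_{i+1} B overlap in a single
    column, the one of \<open>Fc\<close> and \<open>Ec\<close>, which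
    \<open>cn_Plus_cn_Minus\<close> evaluates.\<close>
  have "W = cp ?N ?k (cp ?N ?k (dg ?n (Suc i) Fa) (dg ?n (Suc i) U'))
      (cp ?N ?k (cp ?N i (cn ?n i Minus Fc) (dg ?n (Suc i) Ec)) (cp ?N ?k ?M3 (cn ?n i Minus Ea)))"
    unfolding W_def cB' dB
    by (rule cp_staggered)
      (simp_all add: fc_dg_less fc_dg_greater fc_cn_greater fc_cn_opposite fc_cp_less cn_dg_same
          ptu pt pt2)
  also have "cp ?N i (cn ?n i Minus Fc) (dg ?n (Suc i) Ec) = cn ?n (Suc i) Plus Ec"
    unfolding Fc_def Ec_def by (rule cn_Plus_cn_Minus) simp_all
  also have "cn ?n i Minus Ea = cn ?n (Suc i) Minus Ea"
    by (simp add: Ea_def cn_cn_same)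
  finally have "W = Pf ?N (Suc i) M"
    unfolding PM by (simp add: cp_assoc fc_dg_greater fc_cn_greater fc_cn_opposite flip: Ec_def Ea_def)
  then have RPM: "Rp ?N (Suc i) (Pf ?N (Suc i) M) (cn ?n i Minus B)" using Rp_sym[OF RW] by simp
  have fM: "fc ?N ?k Minus M = B" "fc ?N ?k Plus M = dg ?m i a"
    "fc ?N (Suc i) Minus M = dg ?m i (dg m i p)" "fc ?N (Suc i) Plus M = dg ?m i (dg m i q)"
    unfolding M_def
    by (simp_all add: fc_Pf_greater Pf_dg fc_Pf_Suc flip: B_def)
  have T2: "Tp ?N (Suc i) M (cn ?n i Minus B)"
    by (rule Rp_Pf_imp_Tp[of "Suc i" ?m _ _ "dg m i p" "dg m i q"])
      (use RPM in \<open>simp_all add: fM fc_cn_opposite fc_cn_greater cn_dg_same pt\<close>)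
  show ?thesis unfolding conn_compat_def using T T1 T2 B_def by blast
qed

text \<open>Unfolding by \<open>Qf\<close> writes \<open>A\<close> as a composite of degeneracies,
  connections and \<open>Qf A\<close>, which is \<star>_{i+1}-invertible with degenerate i-faces.
  Each piece is compatible with connections, hence so is \<open>A\<close>; the cell reached is
  \<open>B\<close> by uniqueness.\<close>

lemma Tp_cn_Minus_Suc:
  assumes T: "Tp n i A B"
  obtains M where "Tp (Suc n) i (cn n (Suc i) Minus A) M" "Tp (Suc n) (Suc i) M (cn n i Minus B)"
proof -
  obtain m where n: "n = Suc (Suc m)" and i': "Suc 0 \<le> i" "i \<le> Suc m" using T by (rule Tp_dim)
  then have i: "1 \<le> i" "i \<le> Suc m" by simp_all
  have A: "A \<in> cl (Suc (Suc m))" and B: "B \<in> cl (Suc (Suc m))" using TpD[OF T] n by auto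
  let ?R = "\<lambda>X. \<exists>B. conn_compat (Suc (Suc m)) i X B"
  have "?R A"
  proof (rule unfold_Qf_closed[OF i A, where R = ?R])
    have R: "Rp (Suc (Suc m)) (Suc i) (Qf (Suc (Suc m)) i A) (Qf (Suc (Suc m)) i B)"
      by (rule Tp_Rp_Qf[OF i]) (use T n in simp)
    have q: "fc (Suc (Suc m)) i Minus (Qf (Suc (Suc m)) i A) = dg m i (fc (Suc m) i Minus (fc (Suc (Suc m)) i Minus A))"
      "fc (Suc (Suc m)) i Plus (Qf (Suc (Suc m)) i A) = dg m i (fc (Suc m) i Plus (fc (Suc (Suc m)) i Plus A))"
      by (simp_all add: fc_Qf_same[OF i] A)
    have q': "fc (Suc (Suc m)) i Minus (Qf (Suc (Suc m)) i B) = dg m i (fc (Suc m) i Minus (fc (Suc (Suc m)) i Minus A))"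
      "fc (Suc (Suc m)) i Plus (Qf (Suc (Suc m)) i B) = dg m i (fc (Suc m) i Plus (fc (Suc (Suc m)) i Plus A))"
      using TpD(5,6)[OF T] A B i by (simp_all add: fc_Qf_same[OF i] n fc_fc)
    have "fc (Suc m) i \<beta> (fc (Suc (Suc m)) i \<gamma> A) \<in> cl m" for \<beta> \<gamma> using A i by simp
    from conn_compat_Rp[OF i R this this q q'] show "?R (Qf (Suc (Suc m)) i A)" by blast
    show "\<And>X Y. \<lbrakk>X \<in> cl (Suc (Suc m)); Y \<in> cl (Suc (Suc m)); fc (Suc (Suc m)) (Suc i) Plus X = fc (Suc (Suc m)) (Suc i) Minus Y; ?R X; ?R Y\<rbrakk>
       \<Longrightarrow> ?R (cp (Suc (Suc m)) (Suc i) X Y)"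
      "\<And>X Y. \<lbrakk>X \<in> cl (Suc (Suc m)); Y \<in> cl (Suc (Suc m)); fc (Suc (Suc m)) i Plus X = fc (Suc (Suc m)) i Minus Y; ?R X; ?R Y\<rbrakk>
       \<Longrightarrow> ?R (cp (Suc (Suc m)) i X Y)"
      using conn_compat_cp[OF i] conn_compat_cp_Suc[OF i] by blast+
    have f: "fc (Suc (Suc m)) i \<alpha> A \<in> cl (Suc m)" "fc (Suc (Suc m)) (Suc i) \<alpha> A \<in> cl (Suc m)" for \<alpha>
      using A i by simp_all
    show "?R (dg (Suc m) (Suc i) (fc (Suc (Suc m)) (Suc i) Minus A))"
      "?R (dg (Suc m) (Suc i) (fc (Suc (Suc m)) (Suc i) Plus A))"
      "?R (cn (Suc m) i Plus (fc (Suc (Suc m)) i Plus A))"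
      "?R (cn (Suc m) i Minus (fc (Suc (Suc m)) i Minus A))"
      using conn_compat_dg_Suc[OF i] conn_compat_cn_Plus[OF i] conn_compat_cn_Minus[OF i] f by blast+
  qed
  then obtain B' where B': "conn_compat n i A B'" using n by blast
  then have "B' = B" using T Tp_unique by (auto simp: conn_compat_def)
  then show thesis using B' that by (auto simp: conn_compat_def)
qed

end

section \<open>Reversing all directions\<close>

fun neg :: "polarity \<Rightarrow> polarity" where
  "neg Minus = Plus"
| "neg Plus = Minus"

lemma neg_eq_iff [simp]: "neg \<alpha> = neg \<beta> \<longleftrightarrow> \<alpha> = \<beta>"
  by (cases \<alpha>; cases \<beta>) auto

text \<open>Serves to exchange the two signs of connections, so that \<open>Tp_cn_Minus_Suc\<close>
  also covers the sign \<open>Plus\<close>.\<close>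

definition reversed :: "'a cubical \<Rightarrow> 'a cubical" where
  "reversed C = \<lparr>cells = cells C, face = (\<lambda>n i \<alpha>. face C n i (neg \<alpha>)), degen = degen C,
     conn = (\<lambda>n i \<alpha>. conn C n i (neg \<alpha>)), cube_comp = (\<lambda>n i A B. cube_comp C n i B A)\<rparr>"

lemma reversed_sel [simp]:
  "cells (reversed C) = cells C" "face (reversed C) n i \<alpha> = face C n i (neg \<alpha>)"
  "degen (reversed C) = degen C" "conn (reversed C) n i \<alpha> = conn C n i (neg \<alpha>)"
  "cube_comp (reversed C) n i A B = cube_comp C n i B A"
  by (simp_all add: reversed_def)

lemma composable_reversed [simp]: "composable (reversed C) n i A B \<longleftrightarrow> composable C n i B A"
  by (auto simp: composable_def)

context cubical_omega_category
begin

lemma cubical_omega_category_reversed: "cubical_omega_category (reversed C)"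
  by (unfold_locales; (simp only: reversed_sel composable_reversed neg.simps)?;
      (rule face_cell face_degen face_degen_same face_conn face_conn_same face_comp_Minus
        face_comp_Plus comp_assoc[symmetric] comp_degen_right comp_degen_left interchange
        degen_comp conn_comp conn_comp_Minus conn_comp_Plus conn_transport conn_transport_Suc
        degen_cell conn_cell comp_cell face_face face_conn_opposite degen_degen conn_conn
        conn_conn_same conn_degen conn_degen_same face_comp; (assumption | simp))?)

text \<open>Reversal turns the T-equation for \<open>A\<close> and \<open>B\<close> into the one for
  \<open>B\<close> and \<open>A\<close>, and a T-inverse satisfies both.\<close>

lemma Tp_reversed: "is_T_inverse (reversed C) n i A B \<longleftrightarrow> Tp n i A B"
proof -
  have "T_equation (reversed C) n i A B \<longleftrightarrow> T_equation C n i B A"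
    if "\<forall>\<alpha>. fc n i \<alpha> A = fc n (i + 1) \<alpha> B \<and> fc n (i + 1) \<alpha> A = fc n i \<alpha> B" for A B
    using that by (simp add: T_equation_def)
  then show ?thesis
    unfolding is_T_inverse_def by (auto simp: polarity_cases_eq)
qed

lemma Tp_cn_Suc:
  assumes T: "Tp n i A B"
  obtains M where "Tp (Suc n) i (cn n (Suc i) \<alpha> A) M" "Tp (Suc n) (Suc i) M (cn n i \<alpha> B)"
proof (cases \<alpha>)
  case Minus
  then show ?thesis using Tp_cn_Minus_Suc[OF T] that by metis
next
  case Plus
  interpret r: cubical_omega_category "reversed C" by (rule cubical_omega_category_reversed)
  obtain M where "is_T_inverse (reversed C) (Suc n) i (conn (reversed C) n (Suc i) Minus A) M"
    "is_T_inverse (reversed C) (Suc n) (Suc i) M (conn (reversed C) n i Minus B)"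
    using r.Tp_cn_Minus_Suc T Tp_reversed by metis
  then show ?thesis using that Plus by (simp add: Tp_reversed)
qed

end

section \<open>Words and marked directions\<close>

lemma append_swap_cases:
  assumes "t1 @ b # t2 = u @ True # False # v"
  obtains u' where "u = t1 @ b # u'" "t2 = u' @ True # False # v"
  | "b" "t1 = u" "t2 = False # v"
  | "\<not> b" "t1 = u @ [True]" "t2 = v"
  | v' where "t1 = u @ True # False # v'" "v = v' @ b # t2"
proof -
  consider u' where "u = t1 @ b # u'" "t2 = u' @ True # False # v"
    | "t1 = u" "b # t2 = True # False # v"
    | w where "t1 = u @ True # w" "w @ b # t2 = False # v"
    using assms by (auto simp: append_eq_append_conv2 append_eq_Cons_conv Cons_eq_append_conv)
  then show thesis
  proof cases
    case 3
    then show thesis using that by (cases w) auto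
  qed (use that in auto)
qed

lemma insert_swap_cases:
  assumes "t1 @ t2 = u @ True # False # v"
  obtains u' where "u = t1 @ u'" "t2 = u' @ True # False # v"
  | "t1 = u @ [True]" "t2 = False # v"
  | v' where "t1 = u @ True # False # v'" "v = v' @ t2"
  using assms by (auto simp: append_eq_append_conv2 append_eq_Cons_conv Cons_eq_append_conv)

text \<open>The lists that admit no move from \<open>True # False\<close> to
  \<open>False # True\<close>, that is, with all marks on the right.\<close>

definition final :: "bool list \<Rightarrow> bool" where
  "final s \<longleftrightarrow> (\<forall>u v. s = u @ True # v \<longrightarrow> False \<notin> set v)"

lemma finalD: "final (u @ True # v) \<Longrightarrow> False \<notin> set v"
  by (auto simp: final_def)

lemma final_prefix:
  assumes "final (s @ t)"
  shows "final s"
  unfolding final_def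
proof (intro allI impI)
  fix u v assume "s = u @ True # v"
  then have "final (u @ True # (v @ t))" using assms by simp
  from finalD[OF this] show "False \<notin> set v" by simp
qed

lemma not_final_split: "\<not> final s \<Longrightarrow> \<exists>u v. s = u @ True # False # v \<and> final u"
proof (induction s rule: rev_induct)
  case Nil
  then show ?case by (simp add: final_def)
next
  case (snoc x s)
  show ?case
  proof (cases "final s")
    case False
    then obtain u v where "s = u @ True # False # v" "final u" using snoc.IH by blast
    then have "s @ [x] = u @ True # False # (v @ [x]) \<and> final u" by simp
    then show ?thesis by blast
  next
    case True
    obtain u v where uv: "s @ [x] = u @ True # v" "False \<in> set v" using snoc.prems by (auto simp: final_def)
    then obtain v' where v': "v = v' @ [x]" "s = u @ True # v'" by (cases v rule: rev_cases) auto
    then have v'F: "False \<notin> set v'" using True by (auto simp: final_def)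
    then have x: "\<not> x" using uv v' by auto
    obtain w where w: "s = w @ [True]"
      using v' v'F by (cases v' rule: rev_cases) auto
    then have "s @ [x] = w @ True # False # [] \<and> final w" using x final_prefix True by auto
    then show ?thesis by blast
  qed
qed

text \<open>A final \<open>u\<close> contains no pair \<open>True\<close>, \<open>False\<close>, and
  two such pairs cannot overlap; so the other pair lies wholly to the right.\<close>

lemma swap_far:
  assumes "u @ True # False # v = u1 @ True # False # v1" "final u" "u \<noteq> u1"
  obtains w where "u1 = u @ True # False # w" "v = w @ True # False # v1"
proof -
  have "\<not> (\<exists>w. u = u1 @ True # False # w)"
    using assms(2) finalD by fastforce
  then show thesis using assms(1,3) that
    by (auto simp: append_eq_append_conv2 append_eq_Cons_conv Cons_eq_append_conv)
qed

lemma final_replicate: "final (replicate n False @ replicate p True)"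
proof -
  have "False" if "replicate n False @ replicate p True = u @ True # v" "False \<in> set v" for u v
    using that
  proof (induction n arbitrary: u)
    case 0
    then have "set (u @ True # v) = set (replicate p True)" by simp
    then have "False \<in> set (replicate p True)" using 0 by auto
    then show ?case by simp
  next
    case (Suc n)
    then show ?case by (cases u) auto
  qed
  then show ?thesis unfolding final_def by blast
qed

text \<open>Like a word, the list is read from its end: its head is the last move. Letters count
  positions from 1.\<close>

primrec path :: "nat list \<Rightarrow> bool list \<Rightarrow> bool list \<Rightarrow> bool" where
  "path [] s t \<longleftrightarrow> s = t"
| "path (i # w) s t \<longleftrightarrow> (\<exists>u v. path w s (u @ True # False # v) \<and> i = Suc (length u) \<and> t = u @ False # True # v)"

lemma path_snoc:
  "path (w @ [Suc (length u)]) (u @ True # False # v) t \<longleftrightarrow> path w (u @ False # True # v) t"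
  by (induction w arbitrary: t) auto

lemma path_length: "path w s t \<Longrightarrow> length t = length s"
proof (induction w arbitrary: t)
  case (Cons j w)
  then obtain u v where uv: "path w s (u @ True # False # v)" "t = u @ False # True # v" by auto
  show ?case using Cons.IH[OF uv(1)] uv(2) by auto
qed simp

lemma path_trans: "path w s t \<Longrightarrow> path w' t r \<Longrightarrow> path (w' @ w) s r"
  by (induction w' arbitrary: r) auto

text \<open>Only the existence of a word is claimed, because the prefix \<open>a\<close> shifts all
  letters.\<close>

lemma path_context: "path w s t \<Longrightarrow> \<exists>w'. path w' (a @ s @ c) (a @ t @ c)"
proof (induction w arbitrary: t)
  case Nil
  then show ?case by (metis path.simps(1))
next
  case (Cons i w)
  then obtain u v where uv: "path w s (u @ True # False # v)" "t = u @ False # True # v" by auto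
  from Cons.IH[OF uv(1)] obtain w' where "path w' (a @ s @ c) ((a @ u) @ True # False # (v @ c))" by auto
  then have "path (Suc (length (a @ u)) # w') (a @ s @ c) ((a @ u) @ False # True # (v @ c))"
    unfolding path.simps by blast
  then show ?case using uv(2) by (metis append.assoc append_Cons)
qed

lemma path_move_False: "\<exists>w. path w (replicate p True @ [False]) (False # replicate p True)"
proof (induction p)
  case 0
  then show ?case by (intro exI[of _ "[]"]) simp
next
  case (Suc p)
  then obtain w where "path w (replicate p True @ [False]) (False # replicate p True)" by blast
  from path_context[OF this, of "[True]" "[]"] obtain w' where
    "path w' (replicate (Suc p) True @ [False]) ([] @ True # False # replicate p True)" by auto
  then have "path (Suc 0 # w') (replicate (Suc p) True @ [False]) (False # replicate (Suc p) True)"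
    by force
  then show ?case by blast
qed

lemma path_exists: "\<exists>w. path w (replicate p True @ replicate n False) (replicate n False @ replicate p True)"
proof (induction n)
  case 0
  then show ?case by (intro exI[of _ "[]"]) simp
next
  case (Suc n)
  then obtain w where w: "path w (replicate p True @ replicate n False) (replicate n False @ replicate p True)" by blast
  from path_move_False obtain w1 where "path w1 (replicate p True @ [False]) (False # replicate p True)" by blast
  from path_context[OF this, of "[]" "replicate n False"] obtain w2 where
    2: "path w2 (replicate p True @ replicate (Suc n) False) (False # replicate p True @ replicate n False)" by auto
  from path_context[OF w, of "[False]" "[]"] obtain w3 where
    "path w3 (False # replicate p True @ replicate n False) (replicate (Suc n) False @ replicate p True)" by auto
  with path_trans[OF 2] show ?case by blast
qed

section \<open>Minimal words are paths\<close>

text \<open>A word of adjacent transpositions acts on the marks by a path as soon as it raises the sum of the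
  positions of the marks by its length; this is how minimality of a word is used.\<close>

definition potential :: "bool list \<Rightarrow> nat" where
  "potential s = (\<Sum>k<length s. if s ! k then k else 0)"

lemma potential_append: "potential (s @ t) = potential s + potential t + length s * count_list t True"
proof (induction t rule: rev_induct)
  case Nil
  then show ?case by (simp add: potential_def)
next
  case (snoc x t)
  have s: "potential (r @ [x]) = potential r + (if x then length r else 0)" for r
    by (simp add: potential_def nth_append)
  have "potential ((s @ t) @ [x]) = potential s + potential (t @ [x]) + length s * count_list (t @ [x]) True"
    unfolding s snoc.IH by simp
  then show ?case by simp
qed

lemma potential_Cons: "potential (x # t) = potential t + count_list t True"
  using potential_append[of "[x]" t] by (simp add: potential_def)

lemma path_potential: "path w s t \<Longrightarrow> potential t = potential s + length w"
proof (induction w arbitrary: t)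
  case (Cons j w)
  then obtain u v where uv: "path w s (u @ True # False # v)" "t = u @ False # True # v" by auto
  show ?case using Cons.IH[OF uv(1)] uv(2) by (simp add: potential_append potential_Cons)
qed simp

text \<open>Chosen so that a new letter at the head of a word, which precomposes with a
  transposition, exchanges two neighbouring entries. The identity marks the first p positions and
  \<open>rho n p\<close> the last p.\<close>

definition marks :: "nat \<Rightarrow> nat \<Rightarrow> (nat \<Rightarrow> nat) \<Rightarrow> bool list" where
  "marks N p \<sigma> = map (\<lambda>k. \<sigma> (Suc k) \<le> p) [0..<N]"

lemma marks_swap:
  assumes "1 \<le> i" "i < N"
  obtains u a b v where "marks N p \<sigma> = u @ a # b # v" "marks N p (\<sigma> \<circ> transpose i (i + 1)) = u @ b # a # v"
    "i = Suc (length u)"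
proof -
  obtain k where k: "i = Suc k" "Suc k < N" using assms by (cases i) auto
  define l where "l = N - Suc (Suc k)"
  have N: "N = k + 2 + l" using k by (simp add: l_def)
  have u: "[0..<N] = [0..<k] @ k # Suc k # [k + 2..<N]"
  proof -
    have "[0..<N] = [0..<k] @ [k..<N]" using N by (metis upt_add_eq_append add.assoc le0 add_0)
    moreover have "[k..<N] = k # Suc k # [k + 2..<N]" using N by (simp add: upt_conv_Cons)
    ultimately show ?thesis by simp
  qed
  have t: "transpose i (i + 1) (Suc j) = Suc j" if "j \<noteq> k" "j \<noteq> Suc k" for j
    using that k by (simp add: transpose_def)
  show thesis
  proof (rule that)
    show "marks N p \<sigma> = map (\<lambda>k. \<sigma> (Suc k) \<le> p) [0..<k] @ (\<sigma> (Suc k) \<le> p) # (\<sigma> (Suc (Suc k)) \<le> p)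
       # map (\<lambda>k. \<sigma> (Suc k) \<le> p) [k + 2..<N]"
      unfolding marks_def u by simp
    show "marks N p (\<sigma> \<circ> transpose i (i + 1)) = map (\<lambda>k. \<sigma> (Suc k) \<le> p) [0..<k] @ (\<sigma> (Suc (Suc k)) \<le> p) # (\<sigma> (Suc k) \<le> p)
       # map (\<lambda>k. \<sigma> (Suc k) \<le> p) [k + 2..<N]"
      unfolding marks_def u using k by (auto simp: t)
  qed (use k in simp)
qed

lemma marks_id: "marks (n + p) p id = replicate p True @ replicate n False"
  by (rule nth_equalityI) (auto simp: marks_def nth_append)

lemma marks_rho: "marks (n + p) p (rho n p) = replicate n False @ replicate p True"
  by (rule nth_equalityI) (auto simp: marks_def nth_append rho_def)

lemma potential_word:
  assumes s0: "marks N p id = s0" and "set w \<subseteq> {1..<N}"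
  shows "potential (marks N p (word_perm w)) \<le> potential s0 + length w"
    "potential (marks N p (word_perm w)) = potential s0 + length w \<Longrightarrow>
      path w s0 (marks N p (word_perm w))"
  using assms(2)
proof (induction w)
  case Nil
  { case 1 show ?case by (simp add: s0 flip: id_def) }
  { case 2 show ?case by (simp add: s0 flip: id_def) }
next
  case (Cons i w)
  have i: "1 \<le> i" "i < N" if "set (i # w) \<subseteq> {1..<N}" using that by auto
  { case 1
    obtain u a b v where m: "marks N p (word_perm w) = u @ a # b # v"
      "marks N p (word_perm w \<circ> transpose i (i + 1)) = u @ b # a # v" "i = Suc (length u)"
      by (rule marks_swap[OF i[OF 1]])
    have "potential (u @ a # b # v) \<le> potential s0 + length w"
      unfolding m(1)[symmetric] by (rule Cons.IH(1)) (use 1 in simp)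
    then show ?case unfolding word_perm.simps m(2)
      by (cases a; cases b) (simp_all add: potential_append potential_Cons) }
  { case 2
    obtain u a b v where m: "marks N p (word_perm w) = u @ a # b # v"
      "marks N p (word_perm w \<circ> transpose i (i + 1)) = u @ b # a # v" "i = Suc (length u)"
      by (rule marks_swap[OF i[OF 2(2)]])
    have w: "set w \<subseteq> {1..<N}" using 2 by simp
    have 1: "potential (u @ a # b # v) \<le> potential s0 + length w"
      unfolding m(1)[symmetric] by (rule Cons.IH(1)[OF w])
    have e: "potential (u @ b # a # v) = potential s0 + length (i # w)"
      using 2(1) unfolding word_perm.simps m(2) .
    \<comment> \<open>Exchanging neighbours raises the potential only if a mark stands in front of
      an unmarked entry.\<close>
    have ab: "a" "\<not> b" using 1 e by (cases a; cases b; simp add: potential_append potential_Cons)+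
    have "potential (marks N p (word_perm w)) = potential s0 + length w"
      unfolding m(1) using e ab by (simp add: potential_append potential_Cons)
    from Cons.IH(2)[OF this w] have "path w s0 (u @ True # False # v)"
      using m(1) ab by simp
    then show ?case unfolding word_perm.simps m(2) path.simps using m(3) ab by auto }
qed

lemma path_letters: "path w s t \<Longrightarrow> set w \<subseteq> {1..<length s}"
proof (induction w arbitrary: t)
  case (Cons i w)
  then obtain u v where "path w s (u @ True # False # v)" "i = Suc (length u)" by auto
  then show ?case using Cons.IH path_length by fastforce
qed simp

lemma word_perm_outside: "set w \<subseteq> {1..<N} \<Longrightarrow> k < 1 \<or> N < k \<Longrightarrow> word_perm w k = k"
  by (induction w arbitrary: k) (auto simp: transpose_def)

text \<open>Moves never exchange equal entries, so the r-th marked entry stays the r-th marked one,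
  and likewise for unmarked ones. The permutation leads from positions in \<open>t\<close> back to
  positions in \<open>s\<close>.\<close>

lemma path_word_perm:
  "path w s t \<Longrightarrow> t = t1 @ b # t2 \<Longrightarrow>
    \<exists>s1 s2. s = s1 @ b # s2 \<and> count_list s1 b = count_list t1 b \<and> word_perm w (Suc (length t1)) = Suc (length s1)"
proof (induction w arbitrary: t t1 t2)
  case Nil
  then show ?case by auto
next
  case (Cons i w)
  then obtain u v where p: "path w s (u @ True # False # v)" and i: "i = Suc (length u)"
    and t: "t = u @ False # True # v" by auto
  have *: ?case if "u @ True # False # v = r1 @ b # r2" "count_list r1 b = count_list t1 b"
      "transpose i (i + 1) (Suc (length t1)) = Suc (length r1)" for r1 r2
    using Cons.IH[OF p that(1)] that by auto
  consider u' where "u = t1 @ b # u'" | "\<not> b" "t1 = u" | "b" "t1 = u @ [False]"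
    | v' where "t1 = u @ False # True # v'" "v = v' @ b # t2"
  proof -
    have e: "t1 @ b # t2 = u @ False # True # v" using Cons.prems t by simp
    then show thesis using that
      by (auto simp: append_eq_append_conv2 append_eq_Cons_conv Cons_eq_append_conv)
  qed
  then show ?case
  proof cases
    case 1
    then show ?thesis using *[of t1 "u' @ True # False # v"] i by (simp add: transpose_def)
  next
    case 2
    then show ?thesis using *[of "u @ [True]" v] i by (simp add: transpose_def)
  next
    case 3
    then show ?thesis using *[of u "False # v"] i by (simp add: transpose_def)
  next
    case 4
    then show ?thesis using *[of "u @ True # False # v'" t2] i by (auto simp: transpose_def)
  qed
qed

lemma replicate_split:
  assumes "replicate n a @ replicate p (\<not> a) = t1 @ b # t2"
  shows "if b = a then t1 = replicate (count_list t1 b) a \<and> count_list t1 b < n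
    else t1 = replicate n a @ replicate (count_list t1 b) (\<not> a) \<and> count_list t1 b < p"
  using assms
proof (induction t1 arbitrary: n p)
  case Nil
  then show ?case by (cases n; cases p) auto
next
  case (Cons x t1)
  show ?case
  proof (cases n)
    case 0
    then obtain p' where p: "p = Suc p'" using Cons.prems by (cases p) auto
    then have x: "x = (\<not> a)" "replicate 0 a @ replicate p' (\<not> a) = t1 @ b # t2" using Cons.prems 0 by auto
    show ?thesis using Cons.IH[OF x(2)] x(1) 0 p by (auto split: if_splits)
  next
    case (Suc n')
    then have x: "x = a" "replicate n' a @ replicate p (\<not> a) = t1 @ b # t2" using Cons.prems by auto
    show ?thesis using Cons.IH[OF x(2)] x(1) Suc by (auto split: if_splits)
  qed
qed

text \<open>As the order is kept among marked and among unmarked entries, the permutation is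
  determined by the two end lists.\<close>

lemma path_represents:
  assumes "path w (replicate p True @ replicate n False) (replicate n False @ replicate p True)"
  shows "represents (n + p) w (rho n p)"
proof -
  let ?s = "replicate p True @ replicate n False" and ?t = "replicate n False @ replicate p True"
  have w: "set w \<subseteq> {1..<n + p}" using path_letters[OF assms] by (simp add: add.commute)
  have "word_perm w k = rho n p k" for k
  proof (cases "1 \<le> k \<and> k \<le> n + p")
    case True
    then obtain j where j: "k = Suc j" "j < n + p" by (cases k) auto
    define b t1 t2 where "b = ?t ! j" and "t1 = take j ?t" and "t2 = drop (Suc j) ?t"
    have t: "?t = t1 @ b # t2" unfolding b_def t1_def t2_def using j by (intro id_take_nth_drop) simp
    have l: "length t1 = j" using j by (simp add: t1_def)
    obtain s1 s2 where s: "?s = s1 @ b # s2" "count_list s1 b = count_list t1 b" "word_perm w k = Suc (length s1)"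
      using path_word_perm[OF assms t] l j by auto
    have "replicate p True @ replicate n (\<not> True) = s1 @ b # s2" using s by simp
    note S = replicate_split[OF this]
    have "replicate n False @ replicate p (\<not> False) = t1 @ b # t2" using t by simp
    note T = replicate_split[OF this]
    show ?thesis
    proof (cases b)
      case True
      then have "s1 = replicate (count_list t1 b) True" "t1 = replicate n False @ replicate (count_list t1 b) True"
        using S T s by auto
      then have "length s1 = count_list t1 b" "length t1 = n + count_list t1 b" by (metis length_replicate length_append)+
      then show ?thesis using s l j by (simp add: rho_def)
    next
      case False
      then have "s1 = replicate p True @ replicate (count_list t1 b) False" "t1 = replicate (count_list t1 b) False" "count_list t1 b < n"
        using S T s by auto
      then have "length s1 = p + count_list t1 b" "length t1 = count_list t1 b" "count_list t1 b < n" by (metis length_replicate length_append)+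
      then show ?thesis using s l j by (simp add: rho_def)
    qed
  next
    case False
    then show ?thesis using word_perm_outside[OF w, of k] by (auto simp: rho_def)
  qed
  then show ?thesis using w by (auto simp: represents_def)
qed

text \<open>The difference of the potentials of the end lists bounds the length of every
  representing word from below. Paths are exactly the words that attain it, and
  \<open>path_exists\<close> provides one.\<close>

lemma minimal_word_iff_path:
  "is_arg_min length (\<lambda>w. represents (n + p) w (rho n p)) w \<longleftrightarrow>
    path w (replicate p True @ replicate n False) (replicate n False @ replicate p True)"
proof
  let ?s = "replicate p True @ replicate n False" and ?t = "replicate n False @ replicate p True"
  have lower: "potential ?t \<le> potential ?s + length w \<and> (potential ?t = potential ?s + length w \<longrightarrow> path w ?s ?t)"
    if "represents (n + p) w (rho n p)" for w
    using potential_word[OF marks_id, of w n p] that by (auto simp: represents_def marks_rho)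
  show "path w ?s ?t" if "is_arg_min length (\<lambda>w. represents (n + p) w (rho n p)) w"
  proof -
    obtain w' where w': "path w' ?s ?t" using path_exists by blast
    then have "length w \<le> length w'" using that path_represents[OF w'] by (auto simp: is_arg_min_def not_less)
    then show ?thesis using lower[of w] that path_potential[OF w'] by (auto simp: is_arg_min_def)
  qed
  show "is_arg_min length (\<lambda>w. represents (n + p) w (rho n p)) w" if "path w ?s ?t"
    using path_represents[OF that] path_potential[OF that] lower unfolding is_arg_min_def
    by (metis add_le_cancel_left not_less)
qed

context cubical_omega_category
begin

section \<open>Sequences of T-inverses along the marks\<close>

text \<open>\<open>reach k s X t Y\<close>: from \<open>X\<close>, whose $i$-th direction is marked iff \<open>s ! (i - 1)\<close>, one gets to \<open>Y\<close>,
  with marks \<open>t\<close>, by \<open>k\<close> applications of $T_i$ each of which moves a mark to the right.\<close>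

inductive reach :: "nat \<Rightarrow> bool list \<Rightarrow> 'a \<Rightarrow> bool list \<Rightarrow> 'a \<Rightarrow> bool" where
  refl: "X \<in> cl (length s) \<Longrightarrow> reach 0 s X s X"
| step: "Tp (length u + length v + 2) (Suc (length u)) X Y \<Longrightarrow> reach k (u @ False # True # v) Y t Z \<Longrightarrow>
    reach (Suc k) (u @ True # False # v) X t Z"

lemma reach_cl: "reach k s X t Y \<Longrightarrow> X \<in> cl (length s) \<and> Y \<in> cl (length s) \<and> length t = length s"
proof (induction rule: reach.induct)
  case (step u v X Y k t Z)
  then show ?case using TpD(3)[OF step.hyps(1)] by simp
qed simp

lemma reach_snoc:
  assumes "reach k s X (u @ True # False # v) Y" "Tp (length u + length v + 2) (Suc (length u)) Y Z"
  shows "reach (Suc k) s X (u @ False # True # v) Z"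
  using assms
proof (induction k s X t\<equiv>"u @ True # False # v" Y arbitrary: rule: reach.induct)
  case (refl X)
  have "Z \<in> cl (length (u @ False # True # v))" using TpD(4)[OF refl.prems] by simp
  then show ?case using refl.prems reach.step reach.refl by blast
next
  case (step u v X Y k Z)
  then show ?case using reach.step by blast
qed

text \<open>T-inverses are symmetric, so a sequence can be read backwards. Its marks then move to
  the left, that is, the complementary marks move to the right.\<close>

lemma reach_flip: "reach k s X t Y \<Longrightarrow> reach k (map Not t) Y (map Not s) X"
proof (induction rule: reach.induct)
  case (refl X s)
  then show ?case by (simp add: reach.refl)
next
  case (step u v X Y k t Z)
  have "reach (Suc k) (map Not t) Z (map Not u @ False # True # map Not v) X"
    by (rule reach_snoc[of _ _ _ _ _ Y]) (use step Tp_sym in simp_all)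
  then show ?case by simp
qed

text \<open>All marks end up on the right, so the leftmost possible move is made at some point. It can be made
  first, because all moves made before it are at least two places further right.\<close>

lemma reach_swap:
  assumes "reach k s X t Y" "final t" "s = u @ True # False # v" "final u"
  obtains k' X' where "k = Suc k'" "Tp (length u + length v + 2) (Suc (length u)) X X'"
    "reach k' (u @ False # True # v) X' t Y"
proof -
  have "\<exists>k' X'. k = Suc k' \<and> Tp (length u + length v + 2) (Suc (length u)) X X' \<and>
      reach k' (u @ False # True # v) X' t Y"
    using assms
  proof (induction arbitrary: v rule: reach.induct)
    case (refl X s)
    then show ?case using finalD[of u "False # v"] by auto
  next
    case (step u1 v1 X X1 k t Z)
    have e: "u @ True # False # v = u1 @ True # False # v1" using step.prems by simp
    show ?case
    proof (cases "u = u1")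
      case True
      then show ?thesis using step e by auto
    next
      case False
      obtain w where w: "u1 = u @ True # False # w" "v = w @ True # False # v1"
        by (rule swap_far[OF e step.prems(3) False])
      have "u1 @ False # True # v1 = u @ True # False # (w @ False # True # v1)" using w by simp
      from step.IH[OF step.prems(1) this step.prems(3)] obtain k' X1' where
        k': "k = Suc k'" "Tp (length u + length (w @ False # True # v1) + 2) (Suc (length u)) X1 X1'"
        "reach k' (u @ False # True # (w @ False # True # v1)) X1' t Z" by blast
      let ?N = "length u + length v + 2"
      have N: "length u1 + length v1 + 2 = ?N" "length u + length (w @ False # True # v1) + 2 = ?N"
        using w by simp_all
      have T1: "Tp ?N (Suc (length u1)) X X1" using step.hyps(1) unfolding N(1) .
      have T2: "Tp ?N (Suc (length u)) X1 X1'" using k'(2) unfolding N(2) .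
      obtain X' where X': "Tp ?N (Suc (length u)) X X'" "Tp ?N (Suc (length u1)) X' X1'"
        by (rule Tp_far[OF T1 T2]) (use w in simp_all)
      have "reach (Suc k') ((u @ False # True # w) @ True # False # v1) X' t Z"
        by (rule reach.step) (use X'(2) k'(3) w in \<open>simp_all add: add.assoc\<close>)
      then show ?thesis using k'(1) X'(1) w by auto
    qed
  qed
  then show thesis using that by blast
qed

lemma reach_final:
  assumes "reach k s X t Y" "final s"
  shows "k = 0 \<and> s = t \<and> X = Y"
  using assms(1)
proof cases
  case (step u v X' k')
  then show ?thesis using finalD[of u "False # v"] assms(2) by simp
qed simp

text \<open>Both sequences can be rearranged to begin with the leftmost possible move, whose result
  is unique; the rest is induction.\<close>

lemma reach_unique:
  assumes "reach k s X t Y" "reach k' s X t Y'" "final t"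
  shows "Y = Y'"
  using assms
proof (induction k arbitrary: k' s X)
  case 0
  from 0(1) have "s = t \<and> X = Y" by cases simp
  then show ?case using reach_final[OF 0(2)] 0(3) by simp
next
  case (Suc k)
  show ?case
  proof (cases "final s")
    case True
    then show ?thesis using reach_final[OF Suc.prems(1)] by simp
  next
    case False
    then obtain u v where s: "s = u @ True # False # v" "final u" using not_final_split by blast
    obtain k0 X1 where 1: "Suc k = Suc k0" "Tp (length u + length v + 2) (Suc (length u)) X X1"
      "reach k0 (u @ False # True # v) X1 t Y"
      by (rule reach_swap[OF Suc.prems(1,3) s])
    obtain k1 X1' where 2: "k' = Suc k1" "Tp (length u + length v + 2) (Suc (length u)) X X1'"
      "reach k1 (u @ False # True # v) X1' t Y'"
      by (rule reach_swap[OF Suc.prems(2,3) s])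
    have "X1 = X1'" by (rule Tp_unique[OF 1(2) 2(2)])
    moreover have "k0 = k" using 1(1) by simp
    ultimately have "reach k (u @ False # True # v) X1 t Y" "reach k1 (u @ False # True # v) X1 t Y'"
      using 1(3) 2(3) by simp_all
    from Suc.IH[OF this Suc.prems(3)] show ?thesis .
  qed
qed

text \<open>The relational form of \<open>word_act\<close>: no description operator occurs, and
  failing invertibility means that there is no end cell.\<close>

primrec Tchain :: "nat \<Rightarrow> nat list \<Rightarrow> 'a \<Rightarrow> 'a \<Rightarrow> bool" where
  "Tchain n [] X Y \<longleftrightarrow> X = Y"
| "Tchain n (i # w) X Z \<longleftrightarrow> (\<exists>Y. Tchain n w X Y \<and> Tp n i Y Z)"

lemma T_inverse_eq: "Tp n i A B \<Longrightarrow> T_inverse C n i A = B"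
  unfolding T_inverse_def by (rule the_equality) (assumption, rule Tp_unique)

lemma word_invertible_iff_Tchain:
  "X \<in> cl n \<Longrightarrow> (word_invertible C n w X \<longleftrightarrow> (\<exists>Y. Tchain n w X Y)) \<and> (\<forall>Y. Tchain n w X Y \<longrightarrow> word_act C n w X = Y)"
proof (induction w)
  case Nil
  then show ?case by simp
next
  case (Cons i w)
  note IH1 = conjunct1[OF Cons.IH[OF Cons.prems]] and IH2 = conjunct2[OF Cons.IH[OF Cons.prems], rule_format]
  show ?case
  proof (cases "\<exists>Y. Tchain n w X Y")
    case True
    then obtain Y where Y: "Tchain n w X Y" ..
    have w: "word_invertible C n w X" using IH1 Y by blast
    have a: "word_act C n w X = Y" by (rule IH2[OF Y])
    have c: "Tchain n (i # w) X Z \<longleftrightarrow> Tp n i Y Z" for Z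
    proof
      assume "Tchain n (i # w) X Z"
      then obtain Y' where Y': "Tchain n w X Y'" "Tp n i Y' Z" by auto
      then show "Tp n i Y Z" using IH2[OF Y'(1)] a by simp
    next
      assume "Tp n i Y Z"
      with Y show "Tchain n (i # w) X Z" by auto
    qed
    have "word_invertible C n (i # w) X \<longleftrightarrow> (\<exists>B. Tp n i Y B)"
      using w a by (simp add: T_invertible_def)
    moreover have "word_act C n (i # w) X = B" if "Tp n i Y B" for B
      using T_inverse_eq[OF that] a by simp
    ultimately show ?thesis unfolding c by blast
  next
    case False
    then have "\<not> word_invertible C n w X" "\<not> Tchain n (i # w) X Y" for Y using IH1 by auto
    then show ?thesis by (simp del: Tchain.simps)
  qed
qed

lemma Tchain_snoc: "Tchain n (w @ [i]) X Z \<longleftrightarrow> (\<exists>Y. Tp n i X Y \<and> Tchain n w Y Z)"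
  by (induction w arbitrary: Z) auto

lemma reach_iff_path:
  "X \<in> cl (length s) \<Longrightarrow> (\<exists>k. reach k s X t Y) \<longleftrightarrow> (\<exists>w. path w s t \<and> Tchain (length s) w X Y)"
proof
  assume "\<exists>k. reach k s X t Y"
  then obtain k where "reach k s X t Y" ..
  then show "\<exists>w. path w s t \<and> Tchain (length s) w X Y"
  proof (induction rule: reach.induct)
    case (refl X s)
    have "path [] s s \<and> Tchain (length s) [] X X" by simp
    then show ?case by blast
  next
    case (step u v X Y k t Z)
    then obtain w where w: "path w (u @ False # True # v) t" "Tchain (length u + length v + 2) w Y Z" by auto
    have "path (w @ [Suc (length u)]) (u @ True # False # v) t" unfolding path_snoc by (rule w(1))
    moreover have "length (u @ True # False # v) = length u + length v + 2" by simp
    moreover have "Tchain (length u + length v + 2) (w @ [Suc (length u)]) X Z"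
      unfolding Tchain_snoc using step.hyps(1) w(2) by blast
    ultimately show ?case by metis
  qed
next
  assume X: "X \<in> cl (length s)" and "\<exists>w. path w s t \<and> Tchain (length s) w X Y"
  then obtain w where "path w s t" "Tchain (length s) w X Y" by blast
  then show "\<exists>k. reach k s X t Y"
  proof (induction w arbitrary: t Y)
    case Nil
    then show ?case using reach.refl X by auto
  next
    case (Cons i w)
    from Cons.prems obtain Y' u v where w: "Tchain (length s) w X Y'" "Tp (length s) i Y' Y"
      "path w s (u @ True # False # v)" "i = Suc (length u)" "t = u @ False # True # v" by auto
    then obtain k where k: "reach k s X (u @ True # False # v) Y'" using Cons.IH by blast
    have "length s = length u + length v + 2" using path_length[OF w(3)] by simp
    then have "Tp (length u + length v + 2) (Suc (length u)) Y' Y" using w(2,4) by simp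
    from reach_snoc[OF k this] show ?case unfolding w(5) by blast
  qed
qed

text \<open>This says that \<open>X\<close> is \<rho>_{n,p}-invertible and that \<open>Y\<close> is
  the result of acting by \<rho>_{n,p} on it.\<close>

definition shuffle :: "nat \<Rightarrow> nat \<Rightarrow> 'a \<Rightarrow> 'a \<Rightarrow> bool" where
  "shuffle n p X Y \<longleftrightarrow> (\<exists>k. reach k (replicate p True @ replicate n False) X (replicate n False @ replicate p True) Y)"

lemma shuffle_cl: "shuffle n p X Y \<Longrightarrow> X \<in> cl (n + p)" "shuffle n p X Y \<Longrightarrow> Y \<in> cl (n + p)"
  unfolding shuffle_def using reach_cl by (fastforce simp: add.commute)+

lemma shuffle_unique: "shuffle n p X Y \<Longrightarrow> shuffle n p X Y' \<Longrightarrow> Y = Y'"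
  unfolding shuffle_def using reach_unique final_replicate by blast

text \<open>\<rho>_{p,n} is inverse to \<rho>_{n,p}: complementing the marks turns the final list
  for one into the initial list for the other.\<close>

lemma shuffle_flip: "shuffle n p X Y \<longleftrightarrow> shuffle p n Y X"
proof -
  have "shuffle p n Y X" if sh: "shuffle n p X Y" for n p X Y
  proof -
    obtain k where "reach k (replicate p True @ replicate n False) X (replicate n False @ replicate p True) Y"
      using sh by (auto simp: shuffle_def)
    from reach_flip[OF this] show ?thesis by (auto simp: shuffle_def)
  qed
  then show ?thesis by blast
qed

lemma perm_invertible_rho:
  assumes "X \<in> cl (n + p)"
  shows "perm_invertible C (n + p) (rho n p) X \<longleftrightarrow> (\<exists>Y. shuffle n p X Y)"
proof -
  let ?s = "replicate p True @ replicate n False" and ?t = "replicate n False @ replicate p True"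
  have l: "length ?s = n + p" by simp
  have "perm_invertible C (n + p) (rho n p) X \<longleftrightarrow> (\<exists>w. path w ?s ?t \<and> (\<exists>Y. Tchain (n + p) w X Y))"
    unfolding perm_invertible_def minimal_word_iff_path using word_invertible_iff_Tchain[OF assms] by blast
  also have "\<dots> \<longleftrightarrow> (\<exists>Y. shuffle n p X Y)"
    unfolding shuffle_def using reach_iff_path[of X ?s ?t, unfolded l, OF assms] by blast
  finally show ?thesis .
qed

end

section \<open>Cubical operations along a sequence of moves\<close>

lemma mark_cases:
  assumes "t1 @ False # t2 = u @ True # False # v"
  obtains u' where "u = t1 @ False # u'" "t2 = u' @ True # False # v"
  | "t1 = u @ [True]" "t2 = v"
  | v' where "t1 = u @ True # False # v'" "v = v' @ False # t2"
  using append_swap_cases[OF assms] by metis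

lemma final_split_False:
  assumes "replicate n False @ replicate p True = t1 @ False # t2"
  shows "t1 = replicate (count_list t1 False) False" "count_list t1 False < n"
    "t2 = replicate (n - Suc (count_list t1 False)) False @ replicate p True"
proof -
  let ?i = "count_list t1 False"
  have "replicate n False @ replicate p (\<not> False) = t1 @ False # t2" using assms by simp
  from replicate_split[OF this] show t: "t1 = replicate ?i False" and i: "?i < n" by auto
  have "replicate n False = replicate ?i False @ False # replicate (n - Suc ?i) False"
    using i by (metis Suc_diff_Suc add_diff_inverse_nat not_less_iff_gr_or_eq replicate_Suc replicate_add)
  then show "t2 = replicate (n - Suc ?i) False @ replicate p True" using assms t
    by (metis append.assoc append_Cons same_append_eq list.inject)
qed

lemma final_split:
  assumes "replicate n False @ replicate p True = t1 @ t2"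
  obtains a j where "t1 = replicate a False @ replicate j True"
    "t2 = replicate (n - a) False @ replicate (p - j) True" "a \<le> n" "j \<le> p" "j = 0 \<or> a = n"
proof (cases "length t1 \<le> n")
  case True
  have "t1 = take (length t1) (replicate n False @ replicate p True)"
    "t2 = drop (length t1) (replicate n False @ replicate p True)" unfolding assms by simp_all
  then show ?thesis using True that[of "length t1" 0] by simp
next
  case False
  have "t1 = take (length t1) (replicate n False @ replicate p True)"
    "t2 = drop (length t1) (replicate n False @ replicate p True)" unfolding assms by simp_all
  moreover have "length t1 \<le> n + p" using arg_cong[OF assms, of length] by simp
  ultimately show ?thesis using False that[of n "length t1 - n"] by simp
qed

context cubical_omega_category
begin

text \<open>Unmarked directions keep their order, so the number of those in front identifies the
  direction of the face at the end. A move of a mark past this very direction disappears, since the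
  two faces coincide.\<close>

lemma reach_fc:
  assumes "reach k s X t Y" "s = s1 @ False # s2"
  shows "\<exists>t1 t2 k'. t = t1 @ False # t2 \<and> count_list t1 False = count_list s1 False \<and>
    reach k' (s1 @ s2) (fc (length s) (Suc (length s1)) \<alpha> X) (t1 @ t2) (fc (length s) (Suc (length t1)) \<alpha> Y)"
  using assms
proof (induction arbitrary: s1 s2 rule: reach.induct)
  case (refl X s)
  then have "fc (length s) (Suc (length s1)) \<alpha> X \<in> cl (length (s1 @ s2))" by simp
  then show ?case using refl.prems reach.refl by blast
next
  case (step u v X Y k t Z)
  let ?N = "Suc (length u + length v + 1)"
  note T = step.hyps(1)
  have N: "length u + length v + 2 = ?N" "length (u @ True # False # v) = ?N" "length (u @ False # True # v) = ?N"
    by simp_all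
  from step.prems[symmetric] show ?case
  proof (cases rule: mark_cases)
    case (1 u')
    have "u @ False # True # v = s1 @ False # (u' @ False # True # v)" using 1 by simp
    from step.IH[OF this] obtain t1 t2 k' where IH: "t = t1 @ False # t2" "count_list t1 False = count_list s1 False"
      "reach k' ((s1 @ u') @ False # True # v) (fc ?N (Suc (length s1)) \<alpha> Y) (t1 @ t2) (fc ?N (Suc (length t1)) \<alpha> Z)"
      unfolding N by auto
    have "Tp (length u + length v + 1) (length u) (fc ?N (Suc (length s1)) \<alpha> X) (fc ?N (Suc (length s1)) \<alpha> Y)"
      by (rule Tp_fc_less) (use T 1 in simp_all)
    then have "reach (Suc k') ((s1 @ u') @ True # False # v) (fc ?N (Suc (length s1)) \<alpha> X) (t1 @ t2) (fc ?N (Suc (length t1)) \<alpha> Z)"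
      using 1 by (intro reach.step[OF _ IH(3)]) simp
    then have "reach (Suc k') (s1 @ s2) (fc ?N (Suc (length s1)) \<alpha> X) (t1 @ t2) (fc ?N (Suc (length t1)) \<alpha> Z)"
      using 1 by simp
    then show ?thesis unfolding N using IH(1,2) by blast
  next
    case 2
    have "u @ False # True # v = u @ False # (True # v)" by simp
    from step.IH[OF this] obtain t1 t2 k' where IH: "t = t1 @ False # t2" "count_list t1 False = count_list u False"
      "reach k' (u @ True # v) (fc ?N (Suc (length u)) \<alpha> Y) (t1 @ t2) (fc ?N (Suc (length t1)) \<alpha> Z)"
      unfolding N by auto
    have "fc ?N (Suc (length u)) \<alpha> Y = fc ?N (Suc (length s1)) \<alpha> X"
      using TpD(6)[OF T] 2 by simp
    moreover have "count_list s1 False = count_list u False" "u @ True # v = s1 @ s2" using 2 by simp_all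
    ultimately show ?thesis unfolding N using IH by metis
  next
    case (3 v')
    have "u @ False # True # v = (u @ False # True # v') @ False # s2" using 3 by simp
    from step.IH[OF this] obtain t1 t2 k' where IH: "t = t1 @ False # t2" "count_list t1 False = count_list s1 False"
      "reach k' (u @ False # True # (v' @ s2)) (fc ?N (Suc (length s1)) \<alpha> Y) (t1 @ t2) (fc ?N (Suc (length t1)) \<alpha> Z)"
      unfolding N using 3 by auto
    have "Tp (length u + length v + 1) (Suc (length u)) (fc ?N (Suc (length s1)) \<alpha> X) (fc ?N (Suc (length s1)) \<alpha> Y)"
      by (rule Tp_fc_greater) (use T 3 in simp_all)
    then have "reach (Suc k') (u @ True # False # (v' @ s2)) (fc ?N (Suc (length s1)) \<alpha> X) (t1 @ t2) (fc ?N (Suc (length t1)) \<alpha> Z)"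
      using 3 by (intro reach.step[OF _ IH(3)]) simp
    then have "reach (Suc k') (s1 @ s2) (fc ?N (Suc (length s1)) \<alpha> X) (t1 @ t2) (fc ?N (Suc (length t1)) \<alpha> Z)"
      using 3 by simp
    then show ?thesis unfolding N using IH(1,2) by blast
  qed
qed

text \<open>The connection doubles an unmarked entry. A mark that passed the entry now has to pass
  both copies, which is what \<open>Tp_cn_Suc\<close> provides.\<close>

lemma reach_cn:
  assumes "reach k s X t Y" "s = s1 @ False # s2"
  shows "\<exists>t1 t2 k'. t = t1 @ False # t2 \<and> count_list t1 False = count_list s1 False \<and>
    reach k' (s1 @ False # False # s2) (cn (length s) (Suc (length s1)) \<alpha> X)
      (t1 @ False # False # t2) (cn (length s) (Suc (length t1)) \<alpha> Y)"
  using assms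
proof (induction arbitrary: s1 s2 rule: reach.induct)
  case (refl X s)
  then have "cn (length s) (Suc (length s1)) \<alpha> X \<in> cl (length (s1 @ False # False # s2))" by simp
  then show ?case using refl.prems reach.refl by blast
next
  case (step u v X Y k t Z)
  let ?N = "length u + length v + 2"
  note T = step.hyps(1)
  have N: "length (u @ True # False # v) = ?N" "length (u @ False # True # v) = ?N"
    by simp_all
  from step.prems[symmetric] show ?case
  proof (cases rule: mark_cases)
    case (1 u')
    have "u @ False # True # v = s1 @ False # (u' @ False # True # v)" using 1 by simp
    from step.IH[OF this] obtain t1 t2 k' where IH: "t = t1 @ False # t2" "count_list t1 False = count_list s1 False"
      "reach k' ((s1 @ False # False # u') @ False # True # v) (cn ?N (Suc (length s1)) \<alpha> Y) (t1 @ False # False # t2) (cn ?N (Suc (length t1)) \<alpha> Z)"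
      unfolding N by auto
    have "Tp (Suc ?N) (Suc (Suc (length u))) (cn ?N (Suc (length s1)) \<alpha> X) (cn ?N (Suc (length s1)) \<alpha> Y)"
      by (rule Tp_cn_less) (use T 1 in simp_all)
    then have "reach (Suc k') ((s1 @ False # False # u') @ True # False # v) (cn ?N (Suc (length s1)) \<alpha> X) (t1 @ False # False # t2) (cn ?N (Suc (length t1)) \<alpha> Z)"
      using 1 by (intro reach.step[OF _ IH(3)]) simp
    then have "reach (Suc k') (s1 @ False # False # s2) (cn ?N (Suc (length s1)) \<alpha> X) (t1 @ False # False # t2) (cn ?N (Suc (length t1)) \<alpha> Z)"
      using 1 by simp
    then show ?thesis unfolding N using IH(1,2) by blast
  next
    case 2
    have "u @ False # True # v = u @ False # (True # v)" by simp
    from step.IH[OF this] obtain t1 t2 k' where IH: "t = t1 @ False # t2" "count_list t1 False = count_list u False"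
      "reach k' ((u @ [False]) @ False # True # v) (cn ?N (Suc (length u)) \<alpha> Y) (t1 @ False # False # t2) (cn ?N (Suc (length t1)) \<alpha> Z)"
      unfolding N by auto
    obtain M where M: "Tp (Suc ?N) (Suc (length u)) (cn ?N (Suc (Suc (length u))) \<alpha> X) M"
      "Tp (Suc ?N) (Suc (Suc (length u))) M (cn ?N (Suc (length u)) \<alpha> Y)"
      by (rule Tp_cn_Suc[OF T])
    have "reach (Suc k') ((u @ [False]) @ True # False # v) M (t1 @ False # False # t2) (cn ?N (Suc (length t1)) \<alpha> Z)"
      by (rule reach.step[OF _ IH(3)]) (use M in simp)
    then have "reach (Suc k') (u @ False # True # (False # v)) M (t1 @ False # False # t2) (cn ?N (Suc (length t1)) \<alpha> Z)"
      by simp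
    then have "reach (Suc (Suc k')) (u @ True # False # (False # v)) (cn ?N (Suc (Suc (length u))) \<alpha> X) (t1 @ False # False # t2) (cn ?N (Suc (length t1)) \<alpha> Z)"
      by (rule reach.step[rotated]) (use M in simp)
    then have "reach (Suc (Suc k')) (s1 @ False # False # s2) (cn ?N (Suc (length s1)) \<alpha> X) (t1 @ False # False # t2) (cn ?N (Suc (length t1)) \<alpha> Z)"
      using 2 by simp
    moreover have "count_list s1 False = count_list u False" using 2 by simp
    ultimately show ?thesis unfolding N using IH by metis
  next
    case (3 v')
    have "u @ False # True # v = (u @ False # True # v') @ False # s2" using 3 by simp
    from step.IH[OF this] obtain t1 t2 k' where IH: "t = t1 @ False # t2" "count_list t1 False = count_list s1 False"
      "reach k' (u @ False # True # (v' @ False # False # s2)) (cn ?N (Suc (length s1)) \<alpha> Y) (t1 @ False # False # t2) (cn ?N (Suc (length t1)) \<alpha> Z)"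
      unfolding N using 3 by auto
    have "Tp (Suc ?N) (Suc (length u)) (cn ?N (Suc (length s1)) \<alpha> X) (cn ?N (Suc (length s1)) \<alpha> Y)"
      by (rule Tp_cn_greater) (use T 3 in simp_all)
    then have "reach (Suc k') (u @ True # False # (v' @ False # False # s2)) (cn ?N (Suc (length s1)) \<alpha> X) (t1 @ False # False # t2) (cn ?N (Suc (length t1)) \<alpha> Z)"
      using 3 by (intro reach.step[OF _ IH(3)]) simp
    then have "reach (Suc k') (s1 @ False # False # s2) (cn ?N (Suc (length s1)) \<alpha> X) (t1 @ False # False # t2) (cn ?N (Suc (length t1)) \<alpha> Z)"
      using 3 by simp
    then show ?thesis unfolding N using IH(1,2) by blast
  qed
qed

text \<open>A new unmarked entry is inserted into a gap. A mark that crosses the gap must also pass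
  the new entry, where T_i takes \<epsilon>_{i+1} to \<epsilon>_i. The count determines the final
  gap only up to marks next to it.\<close>

lemma reach_dg:
  assumes "reach k s X t Y" "s = s1 @ s2"
  shows "\<exists>t1 t2 k'. t = t1 @ t2 \<and> count_list t1 False = count_list s1 False \<and>
    reach k' (s1 @ False # s2) (dg (length s) (Suc (length s1)) X) (t1 @ False # t2) (dg (length s) (Suc (length t1)) Y)"
  using assms
proof (induction arbitrary: s1 s2 rule: reach.induct)
  case (refl X s)
  then have "dg (length s) (Suc (length s1)) X \<in> cl (length (s1 @ False # s2))" by simp
  then show ?case using refl.prems reach.refl by blast
next
  case (step u v X Y k t Z)
  let ?N = "length u + length v + 2"
  note T = step.hyps(1)
  have N: "length (u @ True # False # v) = ?N" "length (u @ False # True # v) = ?N"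
    by simp_all
  from step.prems[symmetric] show ?case
  proof (cases rule: insert_swap_cases)
    case (1 u')
    have "u @ False # True # v = s1 @ (u' @ False # True # v)" using 1 by simp
    from step.IH[OF this] obtain t1 t2 k' where IH: "t = t1 @ t2" "count_list t1 False = count_list s1 False"
      "reach k' ((s1 @ False # u') @ False # True # v) (dg ?N (Suc (length s1)) Y) (t1 @ False # t2) (dg ?N (Suc (length t1)) Z)"
      unfolding N by auto
    have "Tp (Suc ?N) (Suc (Suc (length u))) (dg ?N (Suc (length s1)) X) (dg ?N (Suc (length s1)) Y)"
      by (rule Tp_dg_le) (use T 1 in simp_all)
    then have "reach (Suc k') ((s1 @ False # u') @ True # False # v) (dg ?N (Suc (length s1)) X) (t1 @ False # t2) (dg ?N (Suc (length t1)) Z)"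
      using 1 by (intro reach.step[OF _ IH(3)]) simp
    then have "reach (Suc k') (s1 @ False # s2) (dg ?N (Suc (length s1)) X) (t1 @ False # t2) (dg ?N (Suc (length t1)) Z)"
      using 1 by simp
    then show ?thesis unfolding N using IH(1,2) by blast
  next
    case 2
    have "u @ False # True # v = u @ (False # True # v)" by simp
    from step.IH[OF this] obtain t1 t2 k' where IH: "t = t1 @ t2" "count_list t1 False = count_list u False"
      "reach k' ((u @ [False]) @ False # True # v) (dg ?N (Suc (length u)) Y) (t1 @ False # t2) (dg ?N (Suc (length t1)) Z)"
      unfolding N by auto
    have "Tp (Suc ?N) (Suc (Suc (length u))) (dg ?N (Suc (length u)) X) (dg ?N (Suc (length u)) Y)"
      by (rule Tp_dg_le) (use T in simp_all)
    then have "reach (Suc k') ((u @ [False]) @ True # False # v) (dg ?N (Suc (length u)) X) (t1 @ False # t2) (dg ?N (Suc (length t1)) Z)"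
      by (intro reach.step[OF _ IH(3)]) simp
    then have r: "reach (Suc k') (u @ False # True # (False # v)) (dg ?N (Suc (length u)) X) (t1 @ False # t2) (dg ?N (Suc (length t1)) Z)"
      by simp
    have "Tp (Suc ?N) (Suc (length u)) (dg ?N (Suc (Suc (length u))) X) (dg ?N (Suc (length u)) X)"
      using Tp_sym[OF Tp_dg[of "Suc (length u)" "length u + length v + 1" X]] TpD(3)[OF T] by simp
    then have "reach (Suc (Suc k')) (u @ True # False # (False # v)) (dg ?N (Suc (Suc (length u))) X) (t1 @ False # t2) (dg ?N (Suc (length t1)) Z)"
      by (intro reach.step[OF _ r]) simp
    then have "reach (Suc (Suc k')) (s1 @ False # s2) (dg ?N (Suc (length s1)) X) (t1 @ False # t2) (dg ?N (Suc (length t1)) Z)"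
      using 2 by simp
    moreover have "count_list s1 False = count_list u False" using 2 by simp
    ultimately show ?thesis unfolding N using IH by metis
  next
    case (3 v')
    have "u @ False # True # v = (u @ False # True # v') @ s2" using 3 by simp
    from step.IH[OF this] obtain t1 t2 k' where IH: "t = t1 @ t2" "count_list t1 False = count_list s1 False"
      "reach k' (u @ False # True # (v' @ False # s2)) (dg ?N (Suc (length s1)) Y) (t1 @ False # t2) (dg ?N (Suc (length t1)) Z)"
      unfolding N using 3 by auto
    have "Tp (Suc ?N) (Suc (length u)) (dg ?N (Suc (length s1)) X) (dg ?N (Suc (length s1)) Y)"
      by (rule Tp_dg_greater) (use T 3 in simp_all)
    then have "reach (Suc k') (u @ True # False # (v' @ False # s2)) (dg ?N (Suc (length s1)) X) (t1 @ False # t2) (dg ?N (Suc (length t1)) Z)"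
      using 3 by (intro reach.step[OF _ IH(3)]) simp
    then have "reach (Suc k') (s1 @ False # s2) (dg ?N (Suc (length s1)) X) (t1 @ False # t2) (dg ?N (Suc (length t1)) Z)"
      using 3 by simp
    then show ?thesis unfolding N using IH(1,2) by blast
  qed
qed

text \<open>Settles the ambiguity left by \<open>reach_dg\<close>: marks standing directly before
  the new entry are moved past it one by one, each taking \<epsilon>_{i+1} to \<epsilon>_i.\<close>

lemma reach_dg_move:
  assumes "reach k s X (a @ replicate j True @ False # c) (dg m (Suc (length a + j)) Y)"
    "Y \<in> cl m" "m = length a + j + length c"
  shows "\<exists>k'. reach k' s X (a @ False # replicate j True @ c) (dg m (Suc (length a)) Y)"
  using assms
proof (induction j arbitrary: k c)
  case 0
  then show ?case by auto
next
  case (Suc j)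
  obtain m' where m: "m = Suc m'" using Suc.prems(3) by simp
  have r: "reach k s X ((a @ replicate j True) @ True # False # c) (dg m (Suc (Suc (length a + j))) Y)"
    using Suc.prems(1) by (simp flip: replicate_append_same)
  have "Tp (Suc m) (Suc (length a + j)) (dg m (Suc (Suc (length a + j))) Y) (dg m (Suc (length a + j)) Y)"
    using Tp_sym[OF Tp_dg[of "Suc (length a + j)" m' Y]] Suc.prems(2,3) m by simp
  then have "reach (Suc k) s X ((a @ replicate j True) @ False # True # c) (dg m (Suc (length a + j)) Y)"
    using Suc.prems(3) by (intro reach_snoc[OF r]) simp
  then have "reach (Suc k) s X (a @ replicate j True @ False # (True # c)) (dg m (Suc (length a + j)) Y)" by simp
  from Suc.IH[OF this Suc.prems(2)] Suc.prems(3) show ?case by (simp add: replicate_app_Cons_same)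
qed

text \<open>To be composed, the two sequences must make the same moves; by \<open>reach_swap\<close>
  both can begin with the leftmost one. This is where \<open>final t\<close> enters.\<close>

lemma reach_cp:
  assumes "reach k s X t Y" "reach k' s X' t Y'" "final t" "s = s1 @ False # s2"
    "fc (length s) (Suc (length s1)) Plus X = fc (length s) (Suc (length s1)) Minus X'"
  shows "\<exists>t1 t2. t = t1 @ False # t2 \<and> count_list t1 False = count_list s1 False \<and>
    reach k s (cp (length s) (Suc (length s1)) X X') t (cp (length s) (Suc (length t1)) Y Y')"
  using assms
proof (induction k arbitrary: k' s X X' s1 s2)
  case 0
  from 0(1) have e: "s = t \<and> X = Y" by cases simp
  have X': "X' = Y'" using reach_final[OF 0(2)] 0(3) e by simp
  have "X \<in> cl (length s)" "X' \<in> cl (length s)" using reach_cl 0(1,2) by blast+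
  then have "cp (length s) (Suc (length s1)) X X' \<in> cl (length s)" using 0(4,5) by simp
  then show ?case using e X' 0(4) reach.refl by blast
next
  case (Suc k)
  show ?case
  proof (cases "final s")
    case True
    then show ?thesis using reach_final[OF Suc.prems(1)] by simp
  next
    case False
    then obtain u v where s: "s = u @ True # False # v" "final u" using not_final_split by blast
    let ?N = "length u + length v + 2"
    have N: "length (u @ True # False # v) = ?N" "length (u @ False # True # v) = ?N" "length s = ?N"
      using s by simp_all
    obtain k0 X1 where 1: "Suc k = Suc k0" "Tp ?N (Suc (length u)) X X1" "reach k0 (u @ False # True # v) X1 t Y"
      by (rule reach_swap[OF Suc.prems(1,3) s])
    then have r1: "reach k (u @ False # True # v) X1 t Y" by simp
    obtain k1 X1' where 2: "k' = Suc k1" "Tp ?N (Suc (length u)) X' X1'" "reach k1 (u @ False # True # v) X1' t Y'"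
      by (rule reach_swap[OF Suc.prems(2,3) s])
    note e = Suc.prems(5)[unfolded N(3)]
    have "\<exists>r1 r2. u @ False # True # v = r1 @ False # r2 \<and> count_list r1 False = count_list s1 False \<and>
      fc ?N (Suc (length r1)) Plus X1 = fc ?N (Suc (length r1)) Minus X1' \<and>
      Tp ?N (Suc (length u)) (cp ?N (Suc (length s1)) X X') (cp ?N (Suc (length r1)) X1 X1')"
    proof -
      have "s1 @ False # s2 = u @ True # False # v" using Suc.prems(4) s by simp
      then show ?thesis
      proof (cases rule: mark_cases)
        case (1 u')
        note A = 1
        have "fc ?N (Suc (length s1)) Plus X1 = fc ?N (Suc (length s1)) Minus X1'"
          by (rule Tp_fc_eq[OF \<open>Tp ?N (Suc (length u)) X X1\<close> 2(2) _ _ _ _ e]) (use A in simp_all)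
        moreover have "Tp ?N (Suc (length u)) (cp ?N (Suc (length s1)) X X') (cp ?N (Suc (length s1)) X1 X1')"
          by (rule Tp_cp[OF \<open>Tp ?N (Suc (length u)) X X1\<close> 2(2) _ _ _ _ e]) (use A in simp_all)
        moreover have "u @ False # True # v = s1 @ False # (u' @ False # True # v)" using A by simp
        ultimately show ?thesis by blast
      next
        case A: 2
        have l: "Suc (length s1) = Suc (Suc (length u))" using A by simp
        have "fc ?N (Suc (length u)) Plus X1 = fc ?N (Suc (length u)) Minus X1'"
          using e TpD(6)[OF 1(2)] TpD(6)[OF 2(2)] unfolding l by metis
        moreover have "Tp ?N (Suc (length u)) (cp ?N (Suc (length s1)) X X') (cp ?N (Suc (length u)) X1 X1')"
          using Tp_hc[of "Suc (length u)" "length u + length v" X X1 X' X1'] 1(2) 2(2) e unfolding l by simp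
        moreover have "u @ False # True # v = u @ False # (True # v)" "count_list u False = count_list s1 False" using A by simp_all
        ultimately show ?thesis by blast
      next
        case (3 v')
        note A = 3
        have "fc ?N (Suc (length s1)) Plus X1 = fc ?N (Suc (length s1)) Minus X1'"
          by (rule Tp_fc_eq[OF \<open>Tp ?N (Suc (length u)) X X1\<close> 2(2) _ _ _ _ e]) (use A in simp_all)
        moreover have "Tp ?N (Suc (length u)) (cp ?N (Suc (length s1)) X X') (cp ?N (Suc (length s1)) X1 X1')"
          by (rule Tp_cp[OF \<open>Tp ?N (Suc (length u)) X X1\<close> 2(2) _ _ _ _ e]) (use A in simp_all)
        moreover have "u @ False # True # v = (u @ False # True # v') @ False # s2"
          "length (u @ False # True # v') = length s1" "count_list (u @ False # True # v') False = count_list s1 False"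
          using A by simp_all
        ultimately show ?thesis by metis
      qed
    qed
    then obtain q1 q2 where q: "u @ False # True # v = q1 @ False # q2" "count_list q1 False = count_list s1 False"
      "fc ?N (Suc (length q1)) Plus X1 = fc ?N (Suc (length q1)) Minus X1'"
      "Tp ?N (Suc (length u)) (cp ?N (Suc (length s1)) X X') (cp ?N (Suc (length q1)) X1 X1')" by blast
    from Suc.IH[OF r1 2(3) Suc.prems(3) q(1)] q(3) obtain t1 t2 where t: "t = t1 @ False # t2"
      "count_list t1 False = count_list q1 False"
      "reach k (u @ False # True # v) (cp ?N (Suc (length q1)) X1 X1') t (cp ?N (Suc (length t1)) Y Y')"
      unfolding N by blast
    have "reach (Suc k) (u @ True # False # v) (cp ?N (Suc (length s1)) X X') t (cp ?N (Suc (length t1)) Y Y')"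
      by (rule reach.step[OF q(4) t(3)])
    then show ?thesis using t q(2) unfolding N s(1) by metis
  qed
qed

lemma count_list_replicate_same: "count_list (replicate n x) y = (if x = y then n else 0)"
  by (induction n) auto

lemma replicate_split_at: "j < n \<Longrightarrow> replicate n x = replicate j x @ x # replicate (n - Suc j) x"
  by (metis Suc_diff_Suc add_diff_inverse_nat not_less_iff_gr_or_eq replicate_Suc replicate_add)

lemma shuffle_fc:
  assumes "shuffle (Suc n) p X Y" "1 \<le> i" "i \<le> Suc n"
  shows "shuffle n p (fc (Suc n + p) (p + i) \<alpha> X) (fc (Suc n + p) i \<alpha> Y)"
proof -
  let ?s = "replicate p True @ replicate (Suc n) False" and ?t = "replicate (Suc n) False @ replicate p True"
  obtain j where j: "i = Suc j" "j < Suc n" using assms by (cases i) auto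
  obtain k where k: "reach k ?s X ?t Y" using assms(1) by (auto simp: shuffle_def)
  let ?s1 = "replicate p True @ replicate j False"
  have s: "?s = ?s1 @ False # replicate (n - j) False" using replicate_split_at[OF j(2)] by simp
  have c: "count_list ?s1 False = j" by (simp add: count_list_replicate_same)
  obtain t1 t2 k' where t: "?t = t1 @ False # t2" "count_list t1 False = j"
    "reach k' (?s1 @ replicate (n - j) False) (fc (Suc n + p) (p + i) \<alpha> X) (t1 @ t2) (fc (Suc n + p) (Suc (length t1)) \<alpha> Y)"
    using reach_fc[OF k s, of \<alpha>] unfolding c using j by (auto simp: add.commute)
  have t1: "t1 = replicate j False" and t2: "t2 = replicate (n - j) False @ replicate p True"
    using final_split_False[OF t(1)] t(2) by auto
  have n: "replicate j False @ replicate (n - j) False = replicate n False"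
    using j by (simp flip: replicate_add)
  have "?s1 @ replicate (n - j) False = replicate p True @ replicate n False"
    "t1 @ t2 = replicate n False @ replicate p True" unfolding n[symmetric] t1 t2 by simp_all
  then show ?thesis using t(3) t1 j unfolding shuffle_def by auto
qed

lemma shuffle_cn:
  assumes "shuffle n p X Y" "1 \<le> i" "i \<le> n"
  shows "shuffle (Suc n) p (cn (n + p) (p + i) \<alpha> X) (cn (n + p) i \<alpha> Y)"
proof -
  let ?s = "replicate p True @ replicate n False" and ?t = "replicate n False @ replicate p True"
  obtain j where j: "i = Suc j" "j < n" using assms by (cases i) auto
  obtain k where k: "reach k ?s X ?t Y" using assms(1) by (auto simp: shuffle_def)
  let ?s1 = "replicate p True @ replicate j False"
  have s: "?s = ?s1 @ False # replicate (n - Suc j) False" using replicate_split_at[OF j(2)] by simp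
  have c: "count_list ?s1 False = j" by (simp add: count_list_replicate_same)
  obtain t1 t2 k' where t: "?t = t1 @ False # t2" "count_list t1 False = j"
    "reach k' (?s1 @ False # False # replicate (n - Suc j) False) (cn (n + p) (p + i) \<alpha> X)
      (t1 @ False # False # t2) (cn (n + p) (Suc (length t1)) \<alpha> Y)"
    using reach_cn[OF k s, of \<alpha>] unfolding c using j by (auto simp: add.commute)
  have t1: "t1 = replicate j False" and t2: "t2 = replicate (n - Suc j) False @ replicate p True"
    using final_split_False[OF t(1)] t(2) by auto
  have "replicate j False @ False # False # replicate (n - Suc j) False = replicate (Suc n) False"
    using replicate_split_at[OF j(2), of False] by (simp add: replicate_app_Cons_same)
  then have "?s1 @ False # False # replicate (n - Suc j) False = replicate p True @ replicate (Suc n) False"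
    "t1 @ False # False # t2 = replicate (Suc n) False @ replicate p True" using t1 t2 by simp_all
  then show ?thesis using t(3) t1 j unfolding shuffle_def by auto
qed

lemma shuffle_dg:
  assumes "shuffle n p X Y" "1 \<le> i" "i \<le> Suc n"
  shows "shuffle (Suc n) p (dg (n + p) (p + i) X) (dg (n + p) i Y)"
proof -
  let ?s = "replicate p True @ replicate n False" and ?t = "replicate n False @ replicate p True"
  obtain j where j: "i = Suc j" "j \<le> n" using assms by (cases i) auto
  obtain k where k: "reach k ?s X ?t Y" using assms(1) by (auto simp: shuffle_def)
  let ?s1 = "replicate p True @ replicate j False"
  have n: "replicate j False @ replicate (n - j) False = replicate n False"
    using j by (simp flip: replicate_add)
  then have n': "replicate j False @ replicate (n - j) False @ x = replicate n False @ x" for x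
    by (metis append_assoc)
  have s: "?s = ?s1 @ replicate (n - j) False" by (simp add: n)
  have c: "count_list ?s1 False = j" by (simp add: count_list_replicate_same)
  obtain t1 t2 k' where t: "?t = t1 @ t2" "count_list t1 False = j"
    "reach k' (?s1 @ False # replicate (n - j) False) (dg (n + p) (p + i) X)
      (t1 @ False # t2) (dg (n + p) (Suc (length t1)) Y)"
    using reach_dg[OF k s] unfolding c using j by (auto simp: add.commute)
  obtain a l where l: "t1 = replicate a False @ replicate l True"
    "t2 = replicate (n - a) False @ replicate (p - l) True" "a \<le> n" "l \<le> p" "l = 0 \<or> a = n"
    by (rule final_split[OF t(1)])
  have a: "a = j" using t(2) l(1) by (simp add: count_list_replicate_same)
  have Y: "Y \<in> cl (n + p)" using shuffle_cl(2)[OF assms(1)] .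
  \<comment> \<open>The new entry may have ended behind \<open>l\<close> of the marks; it is brought
    in front of them.\<close>
  obtain k'' where r: "reach k'' (?s1 @ False # replicate (n - j) False) (dg (n + p) (p + i) X)
      (replicate j False @ False # replicate l True @ t2) (dg (n + p) (Suc j) Y)"
  proof -
    have r: "reach k' (?s1 @ False # replicate (n - j) False) (dg (n + p) (p + i) X)
      (replicate j False @ replicate l True @ False # t2) (dg (n + p) (Suc (length (replicate j False) + l)) Y)"
      using t(3) unfolding l(1) a by simp
    have "n + p = length (replicate j False) + l + length t2"
      unfolding l(2) a using l(4) j(2) by simp
    from reach_dg_move[OF r Y this] show ?thesis using that by auto
  qed
  have "?s1 @ False # replicate (n - j) False = replicate p True @ replicate (Suc n) False"
    by (simp add: replicate_app_Cons_same n)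
  moreover have "replicate j False @ False # replicate l True @ t2 = replicate (Suc n) False @ replicate p True"
  proof (cases "l = 0")
    case True
    then show ?thesis unfolding l(2) a by (simp add: replicate_app_Cons_same n')
  next
    case False
    then have jn: "j = n" using l(5) a by simp
    then have "t2 = replicate (p - l) True" unfolding l(2) a by simp
    moreover have "replicate l True @ replicate (p - l) True = replicate p True" using l(4) by (simp flip: replicate_add)
    ultimately show ?thesis unfolding jn by (simp add: replicate_app_Cons_same)
  qed
  ultimately show ?thesis using r j(1) unfolding shuffle_def by auto
qed

lemma shuffle_cp:
  assumes "shuffle n p X Y" "shuffle n p X' Y'" "1 \<le> i" "i \<le> n"
    "fc (n + p) (p + i) Plus X = fc (n + p) (p + i) Minus X'"
  shows "shuffle n p (cp (n + p) (p + i) X X') (cp (n + p) i Y Y')"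
proof -
  let ?s = "replicate p True @ replicate n False" and ?t = "replicate n False @ replicate p True"
  obtain j where j: "i = Suc j" "j < n" using assms by (cases i) auto
  obtain k where k: "reach k ?s X ?t Y" using assms(1) by (auto simp: shuffle_def)
  obtain l where l: "reach l ?s X' ?t Y'" using assms(2) by (auto simp: shuffle_def)
  let ?s1 = "replicate p True @ replicate j False"
  have s: "?s = ?s1 @ False # replicate (n - Suc j) False" using replicate_split_at[OF j(2)] by simp
  have c: "count_list ?s1 False = j" by (simp add: count_list_replicate_same)
  have m: "length ?s = n + p" "Suc (length ?s1) = p + i" using j by simp_all
  from reach_cp[OF k l final_replicate s, unfolded c m, OF assms(5)]
  obtain t1 t2 where t: "?t = t1 @ False # t2" "count_list t1 False = j"
    "reach k ?s (cp (n + p) (p + i) X X') ?t (cp (n + p) (Suc (length t1)) Y Y')" by blast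
  have t1: "t1 = replicate j False" using final_split_False[OF t(1)] t(2) by auto
  then show ?thesis using t(3) j unfolding shuffle_def by auto
qed

text \<open>\<open>shuffle_flip\<close> makes marked directions unmarked and so reduces operations
  on transfors to the cases already treated.\<close>

lemma shuffle_fc_mark:
  assumes "shuffle n (Suc p) X Y" "1 \<le> i" "i \<le> Suc p"
  shows "shuffle n p (fc (n + Suc p) i \<alpha> X) (fc (n + Suc p) (n + i) \<alpha> Y)"
  using shuffle_fc[of p n Y X i \<alpha>] assms shuffle_flip[of n "Suc p" X Y]
    shuffle_flip[of n p "fc (n + Suc p) i \<alpha> X"] by (simp add: add.commute)

lemma shuffle_cn_mark:
  assumes "shuffle n p X Y" "1 \<le> i" "i \<le> p"
  shows "shuffle n (Suc p) (cn (n + p) i \<alpha> X) (cn (n + p) (n + i) \<alpha> Y)"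
  using shuffle_cn[of p n Y X i \<alpha>] assms shuffle_flip[of n p X Y]
    shuffle_flip[of n "Suc p" "cn (n + p) i \<alpha> X"] by (simp add: add.commute)

lemma shuffle_dg_mark:
  assumes "shuffle n p X Y" "1 \<le> i" "i \<le> Suc p"
  shows "shuffle n (Suc p) (dg (n + p) i X) (dg (n + p) (n + i) Y)"
  using shuffle_dg[of p n Y X i] assms shuffle_flip[of n p X Y]
    shuffle_flip[of n "Suc p" "dg (n + p) i X"] by (simp add: add.commute)

lemma shuffle_cp_mark:
  assumes S: "shuffle n p X Y" "shuffle n p X' Y'" and i: "1 \<le> i" "i \<le> p"
    and e: "fc (n + p) i Plus X = fc (n + p) i Minus X'"
  shows "shuffle n p (cp (n + p) i X X') (cp (n + p) (n + i) Y Y')"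
proof -
  obtain q where q: "p = Suc q" using i by (cases p) auto
  have "fc (n + p) (n + i) Plus Y = fc (n + p) (n + i) Minus Y'"
    using shuffle_fc_mark[of n q X Y i Plus] shuffle_fc_mark[of n q X' Y' i Minus] S i e shuffle_unique
    unfolding q by metis
  then show ?thesis
    using shuffle_cp[of p n Y X Y' X' i] S i shuffle_flip[of n p X Y] shuffle_flip[of n p X' Y']
      shuffle_flip[of n p "cp (n + p) i X X'"] by (simp add: add.commute)
qed

lemma shuffle_inj: "shuffle n p X Y \<Longrightarrow> shuffle n p X' Y \<Longrightarrow> X = X'"
  using shuffle_unique shuffle_flip by blast

lemma perm_invertible_rho_swap:
  assumes "Y \<in> cl (n + p)"
  shows "perm_invertible C (n + p) (rho p n) Y \<longleftrightarrow> (\<exists>X. shuffle n p X Y)"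
  using perm_invertible_rho[of Y p n] assms shuffle_flip[of n p _ Y] by (simp add: add.commute)

end

section \<open>Transfors\<close>

text \<open>\<open>shifted D d e\<close> forgets \<open>d\<close> directions of the cells of \<open>D\<close>, namely the first \<open>e\<close> and the last \<open>d - e\<close>.\<close>

definition shifted :: "'a cubical \<Rightarrow> nat \<Rightarrow> nat \<Rightarrow> 'a cubical" where
  "shifted D d e = \<lparr>cells = (\<lambda>p. cells D (d + p)), face = (\<lambda>p i. face D (d + p) (e + i)),
     degen = (\<lambda>p i. degen D (d + p) (e + i)), conn = (\<lambda>p i. conn D (d + p) (e + i)),
     cube_comp = (\<lambda>p i. cube_comp D (d + p) (e + i))\<rparr>"

lemma shifted_sel [simp]:
  "cells (shifted D d e) p = cells D (d + p)" "face (shifted D d e) p i = face D (d + p) (e + i)"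
  "degen (shifted D d e) p i = degen D (d + p) (e + i)" "conn (shifted D d e) p i = conn D (d + p) (e + i)"
  "cube_comp (shifted D d e) p i = cube_comp D (d + p) (e + i)"
  by (simp_all add: shifted_def)

lemma down_add: "i \<noteq> j \<Longrightarrow> down (e + i) (e + j) = e + down i j"
  by (auto simp: down_def)

lemma up_add: "up (e + i) (e + j) = e + up i j"
  by (auto simp: up_def)

lemma composable_shifted: "e \<le> d \<Longrightarrow> composable (shifted D d e) p i A B \<Longrightarrow> composable D (d + p) (e + i) A B"
  by (auto simp: composable_def)

context cubical_omega_category
begin

lemma cubical_omega_category_shifted:
  assumes e: "e \<le> d"
  shows "cubical_omega_category (shifted C d e)"
proof -
  note c = composable_shifted[OF e]
  have m: "d + (p - 1) = d + p - 1" if "1 \<le> i" "i \<le> p" for p i :: nat using that by simp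
  have m': "e + (p - 1) = e + p - 1" if "1 \<le> p" for p :: nat using that by simp
  show ?thesis
  proof (unfold_locales, goal_cases)
    case (1 A n i \<alpha>) then show ?case using face_cell[of A "d + n" "e + i" \<alpha>] e by (simp add: m)
  next
    case (2 A n i) then show ?case using degen_cell[of A "d + n" "e + i"] e by simp
  next
    case (3 A n i \<alpha>) then show ?case using conn_cell[of A "d + n" "e + i" \<alpha>] e by simp
  next
    case (4 n i A B) then show ?case using comp_cell[OF c[OF 4]] by simp
  next
    case (5 A n i j \<alpha> \<beta>) then show ?case using face_face[of A "d + n" "e + i" "e + j" \<alpha> \<beta>] e by simp
  next
    case (6 A n i j \<alpha>)
    then have "1 \<le> n" by linarith
    then show ?case using face_degen[of A "d + n" "e + i" "e + j" \<alpha>] e 6 by (simp add: down_add)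
  next
    case (7 A n i \<alpha>) then show ?case using face_degen_same[of A "d + n" "e + i" \<alpha>] e by simp
  next
    case (8 A n i j \<alpha> \<beta>)
    then have "1 \<le> n" by linarith
    then show ?case using face_conn[of A "d + n" "e + i" "e + j" \<alpha> \<beta>] e 8 by (simp add: down_add)
  next
    case (9 A n j i \<alpha>) then show ?case using face_conn_same[of A "d + n" "e + j" "e + i" \<alpha>] e by auto
  next
    case (10 A n j i \<beta> \<alpha>)
    then have "1 \<le> n" by linarith
    then show ?case using face_conn_opposite[of A "d + n" "e + j" "e + i" \<beta> \<alpha>] e 10 by auto
  next
    case (11 A n i j) then show ?case using degen_degen[of A "d + n" "e + i" "e + j"] e by simp
  next
    case (12 A n i j \<alpha> \<beta>) then show ?case using conn_conn[of A "d + n" "e + i" "e + j" \<alpha> \<beta>] e by simp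
  next
    case (13 A n i \<alpha>) then show ?case using conn_conn_same[of A "d + n" "e + i" \<alpha>] e by simp
  next
    case (14 A n i j \<alpha>) then show ?case using conn_degen[of A "d + n" "e + i" "e + j" \<alpha>] e by (simp add: down_add up_add)
  next
    case (15 A n i \<alpha>) then show ?case using conn_degen_same[of A "d + n" "e + i" \<alpha>] e by simp
  next
    case (16 n j A B i \<alpha>)
    then have "1 \<le> n" by linarith
    then show ?case using face_comp[OF c[OF 16(1)], of "e + i" \<alpha>] e 16 by (simp add: down_add)
  next
    case (17 n i A B) then show ?case using face_comp_Minus[OF c[OF 17]] by simp
  next
    case (18 n i A B) then show ?case using face_comp_Plus[OF c[OF 18]] by simp
  next
    case (19 n i A B E) then show ?case using comp_assoc[OF c[OF 19(1)] c[OF 19(2)]] by simp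
  next
    case (20 A n i) then show ?case using comp_degen_right[of A "d + n" "e + i"] e by (simp add: m)
  next
    case (21 A n i) then show ?case using comp_degen_left[of A "d + n" "e + i"] e by (simp add: m)
  next
    case (22 n i A B E F j)
    then show ?case using interchange[OF c[OF 22(1)] c[OF 22(2)] c[OF 22(3)] c[OF 22(4)]] by simp
  next
    case (23 n j A B i) then show ?case using degen_comp[OF c[OF 23(1)], of "e + i"] e by (simp add: up_add)
  next
    case (24 n j A B i \<alpha>) then show ?case using conn_comp[OF c[OF 24(1)], of "e + i" \<alpha>] e by (simp add: up_add)
  next
    case (25 n i A B) then show ?case using conn_comp_Minus[OF c[OF 25]] by simp
  next
    case (26 n i A B) then show ?case using conn_comp_Plus[OF c[OF 26]] by simp
  next
    case (27 A n i) then show ?case using conn_transport[of A "d + n" "e + i"] e by simp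
  next
    case (28 A n i) then show ?case using conn_transport_Suc[of A "d + n" "e + i"] e by simp
  qed
qed

end

text \<open>The common form of \<open>PsLax\<close> and \<open>PsOpLax\<close>: values at cells of
  dimension n are operated on in \<open>S n\<close>, and \<open>K\<close> selects the
  transfors.\<close>

definition pointwise :: "'a cubical \<Rightarrow> (nat \<Rightarrow> 'b cubical) \<Rightarrow> (nat \<Rightarrow> (nat \<Rightarrow> 'a \<Rightarrow> 'b) set) \<Rightarrow> (nat \<Rightarrow> 'a \<Rightarrow> 'b) cubical" where
  "pointwise C S K = \<lparr>cells = K,
     face = (\<lambda>p i \<alpha> F n. \<lambda>A \<in> cells C n. face (S n) p i \<alpha> (F n A)),
     degen = (\<lambda>p i F n. \<lambda>A \<in> cells C n. degen (S n) p i (F n A)),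
     conn = (\<lambda>p i \<alpha> F n. \<lambda>A \<in> cells C n. conn (S n) p i \<alpha> (F n A)),
     cube_comp = (\<lambda>p i F G n. \<lambda>A \<in> cells C n. cube_comp (S n) p i (F n A) (G n A))\<rparr>"

lemma cells_pointwise [simp]: "cells (pointwise C S K) = K"
  by (simp add: pointwise_def)

lemma pointwise_apply:
  assumes "A \<in> cells C n"
  shows "face (pointwise C S K) p i \<alpha> F n A = face (S n) p i \<alpha> (F n A)"
    "degen (pointwise C S K) p i F n A = degen (S n) p i (F n A)"
    "conn (pointwise C S K) p i \<alpha> F n A = conn (S n) p i \<alpha> (F n A)"
    "cube_comp (pointwise C S K) p i F G n A = cube_comp (S n) p i (F n A) (G n A)"
  using assms by (simp_all add: pointwise_def)

lemma pointwise_undefined: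
  assumes "A \<notin> cells C n"
  shows "face (pointwise C S K) p i \<alpha> F n A = undefined"
    "degen (pointwise C S K) p i F n A = undefined"
    "conn (pointwise C S K) p i \<alpha> F n A = undefined"
    "cube_comp (pointwise C S K) p i F G n A = undefined"
  using assms by (simp_all add: pointwise_def)

lemma composable_pointwise:
  assumes "composable (pointwise C S K) p i F G" "A \<in> cells C n" "\<And>p F. F \<in> K p \<Longrightarrow> F n A \<in> cells (S n) p"
  shows "composable (S n) p i (F n A) (G n A)"
proof -
  have FG: "1 \<le> i" "i \<le> p" "F \<in> K p" "G \<in> K p"
    and eq: "face (pointwise C S K) p i Plus F = face (pointwise C S K) p i Minus G"
    using assms(1) unfolding composable_def cells_pointwise by blast+
  have "face (S n) p i Plus (F n A) = face (S n) p i Minus (G n A)"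
    using fun_cong[OF fun_cong[OF eq, of n], of A] unfolding pointwise_apply[OF assms(2)] .
  then show ?thesis
    unfolding composable_def using FG assms(3) by blast
qed

text \<open>Each equation holds argument by argument in \<open>S n\<close>. Outside the cells of
  \<open>C\<close> both sides are \<open>undefined\<close>; where one side is a bare transfor, this
  is its extensionality.\<close>

lemma cubical_omega_category_pointwise:
  fixes C :: "'a cubical" and S :: "nat \<Rightarrow> 'b cubical"
  assumes S: "\<And>n. cubical_omega_category (S n)"
    and K: "\<And>p F n. F \<in> K p \<Longrightarrow> F n \<in> cells C n \<rightarrow>\<^sub>E cells (S n) p"
    and cl: "\<And>p i \<alpha> F. \<lbrakk>F \<in> K p; 1 \<le> i; i \<le> p\<rbrakk> \<Longrightarrow> face (pointwise C S K) p i \<alpha> F \<in> K (p - 1)"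
      "\<And>p i F. \<lbrakk>F \<in> K p; 1 \<le> i; i \<le> p + 1\<rbrakk> \<Longrightarrow> degen (pointwise C S K) p i F \<in> K (p + 1)"
      "\<And>p i \<alpha> F. \<lbrakk>F \<in> K p; 1 \<le> i; i \<le> p\<rbrakk> \<Longrightarrow> conn (pointwise C S K) p i \<alpha> F \<in> K (p + 1)"
      "\<And>p i F G. composable (pointwise C S K) p i F G \<Longrightarrow> cube_comp (pointwise C S K) p i F G \<in> K p"
  shows "cubical_omega_category (pointwise C S K)"
proof -
  let ?P = "pointwise C S K"
  have mem: "F n A \<in> cells (S n) p" if "F \<in> K p" "A \<in> cells C n" for F n A p
    by (rule PiE_mem[OF K[OF that(1)] that(2)])
  have com: "composable (S n) p i (F n A) (G n A)" if "composable ?P p i F G" "A \<in> cells C n" for p i F G n A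
    by (rule composable_pointwise[OF that]) (rule mem[OF _ that(2)])
  have eq: "F = G" if "\<And>n A. A \<in> cells C n \<Longrightarrow> F n A = G n A"
    "\<And>n A. A \<notin> cells C n \<Longrightarrow> F n A = undefined" "\<And>n A. A \<notin> cells C n \<Longrightarrow> G n A = undefined" for F G :: "nat \<Rightarrow> 'a \<Rightarrow> 'b"
    proof (intro ext)
    fix n A show "F n A = G n A" by (cases "A \<in> cells C n") (simp_all add: that)
  qed
  have und: "F n A = undefined" if "F \<in> K p" "A \<notin> cells C n" for F n A p
    by (rule PiE_arb[OF K[OF that(1)] that(2)])
  show ?thesis
  proof (unfold_locales, unfold cells_pointwise, goal_cases)
    case 1 then show ?case by (rule cl)
  next
    case 2 then show ?case by (rule cl)
  next
    case 3 then show ?case by (rule cl)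
  next
    case 4 then show ?case by (rule cl)
  next
    case 5 show ?case
    proof (rule eq, goal_cases)
      case (1 n A)
      show ?case unfolding pointwise_apply[OF 1]
        by (rule cubical_omega_category.face_face[OF S]) (use 5 mem[OF 5(1) 1] in simp_all)
    qed (simp_all add: pointwise_undefined)
  next
    case 6 show ?case
    proof (rule eq, goal_cases)
      case (1 n A)
      show ?case unfolding pointwise_apply[OF 1]
        by (rule cubical_omega_category.face_degen[OF S]) (use 6 mem[OF 6(1) 1] in simp_all)
    qed (simp_all add: pointwise_undefined)
  next
    case 7 show ?case
    proof (rule eq, goal_cases)
      case (1 n A)
      show ?case unfolding pointwise_apply[OF 1]
        by (rule cubical_omega_category.face_degen_same[OF S]) (use 7 mem[OF 7(1) 1] in simp_all)
    qed (simp_all add: pointwise_undefined und[OF 7(1)])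
  next
    case 8 show ?case
    proof (rule eq, goal_cases)
      case (1 n A)
      show ?case unfolding pointwise_apply[OF 1]
        by (rule cubical_omega_category.face_conn[OF S]) (use 8 mem[OF 8(1) 1] in simp_all)
    qed (simp_all add: pointwise_undefined)
  next
    case 9 show ?case
    proof (rule eq, goal_cases)
      case (1 n A)
      show ?case unfolding pointwise_apply[OF 1]
        by (rule cubical_omega_category.face_conn_same[OF S]) (use 9 mem[OF 9(1) 1] in simp_all)
    qed (simp_all add: pointwise_undefined und[OF 9(1)])
  next
    case 10 show ?case
    proof (rule eq, goal_cases)
      case (1 n A)
      show ?case unfolding pointwise_apply[OF 1]
        by (rule cubical_omega_category.face_conn_opposite[OF S]) (use 10 mem[OF 10(1) 1] in simp_all)
    qed (simp_all add: pointwise_undefined)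
  next
    case 11 show ?case
    proof (rule eq, goal_cases)
      case (1 n A)
      show ?case unfolding pointwise_apply[OF 1]
        by (rule cubical_omega_category.degen_degen[OF S]) (use 11 mem[OF 11(1) 1] in simp_all)
    qed (simp_all add: pointwise_undefined)
  next
    case 12 show ?case
    proof (rule eq, goal_cases)
      case (1 n A)
      show ?case unfolding pointwise_apply[OF 1]
        by (rule cubical_omega_category.conn_conn[OF S]) (use 12 mem[OF 12(1) 1] in simp_all)
    qed (simp_all add: pointwise_undefined)
  next
    case 13 show ?case
    proof (rule eq, goal_cases)
      case (1 n A)
      show ?case unfolding pointwise_apply[OF 1]
        by (rule cubical_omega_category.conn_conn_same[OF S]) (use 13 mem[OF 13(1) 1] in simp_all)
    qed (simp_all add: pointwise_undefined)
  next
    case 14 show ?case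
    proof (rule eq, goal_cases)
      case (1 n A)
      show ?case unfolding pointwise_apply[OF 1]
        by (rule cubical_omega_category.conn_degen[OF S]) (use 14 mem[OF 14(1) 1] in simp_all)
    qed (simp_all add: pointwise_undefined)
  next
    case 15 show ?case
    proof (rule eq, goal_cases)
      case (1 n A)
      show ?case unfolding pointwise_apply[OF 1]
        by (rule cubical_omega_category.conn_degen_same[OF S]) (use 15 mem[OF 15(1) 1] in simp_all)
    qed (simp_all add: pointwise_undefined)
  next
    case 16 show ?case
    proof (rule eq, goal_cases)
      case (1 n A)
      show ?case unfolding pointwise_apply[OF 1]
        by (rule cubical_omega_category.face_comp[OF S]) (use 16 com[OF 16(1) 1] in simp_all)
    qed (simp_all add: pointwise_undefined)
  next
    case 17 show ?case
    proof (rule eq, goal_cases)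
      case (1 n A)
      show ?case unfolding pointwise_apply[OF 1]
        by (rule cubical_omega_category.face_comp_Minus[OF S]) (use 17 com[OF 17 1] in simp_all)
    qed (simp_all add: pointwise_undefined)
  next
    case 18 show ?case
    proof (rule eq, goal_cases)
      case (1 n A)
      show ?case unfolding pointwise_apply[OF 1]
        by (rule cubical_omega_category.face_comp_Plus[OF S]) (use 18 com[OF 18 1] in simp_all)
    qed (simp_all add: pointwise_undefined)
  next
    case 19 show ?case
    proof (rule eq, goal_cases)
      case (1 n A)
      show ?case unfolding pointwise_apply[OF 1]
        by (rule cubical_omega_category.comp_assoc[OF S]) (use 19 com[OF 19(1) 1] com[OF 19(2) 1] in simp_all)
    qed (simp_all add: pointwise_undefined)
  next
    case 20 show ?case
    proof (rule eq, goal_cases)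
      case (1 n A)
      show ?case unfolding pointwise_apply[OF 1]
        by (rule cubical_omega_category.comp_degen_right[OF S]) (use 20 mem[OF 20(1) 1] in simp_all)
    qed (simp_all add: pointwise_undefined und[OF 20(1)])
  next
    case 21 show ?case
    proof (rule eq, goal_cases)
      case (1 n A)
      show ?case unfolding pointwise_apply[OF 1]
        by (rule cubical_omega_category.comp_degen_left[OF S]) (use 21 mem[OF 21(1) 1] in simp_all)
    qed (simp_all add: pointwise_undefined und[OF 21(1)])
  next
    case 22 show ?case
    proof (rule eq, goal_cases)
      case (1 n A)
      show ?case unfolding pointwise_apply[OF 1]
        by (rule cubical_omega_category.interchange[OF S]) (use 22 com[OF 22(1) 1] com[OF 22(2) 1] com[OF 22(3) 1] com[OF 22(4) 1] in simp_all)
    qed (simp_all add: pointwise_undefined)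
  next
    case 23 show ?case
    proof (rule eq, goal_cases)
      case (1 n A)
      show ?case unfolding pointwise_apply[OF 1]
        by (rule cubical_omega_category.degen_comp[OF S]) (use 23 com[OF 23(1) 1] in simp_all)
    qed (simp_all add: pointwise_undefined)
  next
    case 24 show ?case
    proof (rule eq, goal_cases)
      case (1 n A)
      show ?case unfolding pointwise_apply[OF 1]
        by (rule cubical_omega_category.conn_comp[OF S]) (use 24 com[OF 24(1) 1] in simp_all)
    qed (simp_all add: pointwise_undefined)
  next
    case 25 show ?case
    proof (rule eq, goal_cases)
      case (1 n A)
      show ?case unfolding pointwise_apply[OF 1]
        by (rule cubical_omega_category.conn_comp_Minus[OF S]) (use 25 com[OF 25 1] in simp_all)
    qed (simp_all add: pointwise_undefined)
  next
    case 26 show ?case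
    proof (rule eq, goal_cases)
      case (1 n A)
      show ?case unfolding pointwise_apply[OF 1]
        by (rule cubical_omega_category.conn_comp_Plus[OF S]) (use 26 com[OF 26 1] in simp_all)
    qed (simp_all add: pointwise_undefined)
  next
    case 27 show ?case
    proof (rule eq, goal_cases)
      case (1 n A)
      show ?case unfolding pointwise_apply[OF 1]
        by (rule cubical_omega_category.conn_transport[OF S]) (use 27 mem[OF 27(1) 1] in simp_all)
    qed (simp_all add: pointwise_undefined)
  next
    case 28 show ?case
    proof (rule eq, goal_cases)
      case (1 n A)
      show ?case unfolding pointwise_apply[OF 1]
        by (rule cubical_omega_category.conn_transport_Suc[OF S]) (use 28 mem[OF 28(1) 1] in simp_all)
    qed (simp_all add: pointwise_undefined)
  qed
qed

text \<open>Of the n + p directions of a value, the operations on lax p-transfors use the first p,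
  those on oplax p-transfors the last p.\<close>

lemma PsLax_pointwise: "PsLax C D = pointwise C (\<lambda>n. shifted D n 0) (cells (PsLax C D))"
  by (simp add: PsLax_def Lax_def pointwise_def)

lemma PsOpLax_pointwise: "PsOpLax C D = pointwise C (\<lambda>n. shifted D n n) (cells (PsOpLax C D))"
  by (simp add: PsOpLax_def OpLax_def pointwise_def)

lemma lax_transforD:
  assumes "lax_transfor C D p F"
  shows "F n \<in> cells C n \<rightarrow>\<^sub>E cells D (n + p)"
    "\<lbrakk>A \<in> cells C n; 1 \<le> i; i \<le> n\<rbrakk> \<Longrightarrow> F (n - 1) (face C n i \<alpha> A) = face D (n + p) (p + i) \<alpha> (F n A)"
    "\<lbrakk>A \<in> cells C n; 1 \<le> i; i \<le> n + 1\<rbrakk> \<Longrightarrow> F (n + 1) (degen C n i A) = degen D (n + p) (p + i) (F n A)"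
    "\<lbrakk>A \<in> cells C n; 1 \<le> i; i \<le> n\<rbrakk> \<Longrightarrow> F (n + 1) (conn C n i \<alpha> A) = conn D (n + p) (p + i) \<alpha> (F n A)"
    "composable C n i A B \<Longrightarrow> F n (cube_comp C n i A B) = cube_comp D (n + p) (p + i) (F n A) (F n B)"
  using assms unfolding lax_transfor_def by auto

lemma oplax_transforD:
  assumes "oplax_transfor C D p F"
  shows "F n \<in> cells C n \<rightarrow>\<^sub>E cells D (n + p)"
    "\<lbrakk>A \<in> cells C n; 1 \<le> i; i \<le> n\<rbrakk> \<Longrightarrow> F (n - 1) (face C n i \<alpha> A) = face D (n + p) i \<alpha> (F n A)"
    "\<lbrakk>A \<in> cells C n; 1 \<le> i; i \<le> n + 1\<rbrakk> \<Longrightarrow> F (n + 1) (degen C n i A) = degen D (n + p) i (F n A)"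
    "\<lbrakk>A \<in> cells C n; 1 \<le> i; i \<le> n\<rbrakk> \<Longrightarrow> F (n + 1) (conn C n i \<alpha> A) = conn D (n + p) i \<alpha> (F n A)"
    "composable C n i A B \<Longrightarrow> F n (cube_comp C n i A B) = cube_comp D (n + p) i (F n A) (F n B)"
  using assms unfolding oplax_transfor_def by auto

locale cubical_pair = C: cubical_omega_category C + D: cubical_omega_category D
  for C :: "'a cubical" and D :: "'b cubical"
begin

text \<open>A relation rather than a map, to be used from either side; extensionality makes each of
  the two families determine the other.\<close>

definition corresponding :: "nat \<Rightarrow> (nat \<Rightarrow> 'a \<Rightarrow> 'b) \<Rightarrow> (nat \<Rightarrow> 'a \<Rightarrow> 'b) \<Rightarrow> bool" where
  "corresponding p F G \<longleftrightarrow> (\<forall>n. F n \<in> extensional (cells C n) \<and> G n \<in> extensional (cells C n) \<and>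
     (\<forall>A \<in> cells C n. D.shuffle n p (F n A) (G n A)))"

text \<open>In each condition the two cells compared on the lax side are shuffled to those compared
  on the oplax side. As \<open>shuffle\<close> is one-to-one, the conditions are equivalent one by
  one.\<close>

lemma lax_iff_oplax:
  assumes R: "corresponding p F G"
  shows "lax_transfor C D p F \<longleftrightarrow> oplax_transfor C D p G"
proof -
  have sh: "D.shuffle n p (F n A) (G n A)" if "A \<in> cells C n" for n A
    using R that by (auto simp: corresponding_def)
  have PiE: "F n \<in> cells C n \<rightarrow>\<^sub>E cells D (n + p)" "G n \<in> cells C n \<rightarrow>\<^sub>E cells D (n + p)" for n
    using R D.shuffle_cl[OF sh] by (auto simp: corresponding_def PiE_def)
  have face: "face D (n + p) (p + i) \<alpha> (F n A) = F (n - 1) (face C n i \<alpha> A) \<longleftrightarrow>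
      face D (n + p) i \<alpha> (G n A) = G (n - 1) (face C n i \<alpha> A)" if A: "A \<in> cells C n" "1 \<le> i" "i \<le> n" for n i \<alpha> A
  proof -
    obtain m where n: "n = Suc m" using A by (cases n) auto
    have "D.shuffle m p (face D (n + p) (p + i) \<alpha> (F n A)) (face D (n + p) i \<alpha> (G n A))"
      using D.shuffle_fc[of m p "F n A" "G n A" i \<alpha>] sh[OF A(1)] A n by simp
    moreover have "D.shuffle m p (F m (face C n i \<alpha> A)) (G m (face C n i \<alpha> A))"
      using C.face_cell[OF A] n by (intro sh) simp
    ultimately show ?thesis using D.shuffle_unique D.shuffle_inj n by auto
  qed
  have degen: "F (n + 1) (degen C n i A) = degen D (n + p) (p + i) (F n A) \<longleftrightarrow>
      G (n + 1) (degen C n i A) = degen D (n + p) i (G n A)" if A: "A \<in> cells C n" "1 \<le> i" "i \<le> n + 1" for n i A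
  proof -
    have "D.shuffle (n + 1) p (degen D (n + p) (p + i) (F n A)) (degen D (n + p) i (G n A))"
      using D.shuffle_dg[of n p "F n A" "G n A" i] sh[OF A(1)] A by simp
    moreover have "D.shuffle (n + 1) p (F (n + 1) (degen C n i A)) (G (n + 1) (degen C n i A))"
      by (rule sh[OF C.degen_cell[OF A]])
    ultimately show ?thesis using D.shuffle_unique D.shuffle_inj by metis
  qed
  have conn: "F (n + 1) (conn C n i \<alpha> A) = conn D (n + p) (p + i) \<alpha> (F n A) \<longleftrightarrow>
      G (n + 1) (conn C n i \<alpha> A) = conn D (n + p) i \<alpha> (G n A)" if A: "A \<in> cells C n" "1 \<le> i" "i \<le> n" for n i \<alpha> A
  proof -
    have "D.shuffle (n + 1) p (conn D (n + p) (p + i) \<alpha> (F n A)) (conn D (n + p) i \<alpha> (G n A))"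
      using D.shuffle_cn[of n p "F n A" "G n A" i \<alpha>] sh[OF A(1)] A by simp
    moreover have "D.shuffle (n + 1) p (F (n + 1) (conn C n i \<alpha> A)) (G (n + 1) (conn C n i \<alpha> A))"
      by (rule sh[OF C.conn_cell[OF A]])
    ultimately show ?thesis using D.shuffle_unique D.shuffle_inj by metis
  qed
  have comp: "F n (cube_comp C n i A B) = cube_comp D (n + p) (p + i) (F n A) (F n B) \<longleftrightarrow>
      G n (cube_comp C n i A B) = cube_comp D (n + p) i (G n A) (G n B)"
    if c: "composable C n i A B"
      and f: "face D (n + p) (p + i) Plus (F n A) = face D (n + p) (p + i) Minus (F n B)" for n i A B
  proof -
    from c have A: "A \<in> cells C n" "B \<in> cells C n" "1 \<le> i" "i \<le> n" by (auto simp: composable_def)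
    have "D.shuffle n p (cube_comp D (n + p) (p + i) (F n A) (F n B)) (cube_comp D (n + p) i (G n A) (G n B))"
      by (rule D.shuffle_cp[OF sh sh _ _ f]) (use A in auto)
    moreover have "D.shuffle n p (F n (cube_comp C n i A B)) (G n (cube_comp C n i A B))"
      by (rule sh[OF C.comp_cell[OF c]])
    ultimately show ?thesis using D.shuffle_unique D.shuffle_inj by metis
  qed
  \<comment> \<open>Composability of the values rests on the face conditions, which must therefore
    be settled before those on composites.\<close>
  have f: "face D (n + p) (p + i) Plus (F n A) = face D (n + p) (p + i) Minus (F n B)"
    if "\<forall>n i \<alpha>. \<forall>A\<in>cells C n. 1 \<le> i \<and> i \<le> n \<longrightarrow> face D (n + p) (p + i) \<alpha> (F n A) = F (n - 1) (face C n i \<alpha> A)"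
      "composable C n i A B" for n i A B
    using that by (simp add: composable_def)
  show ?thesis
  proof
    assume l: "lax_transfor C D p F"
    then show "oplax_transfor C D p G"
      unfolding lax_transfor_def oplax_transfor_def using PiE face degen conn comp f by simp
  next
    assume o: "oplax_transfor C D p G"
    then have "\<forall>n i \<alpha>. \<forall>A\<in>cells C n. 1 \<le> i \<and> i \<le> n \<longrightarrow> face D (n + p) (p + i) \<alpha> (F n A) = F (n - 1) (face C n i \<alpha> A)"
      using face by (simp add: oplax_transfor_def)
    with o show "lax_transfor C D p F"
      unfolding lax_transfor_def oplax_transfor_def using PiE degen conn comp f by simp
  qed
qed

lemma PsLax_iff: "F \<in> cells (PsLax C D) p \<longleftrightarrow> lax_transfor C D p F \<and> (\<exists>G. corresponding p F G)"
proof -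
  have "(\<forall>n. \<forall>A \<in> cells C n. perm_invertible D (n + p) (rho n p) (F n A)) \<longleftrightarrow> (\<exists>G. corresponding p F G)"
    if l: "lax_transfor C D p F"
  proof -
    have m: "F n A \<in> cells D (n + p)" if "A \<in> cells C n" for n A
      using lax_transforD(1)[OF l, of n] that by auto
    have e: "F n \<in> extensional (cells C n)" for n using lax_transforD(1)[OF l, of n] by (simp add: PiE_def)
    have "(\<exists>G. corresponding p F G) \<longleftrightarrow> (\<forall>n. \<forall>A \<in> cells C n. \<exists>Y. D.shuffle n p (F n A) Y)"
    proof
      assume "\<exists>G. corresponding p F G"
      then show "\<forall>n. \<forall>A \<in> cells C n. \<exists>Y. D.shuffle n p (F n A) Y" by (auto simp: corresponding_def)
    next
      assume s: "\<forall>n. \<forall>A \<in> cells C n. \<exists>Y. D.shuffle n p (F n A) Y"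
      have "corresponding p F (\<lambda>n. \<lambda>A \<in> cells C n. SOME Y. D.shuffle n p (F n A) Y)"
        using s e by (auto simp: corresponding_def intro: someI_ex)
      then show "\<exists>G. corresponding p F G" by blast
    qed
    then show ?thesis using D.perm_invertible_rho[OF m] by auto
  qed
  then show ?thesis by (auto simp: PsLax_def Lax_def)
qed

lemma PsOpLax_iff: "G \<in> cells (PsOpLax C D) p \<longleftrightarrow> oplax_transfor C D p G \<and> (\<exists>F. corresponding p F G)"
proof -
  have "(\<forall>n. \<forall>A \<in> cells C n. perm_invertible D (n + p) (rho p n) (G n A)) \<longleftrightarrow> (\<exists>F. corresponding p F G)"
    if l: "oplax_transfor C D p G"
  proof -
    have m: "G n A \<in> cells D (n + p)" if "A \<in> cells C n" for n A
      using oplax_transforD(1)[OF l, of n] that by auto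
    have e: "G n \<in> extensional (cells C n)" for n using oplax_transforD(1)[OF l, of n] by (simp add: PiE_def)
    have "(\<exists>F. corresponding p F G) \<longleftrightarrow> (\<forall>n. \<forall>A \<in> cells C n. \<exists>X. D.shuffle n p X (G n A))"
    proof
      assume "\<exists>F. corresponding p F G"
      then show "\<forall>n. \<forall>A \<in> cells C n. \<exists>X. D.shuffle n p X (G n A)" by (auto simp: corresponding_def)
    next
      assume s: "\<forall>n. \<forall>A \<in> cells C n. \<exists>X. D.shuffle n p X (G n A)"
      have "corresponding p (\<lambda>n. \<lambda>A \<in> cells C n. SOME X. D.shuffle n p X (G n A)) G"
        using s e by (auto simp: corresponding_def intro: someI_ex)
      then show "\<exists>F. corresponding p F G" by blast
    qed
    then show ?thesis using D.perm_invertible_rho_swap[OF m] by auto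
  qed
  then show ?thesis by (auto simp: PsOpLax_def OpLax_def)
qed

end

lemma PsLax_apply:
  assumes "A \<in> cells C n"
  shows "face (PsLax C D) p i \<alpha> F n A = face D (n + p) i \<alpha> (F n A)"
    "degen (PsLax C D) p i F n A = degen D (n + p) i (F n A)"
    "conn (PsLax C D) p i \<alpha> F n A = conn D (n + p) i \<alpha> (F n A)"
    "cube_comp (PsLax C D) p i F G n A = cube_comp D (n + p) i (F n A) (G n A)"
  using assms by (simp_all add: PsLax_def Lax_def)

lemma PsOpLax_apply:
  assumes "A \<in> cells C n"
  shows "face (PsOpLax C D) p i \<alpha> F n A = face D (n + p) (n + i) \<alpha> (F n A)"
    "degen (PsOpLax C D) p i F n A = degen D (n + p) (n + i) (F n A)"
    "conn (PsOpLax C D) p i \<alpha> F n A = conn D (n + p) (n + i) \<alpha> (F n A)"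
    "cube_comp (PsOpLax C D) p i F G n A = cube_comp D (n + p) (n + i) (F n A) (G n A)"
  using assms by (simp_all add: PsOpLax_def OpLax_def)

lemma PsLax_extensional:
  "face (PsLax C D) p i \<alpha> F n \<in> extensional (cells C n)"
  "degen (PsLax C D) p i F n \<in> extensional (cells C n)"
  "conn (PsLax C D) p i \<alpha> F n \<in> extensional (cells C n)"
  "cube_comp (PsLax C D) p i F G n \<in> extensional (cells C n)"
  by (simp_all add: PsLax_def Lax_def)

lemma PsOpLax_extensional:
  "face (PsOpLax C D) p i \<alpha> F n \<in> extensional (cells C n)"
  "degen (PsOpLax C D) p i F n \<in> extensional (cells C n)"
  "conn (PsOpLax C D) p i \<alpha> F n \<in> extensional (cells C n)"
  "cube_comp (PsOpLax C D) p i F G n \<in> extensional (cells C n)"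
  by (simp_all add: PsOpLax_def OpLax_def)

section \<open>Closure under the operations, and the isomorphism\<close>

context cubical_pair
begin

lemma lax_transforI:
  assumes "\<And>n. F n \<in> extensional (cells C n)"
    and "\<And>n A. A \<in> cells C n \<Longrightarrow> F n A \<in> cells D (n + p)"
    and f: "\<And>n i \<alpha> A. \<lbrakk>A \<in> cells C (Suc n); 1 \<le> i; i \<le> Suc n; face C (Suc n) i \<alpha> A \<in> cells C n\<rbrakk> \<Longrightarrow>
      F n (face C (Suc n) i \<alpha> A) = face D (Suc n + p) (p + i) \<alpha> (F (Suc n) A)"
    and "\<And>n i A. \<lbrakk>A \<in> cells C n; 1 \<le> i; i \<le> Suc n; degen C n i A \<in> cells C (Suc n)\<rbrakk> \<Longrightarrow>
      F (Suc n) (degen C n i A) = degen D (n + p) (p + i) (F n A)"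
    and "\<And>n i \<alpha> A. \<lbrakk>A \<in> cells C n; 1 \<le> i; i \<le> n; conn C n i \<alpha> A \<in> cells C (Suc n)\<rbrakk> \<Longrightarrow>
      F (Suc n) (conn C n i \<alpha> A) = conn D (n + p) (p + i) \<alpha> (F n A)"
    and "\<And>n i A B. \<lbrakk>composable C n i A B; A \<in> cells C n; B \<in> cells C n; 1 \<le> i; i \<le> n;
        cube_comp C n i A B \<in> cells C n\<rbrakk> \<Longrightarrow>
      F n (cube_comp C n i A B) = cube_comp D (n + p) (p + i) (F n A) (F n B)"
  shows "lax_transfor C D p F"
proof -
  have "face D (n + p) (p + i) \<alpha> (F n A) = F (n - 1) (face C n i \<alpha> A)"
    if A: "A \<in> cells C n" "1 \<le> i" "i \<le> n" for n i \<alpha> A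
  proof -
    obtain m where "n = Suc m" using A by (cases n) auto
    then show ?thesis using f[of A m i \<alpha>] A C.fc_cl[of A m i \<alpha>] by simp
  qed
  moreover have "F n (cube_comp C n i A B) = cube_comp D (n + p) (p + i) (F n A) (F n B)"
    if "composable C n i A B" for n i A B
    using assms(6)[OF that] C.comp_cell[OF that] that by (simp add: composable_def)
  ultimately show ?thesis
    unfolding lax_transfor_def using assms by (simp add: PiE_def)
qed

lemma lax_cell: "lax_transfor C D p F \<Longrightarrow> A \<in> cells C n \<Longrightarrow> F n A \<in> cells D (n + p)"
  using lax_transforD(1)[of C D p F n] by auto

lemma lax_face: "\<lbrakk>lax_transfor C D p F; A \<in> cells C (Suc n); 1 \<le> i; i \<le> Suc n\<rbrakk> \<Longrightarrow>
    F n (face C (Suc n) i \<alpha> A) = face D (Suc (n + p)) (p + i) \<alpha> (F (Suc n) A)"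
  using lax_transforD(2)[of C D p F A "Suc n" i] by simp

lemma lax_degen: "\<lbrakk>lax_transfor C D p F; A \<in> cells C n; 1 \<le> i; i \<le> Suc n\<rbrakk> \<Longrightarrow>
    F (Suc n) (degen C n i A) = degen D (n + p) (p + i) (F n A)"
  using lax_transforD(3)[of C D p F A n i] by simp

lemma lax_conn: "\<lbrakk>lax_transfor C D p F; A \<in> cells C n; 1 \<le> i; i \<le> n\<rbrakk> \<Longrightarrow>
    F (Suc n) (conn C n i \<alpha> A) = conn D (n + p) (p + i) \<alpha> (F n A)"
  using lax_transforD(4)[of C D p F A n i] by simp

lemma lax_composable:
  assumes "lax_transfor C D p F" "composable C n i A B"
  shows "face D (n + p) (p + i) Plus (F n A) = face D (n + p) (p + i) Minus (F n B)"
  using lax_transforD(2)[OF assms(1), of A n i Plus] lax_transforD(2)[OF assms(1), of B n i Minus] assms(2)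
  by (simp add: composable_def)

text \<open>The operation on transfors acts in one of the first directions, the conditions concern
  the last n. Each condition, here and in the next three lemmas, is thus a commutation law of
  \<open>D\<close> for two different directions.\<close>

lemma lax_transfor_face:
  assumes F: "lax_transfor C D p F" and k: "1 \<le> k" "k \<le> p"
  shows "lax_transfor C D (p - 1) (face (PsLax C D) p k \<beta> F)"
proof -
  obtain q where p: "p = Suc q" using k by (cases p) auto
  note F = F[unfolded p] and k = k[unfolded p]
  note l = lax_cell[OF F] and ax = D.fc_fc D.fc_dg_less D.fc_cn_less D.fc_cp_less
  show ?thesis unfolding p diff_Suc_1
  proof (rule lax_transforI, goal_cases)
    case 1 then show ?case by (rule PsLax_extensional)
  next
    case (2 n A) then show ?case using l[OF 2] k D.fc_cl[of "F n A" "n + q" k \<beta>] by (simp add: PsLax_apply)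
  next
    case (3 n i \<alpha> A)
    then show ?case using l[OF 3(1)] k D.fc_fc[of "F (Suc n) A" "n + q" k "q + i" \<alpha> \<beta>]
      by (simp add: PsLax_apply lax_face[OF F])
  next
    case (4 n i A)
    then show ?case using l[OF 4(1)] k D.fc_dg_less[of "F n A" "n + q" k "Suc q + i" \<beta>]
      by (simp add: PsLax_apply lax_degen[OF F])
  next
    case (5 n i \<alpha> A)
    then show ?case using l[OF 5(1)] k D.fc_cn_less[of "F n A" "n + q" k "Suc q + i" \<beta> \<alpha>]
      by (simp add: PsLax_apply lax_conn[OF F])
  next
    case (6 n i A B)
    then show ?case using l[OF 6(2)] l[OF 6(3)] k lax_composable[OF F 6(1)]
      D.fc_cp_less[of "F n A" "n + q" "F n B" "Suc q + i" k \<beta>]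
      by (simp add: PsLax_apply lax_transforD(5)[OF F 6(1)])
  qed
qed

lemma lax_transfor_degen:
  assumes F: "lax_transfor C D p F" and k: "1 \<le> k" "k \<le> p + 1"
  shows "lax_transfor C D (p + 1) (degen (PsLax C D) p k F)"
proof -
  note l = lax_cell[OF F]
  show ?thesis
  proof (rule lax_transforI, goal_cases)
    case 1 then show ?case by (rule PsLax_extensional)
  next
    case (2 n A) then show ?case using l[OF 2] k D.dg_cl[of "F n A" "n + p" k] by (simp add: PsLax_apply)
  next
    case (3 n i \<alpha> A)
    then show ?case using l[OF 3(1)] k D.fc_dg_greater[of "F (Suc n) A" "n + p" k "Suc (p + i)" \<alpha>]
      by (simp add: PsLax_apply lax_face[OF F])
  next
    case (4 n i A)
    then show ?case using l[OF 4(1)] k D.dg_dg[of "F n A" "n + p" k "p + i"]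
      by (simp add: PsLax_apply lax_degen[OF F])
  next
    case (5 n i \<alpha> A)
    then show ?case using l[OF 5(1)] k D.cn_dg_greater[of "F n A" "n + p" k "Suc (p + i)" \<alpha>]
      by (simp add: PsLax_apply lax_conn[OF F])
  next
    case (6 n i A B)
    then show ?case using l[OF 6(2)] l[OF 6(3)] k lax_composable[OF F 6(1)]
      D.dg_cp_le[of "F n A" "n + p" "F n B" "p + i" k]
      by (simp add: PsLax_apply lax_transforD(5)[OF F 6(1)])
  qed
qed

lemma lax_transfor_conn:
  assumes F: "lax_transfor C D p F" and k: "1 \<le> k" "k \<le> p"
  shows "lax_transfor C D (p + 1) (conn (PsLax C D) p k \<beta> F)"
proof -
  note l = lax_cell[OF F]
  show ?thesis
  proof (rule lax_transforI, goal_cases)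
    case 1 then show ?case by (rule PsLax_extensional)
  next
    case (2 n A) then show ?case using l[OF 2] k D.cn_cl[of "F n A" "n + p" k] by (simp add: PsLax_apply)
  next
    case (3 n i \<alpha> A)
    then show ?case using l[OF 3(1)] k D.fc_cn_greater[of "F (Suc n) A" "n + p" k "Suc (p + i)" \<alpha> \<beta>]
      by (simp add: PsLax_apply lax_face[OF F])
  next
    case (4 n i A)
    then show ?case using l[OF 4(1)] k D.cn_dg_less[of "F n A" "n + p" k "p + i" \<beta>]
      by (simp add: PsLax_apply lax_degen[OF F])
  next
    case (5 n i \<alpha> A)
    then show ?case using l[OF 5(1)] k D.cn_cn[of "F n A" "n + p" k "p + i" \<beta> \<alpha>]
      by (simp add: PsLax_apply lax_conn[OF F])
  next
    case (6 n i A B)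
    then show ?case using l[OF 6(2)] l[OF 6(3)] k lax_composable[OF F 6(1)]
      D.cn_cp_less[of "F n A" "n + p" "F n B" "p + i" k]
      by (simp add: PsLax_apply lax_transforD(5)[OF F 6(1)])
  qed
qed

lemma lax_transfor_comp:
  assumes F: "lax_transfor C D p F" and G: "lax_transfor C D p G" and k: "1 \<le> k" "k \<le> p"
    and e: "face (PsLax C D) p k Plus F = face (PsLax C D) p k Minus G"
  shows "lax_transfor C D p (cube_comp (PsLax C D) p k F G)"
proof -
  note l = lax_cell[OF F] lax_cell[OF G]
  have e': "face D (n + p) k Plus (F n A) = face D (n + p) k Minus (G n A)" if "A \<in> cells C n" for n A
    using fun_cong[OF fun_cong[OF e, of n], of A] that by (simp add: PsLax_apply)
  show ?thesis
  proof (rule lax_transforI, goal_cases)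
    case 1 then show ?case by (rule PsLax_extensional)
  next
    case (2 n A) then show ?case using l[OF 2] k e'[OF 2] by (simp add: PsLax_apply)
  next
    case (3 n i \<alpha> A)
    then show ?case using l[OF 3(1)] k e'[OF 3(1)]
        D.fc_cp_greater[of "F (Suc n) A" "n + p" "G (Suc n) A" k "p + i" \<alpha>]
      by (simp add: PsLax_apply lax_face[OF F] lax_face[OF G])
  next
    case (4 n i A)
    then show ?case using l[OF 4(1)] k e'[OF 4(1)] D.dg_cp_greater[of "F n A" "n + p" "G n A" k "p + i"]
      by (simp add: PsLax_apply lax_degen[OF F] lax_degen[OF G])
  next
    case (5 n i \<alpha> A)
    then show ?case using l[OF 5(1)] k e'[OF 5(1)] D.cn_cp_greater[of "F n A" "n + p" "G n A" k "p + i" \<alpha>]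
      by (simp add: PsLax_apply lax_conn[OF F] lax_conn[OF G])
  next
    case (6 n i A B)
    then show ?case using l[OF 6(2)] l[OF 6(3)] k lax_composable[OF F 6(1)] lax_composable[OF G 6(1)]
      e'[OF 6(2)] e'[OF 6(3)] D.cp_exch[of "F n A" "n + p" "F n B" "G n A" "G n B" "p + i" k]
      by (simp add: PsLax_apply lax_transforD(5)[OF F 6(1)] lax_transforD(5)[OF G 6(1)])
  qed
qed

lemma correspondingI:
  assumes "\<And>n. F n \<in> extensional (cells C n)" "\<And>n. G n \<in> extensional (cells C n)"
    "\<And>n A. A \<in> cells C n \<Longrightarrow> D.shuffle n p (F n A) (G n A)"
  shows "corresponding p F G"
  using assms by (simp add: corresponding_def)

lemma correspondingD: "corresponding p F G \<Longrightarrow> A \<in> cells C n \<Longrightarrow> D.shuffle n p (F n A) (G n A)"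
  by (simp add: corresponding_def)

lemma corresponding_ext: "corresponding p F G \<Longrightarrow> F n \<in> extensional (cells C n)"
  "corresponding p F G \<Longrightarrow> G n \<in> extensional (cells C n)"
  by (simp_all add: corresponding_def)

lemma corresponding_unique:
  assumes "corresponding p F G" "corresponding p F G'"
  shows "G = G'"
proof
  fix n show "G n = G' n"
    by (rule extensionalityI[OF assms[THEN corresponding_ext(2)]])
      (rule D.shuffle_unique[OF assms[THEN correspondingD]])
qed

lemma corresponding_inj:
  assumes "corresponding p F G" "corresponding p F' G"
  shows "F = F'"
proof
  fix n show "F n = F' n"
    by (rule extensionalityI[OF assms[THEN corresponding_ext(1)]])
      (rule D.shuffle_inj[OF assms[THEN correspondingD]])
qed

lemma corresponding_face:
  assumes "corresponding p F G" "1 \<le> k" "k \<le> p"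
  shows "corresponding (p - 1) (face (PsLax C D) p k \<alpha> F) (face (PsOpLax C D) p k \<alpha> G)"
proof -
  obtain q where "p = Suc q" using assms(2,3) by (cases p) auto
  then show ?thesis using D.shuffle_fc_mark[OF correspondingD] assms
    by (intro correspondingI PsLax_extensional PsOpLax_extensional) (simp add: PsLax_apply PsOpLax_apply)
qed

lemma corresponding_degen:
  assumes "corresponding p F G" "1 \<le> k" "k \<le> p + 1"
  shows "corresponding (p + 1) (degen (PsLax C D) p k F) (degen (PsOpLax C D) p k G)"
  using D.shuffle_dg_mark[OF correspondingD] assms
  by (intro correspondingI PsLax_extensional PsOpLax_extensional) (simp add: PsLax_apply PsOpLax_apply)

lemma corresponding_conn:
  assumes "corresponding p F G" "1 \<le> k" "k \<le> p"
  shows "corresponding (p + 1) (conn (PsLax C D) p k \<alpha> F) (conn (PsOpLax C D) p k \<alpha> G)"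
  using D.shuffle_cn_mark[OF correspondingD] assms
  by (intro correspondingI PsLax_extensional PsOpLax_extensional) (simp add: PsLax_apply PsOpLax_apply)

lemma corresponding_comp:
  assumes "corresponding p F G" "corresponding p F' G'" "1 \<le> k" "k \<le> p"
    and e: "face (PsLax C D) p k Plus F = face (PsLax C D) p k Minus F'"
  shows "corresponding p (cube_comp (PsLax C D) p k F F') (cube_comp (PsOpLax C D) p k G G')"
proof -
  have "face D (n + p) k Plus (F n A) = face D (n + p) k Minus (F' n A)" if "A \<in> cells C n" for n A
    using fun_cong[OF fun_cong[OF e, of n], of A] that by (simp add: PsLax_apply)
  then show ?thesis using D.shuffle_cp_mark[OF correspondingD correspondingD] assms(1-4)
    by (intro correspondingI PsLax_extensional PsOpLax_extensional) (simp add: PsLax_apply PsOpLax_apply)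
qed

definition transport :: "nat \<Rightarrow> (nat \<Rightarrow> 'a \<Rightarrow> 'b) \<Rightarrow> nat \<Rightarrow> 'a \<Rightarrow> 'b" where
  "transport p F = (THE G. corresponding p F G)"

lemma transport_eq: "corresponding p F G \<Longrightarrow> transport p F = G"
  unfolding transport_def using corresponding_unique by blast

lemma PsLaxE:
  assumes "F \<in> cells (PsLax C D) p"
  obtains "lax_transfor C D p F" "corresponding p F (transport p F)"
  using assms PsLax_iff transport_eq by metis

lemma PsOpLaxE:
  assumes "G \<in> cells (PsOpLax C D) p"
  obtains F where "F \<in> cells (PsLax C D) p" "corresponding p F G"
  using assms PsLax_iff PsOpLax_iff lax_iff_oplax by metis

lemma PsLaxI: "lax_transfor C D p F \<Longrightarrow> corresponding p F G \<Longrightarrow> F \<in> cells (PsLax C D) p"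
  using PsLax_iff by blast

lemma PsOpLaxI: "F \<in> cells (PsLax C D) p \<Longrightarrow> corresponding p F G \<Longrightarrow> G \<in> cells (PsOpLax C D) p"
  using PsLax_iff PsOpLax_iff lax_iff_oplax by metis

lemma PsLax_face: "\<lbrakk>F \<in> cells (PsLax C D) p; 1 \<le> k; k \<le> p\<rbrakk> \<Longrightarrow>
    face (PsLax C D) p k \<alpha> F \<in> cells (PsLax C D) (p - 1)"
  by (elim PsLaxE) (rule PsLaxI[OF lax_transfor_face corresponding_face])

lemma PsLax_degen: "\<lbrakk>F \<in> cells (PsLax C D) p; 1 \<le> k; k \<le> p + 1\<rbrakk> \<Longrightarrow>
    degen (PsLax C D) p k F \<in> cells (PsLax C D) (p + 1)"
  by (elim PsLaxE) (rule PsLaxI[OF lax_transfor_degen corresponding_degen])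

lemma PsLax_conn: "\<lbrakk>F \<in> cells (PsLax C D) p; 1 \<le> k; k \<le> p\<rbrakk> \<Longrightarrow>
    conn (PsLax C D) p k \<alpha> F \<in> cells (PsLax C D) (p + 1)"
  by (elim PsLaxE) (rule PsLaxI[OF lax_transfor_conn corresponding_conn])

lemma PsLax_comp: "composable (PsLax C D) p k F G \<Longrightarrow> cube_comp (PsLax C D) p k F G \<in> cells (PsLax C D) p"
  unfolding composable_def
  by (elim conjE PsLaxE) (rule PsLaxI[OF lax_transfor_comp corresponding_comp])

text \<open>Faces of corresponding families correspond, and the lax one is determined by the oplax
  one.\<close>

lemma composable_corresponding:
  assumes "composable (PsOpLax C D) p k G G'" "corresponding p F G" "corresponding p F' G'"
    "F \<in> cells (PsLax C D) p" "F' \<in> cells (PsLax C D) p"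
  shows "composable (PsLax C D) p k F F'"
proof -
  have k: "1 \<le> k" "k \<le> p" and e: "face (PsOpLax C D) p k Plus G = face (PsOpLax C D) p k Minus G'"
    using assms(1) by (simp_all add: composable_def)
  have "face (PsLax C D) p k Plus F = face (PsLax C D) p k Minus F'"
    using corresponding_face[OF assms(2) k, of Plus] corresponding_face[OF assms(3) k, of Minus]
    unfolding e by (rule corresponding_inj)
  then show ?thesis using assms(4,5) k by (simp add: composable_def)
qed

text \<open>Closure on the oplax side is carried over from the lax side along the
  correspondence.\<close>

lemma PsOpLax_face: "\<lbrakk>G \<in> cells (PsOpLax C D) p; 1 \<le> k; k \<le> p\<rbrakk> \<Longrightarrow>
    face (PsOpLax C D) p k \<alpha> G \<in> cells (PsOpLax C D) (p - 1)"
  by (elim PsOpLaxE) (rule PsOpLaxI[OF PsLax_face corresponding_face])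

lemma PsOpLax_degen: "\<lbrakk>G \<in> cells (PsOpLax C D) p; 1 \<le> k; k \<le> p + 1\<rbrakk> \<Longrightarrow>
    degen (PsOpLax C D) p k G \<in> cells (PsOpLax C D) (p + 1)"
  by (elim PsOpLaxE) (rule PsOpLaxI[OF PsLax_degen corresponding_degen])

lemma PsOpLax_conn: "\<lbrakk>G \<in> cells (PsOpLax C D) p; 1 \<le> k; k \<le> p\<rbrakk> \<Longrightarrow>
    conn (PsOpLax C D) p k \<alpha> G \<in> cells (PsOpLax C D) (p + 1)"
  by (elim PsOpLaxE) (rule PsOpLaxI[OF PsLax_conn corresponding_conn])

lemma PsOpLax_comp:
  assumes c: "composable (PsOpLax C D) p k G G'"
  shows "cube_comp (PsOpLax C D) p k G G' \<in> cells (PsOpLax C D) p"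
proof -
  have k: "1 \<le> k" "k \<le> p" "G \<in> cells (PsOpLax C D) p" "G' \<in> cells (PsOpLax C D) p"
    using c by (simp_all add: composable_def)
  obtain F where F: "F \<in> cells (PsLax C D) p" "corresponding p F G" using k(3) by (rule PsOpLaxE)
  obtain F' where F': "F' \<in> cells (PsLax C D) p" "corresponding p F' G'" using k(4) by (rule PsOpLaxE)
  have c': "composable (PsLax C D) p k F F'" by (rule composable_corresponding[OF c F(2) F'(2) F(1) F'(1)])
  then have e: "face (PsLax C D) p k Plus F = face (PsLax C D) p k Minus F'" by (simp add: composable_def)
  show ?thesis by (rule PsOpLaxI[OF PsLax_comp[OF c'] corresponding_comp[OF F(2) F'(2) k(1,2) e]])
qed

lemma PsLax_cubical_omega_category: "cubical_omega_category (PsLax C D)"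
proof (subst PsLax_pointwise, rule cubical_omega_category_pointwise, unfold PsLax_pointwise[symmetric], goal_cases)
  case (1 n) show ?case by (rule D.cubical_omega_category_shifted) simp
next
  case (2 p F n)
  then show ?case using lax_transforD(1)[of C D p F n] by (auto elim: PsLaxE)
qed (fact PsLax_face PsLax_degen PsLax_conn PsLax_comp)+

lemma PsOpLax_cubical_omega_category: "cubical_omega_category (PsOpLax C D)"
proof (subst PsOpLax_pointwise, rule cubical_omega_category_pointwise, unfold PsOpLax_pointwise[symmetric], goal_cases)
  case (1 n) show ?case by (rule D.cubical_omega_category_shifted) simp
next
  case (2 p F n)
  then show ?case using oplax_transforD(1)[of C D p F n] PsOpLax_iff by simp
qed (fact PsOpLax_face PsOpLax_degen PsOpLax_conn PsOpLax_comp)+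

lemma cubical_functor_transport: "cubical_functor (PsLax C D) (PsOpLax C D) transport"
  unfolding cubical_functor_def
proof (intro conjI allI ballI impI; (elim conjE)?)
  fix p F assume "F \<in> cells (PsLax C D) p"
  then show "transport p F \<in> cells (PsOpLax C D) p" by (metis PsLaxE PsOpLaxI)
next
  fix p k \<alpha> F assume "F \<in> cells (PsLax C D) p" "1 \<le> k" "k \<le> p"
  then show "transport (p - 1) (face (PsLax C D) p k \<alpha> F) = face (PsOpLax C D) p k \<alpha> (transport p F)"
    by (elim PsLaxE) (rule transport_eq[OF corresponding_face])
next
  fix p k F assume "F \<in> cells (PsLax C D) p" "1 \<le> k" "k \<le> p + 1"
  then show "transport (p + 1) (degen (PsLax C D) p k F) = degen (PsOpLax C D) p k (transport p F)"
    by (elim PsLaxE) (rule transport_eq[OF corresponding_degen])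
next
  fix p k \<alpha> F assume "F \<in> cells (PsLax C D) p" "1 \<le> k" "k \<le> p"
  then show "transport (p + 1) (conn (PsLax C D) p k \<alpha> F) = conn (PsOpLax C D) p k \<alpha> (transport p F)"
    by (elim PsLaxE) (rule transport_eq[OF corresponding_conn])
next
  fix p k F G assume "composable (PsLax C D) p k F G"
  then show "transport p (cube_comp (PsLax C D) p k F G) =
      cube_comp (PsOpLax C D) p k (transport p F) (transport p G)"
    unfolding composable_def by (elim conjE PsLaxE) (rule transport_eq[OF corresponding_comp])
qed

lemma bij_betw_transport: "bij_betw (transport p) (cells (PsLax C D) p) (cells (PsOpLax C D) p)"
  unfolding bij_betw_def
proof
  show "inj_on (transport p) (cells (PsLax C D) p)"
    by (rule inj_onI) (metis PsLaxE corresponding_inj)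
  show "transport p ` cells (PsLax C D) p = cells (PsOpLax C D) p"
  proof (intro equalityI subsetI)
    fix G assume "G \<in> transport p ` cells (PsLax C D) p"
    then show "G \<in> cells (PsOpLax C D) p"
      using cubical_functor_transport by (auto simp: cubical_functor_def)
  next
    fix G assume "G \<in> cells (PsOpLax C D) p"
    then show "G \<in> transport p ` cells (PsLax C D) p"
      by (metis PsOpLaxE transport_eq imageI)
  qed
qed

end

theorem proposition5p2p6:
  fixes C :: "'a cubical" and D :: "'b cubical"
  assumes "cubical_omega_category C" and "cubical_omega_category D"
  shows "cubical_omega_category (PsLax C D) \<and> cubical_omega_category (PsOpLax C D) \<and>
    cubical_isomorphic (PsLax C D) (PsOpLax C D)"
proof -
  interpret cubical_pair C D
    by (rule cubical_pair.intro[OF assms])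
  show ?thesis
    unfolding cubical_isomorphic_def
    using PsLax_cubical_omega_category PsOpLax_cubical_omega_category
      cubical_functor_transport bij_betw_transport by blast
qed

end
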